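(* Let $K\subset\mathbb{C}$ be non-polar, compact and polynomially convex, and let $(q_k)_{k\in\mathbb{N}}$ be a sequence of complex polynomials with degrees $n_k=\deg q_k\to\infty$. Let $(L_k)_k$ be a sequence of compact sets in $\mathbb{C}$ for which $\log(\operatorname{Cap}(L_k))=o(n_k)$ as $k\to\infty$ and such that there exist $N\in\mathbb{N}$ and $r_2>0$ with $L_k\subset\mathbb{D}(r_2)$ for all $k\ge N$. If $(q_k)_{k\in\mathbb{N}}$ is $K$-regular and centers on $K$, then $$\omega_{q_k^{-1}(L_k)}\to\omega_K\quad\text{weak* as } k\to\infty.$$
   Context: $\mathbb{D}(R)=\{z\in\mathbb{C}:|z|<R\}$. Polynomially convex (full) for a compact $K\subset\mathbb{C}$ means that $\Omega:=\mathbb{C}\setminus K$ is connected. The energy of a compactly supported Borel probability measure $\mu$ on $\mathbb{C}$ is $I(\mu)=\iint\log|z-w|\,d\mu(w)\,d\mu(z)\in\{-\infty\}\cup\mathbb{R}$. The (logarithmic) capacity of a compact set $C$ is $\operatorname{Cap}(C)=\sup_\mu e^{I(\mu)}$ over Borel probability measures $\mu$ on $C$ (equal to $0$ exactly when $C$ is polar); for non-polar $C$, the equilibrium measure $\omega_C$ is the unique maximizer. The hypothesis $\log(\operatorname{Cap}(L_k))=o(n_k)$ in particular entails that $L_k$ is non-polar for all large $k$. The Green's function of $\Omega$ with pole at $\infty$ is $g_\Omega(z)=\int\log|z-w|\,d\omega_K(w)-I(\omega_K)$. Weak* convergence $\mu_k\to\mu$ of probability measures means $\int f\,d\mu_k\to\int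 f\,d\mu$ for every compactly supported continuous $f$ on $\mathbb{C}$. All sequences of polynomials considered have degrees tending to infinity, so finitely many terms for which the expressions do not make sense are disregarded. Centering: a sequence $(q_k)_k$ of polynomials centers on a non-empty compact set $C\subset\mathbb{C}$ if there exist $N\in\mathbb{N}$ and $R>0$ such that (1) $q_k^{-1}(\{0\})\subset\mathbb{D}(R)$ for all $k\ge N$; and (2) for every closed set $L\subset\mathbb{C}$ with $L\cap C=\emptyset$ there exists $M=M(L)>0$ such that for all $k\ge N$ the number of zeros of $q_k$ in $L$, counted with multiplicity, is at most $M$. $K$-regularity: a sequence $(q_k)_k$ of polynomials of degrees $n_k$ is $K$-regular if for some $R>0$ (taken large enough that $K\subset\mathbb{D}(R)$) one has $\lim_{k\to\infty}\frac{1}{n_k}\log|q_k(z)|=g_\Omega(z)$ uniformly on $\mathbb{C}\setminus\mathbb{D}(R)$. *)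

theory Defs
  imports
    "HOL-Probability.Probability"
    "HOL-Library.Landau_Symbols"
    "HOL-Computational_Algebra.Polynomial"
begin

section \<open>Logarithmic potential theory in the plane\<close>

text \<open>The kernel is extended-real valued because \<^const>\<open>ln\<close> is totalised by \<open>ln 0 = 0\<close>,
  whereas here \<open>log 0\<close> has to be \<open>-\<infinity>\<close>: point masses must have energy \<open>-\<infinity>\<close>.\<close>

definition log_kernel :: "complex \<Rightarrow> complex \<Rightarrow> ereal" where
  "log_kernel z w = (if z = w then - \<infinity> else ereal (ln (cmod (z - w))))"

text \<open>Integral of an extended-real function, positive part minus negative part. It is meaningful
  when at least one part is finite. Every use below is of this kind: for \<open>\<mu>\<close> of compact support,
  the kernel and the potential are bounded above on the support.\<close>

definition ereal_integral :: "'a measure \<Rightarrow> ('a \<Rightarrow> ereal) \<Rightarrow> ereal" where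
  "ereal_integral M f =
     enn2ereal (\<integral>\<^sup>+ x. e2ennreal (f x) \<partial>M) - enn2ereal (\<integral>\<^sup>+ x. e2ennreal (- f x) \<partial>M)"

definition log_potential :: "complex measure \<Rightarrow> complex \<Rightarrow> ereal" where
  "log_potential \<mu> z = ereal_integral \<mu> (\<lambda>w. log_kernel z w)"

definition log_energy :: "complex measure \<Rightarrow> ereal" where
  "log_energy \<mu> = ereal_integral \<mu> (\<lambda>z. log_potential \<mu> z)"

text \<open>Borel probability measures on \<open>C\<close>, realised as measures on the whole plane carried by \<open>C\<close>,
  so that measures belonging to different sets can be compared.\<close>

definition prob_measures_on :: "complex set \<Rightarrow> complex measure set" where
  "prob_measures_on C = {\<mu>. prob_space \<mu> \<and> sets \<mu> = sets borel \<and> emeasure \<mu> C = 1}"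

text \<open>The notions below are used for compact \<open>C\<close> only.\<close>

definition polar :: "complex set \<Rightarrow> bool" where
  "polar C \<longleftrightarrow> (\<forall>\<mu>\<in>prob_measures_on C. log_energy \<mu> = - \<infinity>)"

definition exp_ereal :: "ereal \<Rightarrow> ennreal" where
  "exp_ereal x = (if x = - \<infinity> then 0 else if x = \<infinity> then \<infinity> else ennreal (exp (real_of_ereal x)))"

text \<open>The supremum is taken in \<^typ>\<open>ennreal\<close> so that the empty set has capacity \<open>0\<close>.\<close>

definition capacity :: "complex set \<Rightarrow> real" where
  "capacity C = enn2real (\<Squnion>\<mu>\<in>prob_measures_on C. exp_ereal (log_energy \<mu>))"

text \<open>Meaningful for non-polar compact sets, where the maximizer of the energy exists and
  is unique.\<close>

definition equilibrium_measure :: "complex set \<Rightarrow> complex measure" where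
  "equilibrium_measure C =
     (THE \<mu>. \<mu> \<in> prob_measures_on C \<and> (\<forall>\<nu>\<in>prob_measures_on C. log_energy \<nu> \<le> log_energy \<mu>))"

text \<open>Green's function of the complement of \<open>K\<close> with pole at infinity. It is used only at points
  \<open>z \<notin> K\<close>, where the potential is finite.\<close>

definition green :: "complex set \<Rightarrow> complex \<Rightarrow> real" where
  "green K z = real_of_ereal
     (log_potential (equilibrium_measure K) z - log_energy (equilibrium_measure K))"

definition polynomially_convex :: "complex set \<Rightarrow> bool" where
  "polynomially_convex K \<longleftrightarrow> connected (- K)"

definition weak_star_tendsto :: "(nat \<Rightarrow> complex measure) \<Rightarrow> complex measure \<Rightarrow> bool" where
  "weak_star_tendsto \<mu> \<nu> \<longleftrightarrow>
     (\<forall>f :: complex \<Rightarrow> real. continuous_on UNIV f \<longrightarrow> compact (closure {z. f z \<noteq> 0}) \<longrightarrow>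
        (\<lambda>k. LINT z|\<mu> k. f z) \<longlonglongrightarrow> (LINT z|\<nu>. f z))"


section \<open>Sequences of polynomials\<close>

text \<open>The multiset \<^term>\<open>proots p\<close> lists the zeros of \<open>p\<close> with multiplicity if \<open>p \<noteq> 0\<close>.
  The polynomial \<open>0\<close> is excluded for \<open>k \<ge> N\<close> by boundedness of the zero set.\<close>

definition centers_on :: "(nat \<Rightarrow> complex poly) \<Rightarrow> complex set \<Rightarrow> bool" where
  "centers_on q C \<longleftrightarrow>
     (\<exists>N. \<exists>R>0.
        (\<forall>k\<ge>N. poly (q k) -` {0} \<subseteq> ball 0 R) \<and>
        (\<forall>L. closed L \<longrightarrow> L \<inter> C = {} \<longrightarrow>
           (\<exists>M>0. \<forall>k\<ge>N. size {# z \<in># proots (q k). z \<in> L #} \<le> M)))"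

text \<open>Nonvanishing is spelled out because of \<open>ln 0 = 0\<close>: in the intended reading
  \<open>log |q\<^sub>k|\<close> is \<open>-\<infinity>\<close> at the zeros of \<open>q\<^sub>k\<close>, so uniform convergence to a finite function forces
  \<open>q\<^sub>k\<close> to have eventually no zero in the region.\<close>

definition regular_wrt :: "complex set \<Rightarrow> (nat \<Rightarrow> complex poly) \<Rightarrow> bool" where
  "regular_wrt K q \<longleftrightarrow>
     (\<exists>R>0. K \<subseteq> ball 0 R \<and>
        (\<forall>\<^sub>F k in sequentially. \<forall>z \<in> - ball 0 R. poly (q k) z \<noteq> 0) \<and>
        uniform_limit (- ball 0 R)
          (\<lambda>k z. ln (cmod (poly (q k) z)) / real (degree (q k))) (green K) sequentially)"

text \<open>The condition \<open>log (Cap (L\<^sub>k)) = o(n\<^sub>k)\<close>. Positivity is spelled out because of \<open>ln 0 = 0\<close>.\<close>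

definition log_capacity_smallo :: "(nat \<Rightarrow> complex set) \<Rightarrow> (nat \<Rightarrow> nat) \<Rightarrow> bool" where
  "log_capacity_smallo L n \<longleftrightarrow>
     (\<forall>\<^sub>F k in sequentially. capacity (L k) > 0) \<and>
     (\<lambda>k. ln (capacity (L k))) \<in> o(\<lambda>k. real (n k))"

end

theory Submission
  imports
    Defs
    "HOL-Computational_Algebra.Fundamental_Theorem_Algebra"
    "HOL-Real_Asymp.Real_Asymp"
    "HOL-Complex_Analysis.Complex_Analysis"
begin

text \<open>Write \<open>m k\<close> for the equilibrium measure of the preimage of \<open>L k\<close> under \<open>q k\<close>, \<open>n k\<close> for the
  degree and \<open>a k\<close> for the leading coefficient of \<open>q k\<close>. Pulling back a nearly extremal measure on
  \<open>L k\<close> shows that the energy of \<open>m k\<close> is at least \<open>(ln (Cap (L k)) - ln |a k|) / n k - o(1)\<close>, and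
  regularity makes this tend to the energy \<open>I\<close> of the equilibrium measure \<open>\<omega>\<close> of \<open>K\<close>.
  So every weak limit \<open>\<mu>\<close> of the \<open>m k\<close> has energy at least \<open>I\<close>.

  By centering, the zero counting measures of the \<open>q k\<close> accumulate only on \<open>K\<close>. By regularity and
  unique continuation off \<open>K\<close> the potential of each limit equals that of \<open>\<omega>\<close> off \<open>K\<close>.
  Hence near a point off \<open>K\<close> where the potential of \<open>\<omega>\<close> exceeds \<open>I\<close>, the polynomial \<open>q k\<close> is
  exponentially large except very close to boundedly many zeros. A measure of bounded energy charges
  such small neighbourhoods only little, so \<open>\<mu>\<close> lives where the potential of \<open>\<omega>\<close> is at most \<open>I\<close>
  (on \<open>K\<close> this is the easy half of Frostman's theorem). Thus the mutual energy of \<open>\<mu>\<close> and \<open>\<omega>\<close> is at most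
  \<open>I\<close>, and positive definiteness of the logarithmic kernel on measures of total mass zero
  forces \<open>\<mu> = \<omega>\<close>.\<close>

text \<open>Two obstacles shape the development. The kernel is unbounded and its integrals may be
  infinite, so energies are handled as \<open>mutual_energy\<close>, with values in
  \<open>ennreal\<close>: Tonelli and Fatou then apply without integrability conditions, and
  \<open>D\<close> is merely a scale no smaller than the diameters involved. Weak limits are used as
  pointwise limits of random variables on one probability space: semicontinuity of energy becomes
  Fatou's lemma, and convergence of potentials becomes dominated convergence. The Schoenberg curve,
  with its Borel right inverse, carries planar laws to the line and back for this purpose. The zero
  counting measures need not converge to \<omega>: a limit may sit inside \<open>K\<close> (take the
  powers of \<open>z\<close> on the closed unit disc), and only its potential off \<open>K\<close>
  is determined. Convergence of their potentials may also fail at points approached by zeros. Hence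
  the discs around the few zeros off \<open>K\<close> that are treated separately, with a radius
  dictated by the energy bound. Points off \<open>K\<close> where the potential of \<omega> is at
  most \<open>I\<close> need not be excluded, since the argument asks only for that upper bound
  \<mu>-almost everywhere off \<open>K\<close>.\<close>

section \<open>The Schoenberg curve\<close>

text \<open>This wave of period \<open>2\<close> is \<open>0\<close> on \<open>[0, 1/3]\<close> and \<open>1\<close> on \<open>[2/3, 1]\<close>, so it reads off ternary digits.\<close>

definition schoenberg_wave :: "real \<Rightarrow> real" where
  "schoenberg_wave t = max 0 (min 1 (1 / 2 - cos (pi * t)))"

text \<open>Schoenberg's space-filling curve: on the Cantor set, the ternary digits of
  \<open>t\<close> in even and odd positions become the binary digits of the two coordinates. In
  between, the wave interpolates, which makes the curve continuous on the whole line.\<close>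

definition schoenberg_curve :: "real \<Rightarrow> complex" where
  "schoenberg_curve t =
     Complex (\<Sum>k. schoenberg_wave (3 ^ (2 * k) * t) / 2 ^ Suc k)
             (\<Sum>k. schoenberg_wave (3 ^ Suc (2 * k) * t) / 2 ^ Suc k)"

definition binary_digit :: "real \<Rightarrow> nat \<Rightarrow> int" where
  "binary_digit x k = \<lfloor>2 ^ Suc k * x\<rfloor> - 2 * \<lfloor>2 ^ k * x\<rfloor>"

definition interleaved_digit :: "complex \<Rightarrow> nat \<Rightarrow> int" where
  "interleaved_digit z k = binary_digit (if even k then Re z else Im z) (k div 2)"

text \<open>The interleaved digits, doubled, are the ternary digits of a point of the Cantor set.
  The map is not continuous, but it is Borel, which is what the transport of measures asks
  for.\<close>

definition schoenberg_section :: "complex \<Rightarrow> real" where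
  "schoenberg_section z = (\<Sum>k. 2 * real_of_int (interleaved_digit z k) / 3 ^ Suc k)"

lemma schoenberg_wave_bounds: "0 \<le> schoenberg_wave t" "schoenberg_wave t \<le> 1"
  by (auto simp: schoenberg_wave_def)

text \<open>\<open>cos\<close> is at least 1/2 on \<open>[0, pi/3]\<close> and at most -1/2 on
  \<open>[2 pi/3, pi]\<close>; clipping turns this into the exact values 0 and 1. The slack
  \<open>r\<close> absorbs all later digits.\<close>

lemma schoenberg_wave_digit:
  assumes "a \<in> {0, 1 :: int}" "0 \<le> r" "r \<le> 1 / 3"
  shows "schoenberg_wave (2 * of_int m + 2 * of_int a / 3 + r) = of_int a"
proof -
  define u where "u = 2 * of_int a / 3 + r"
  have "cos (pi * (2 * of_int m + 2 * of_int a / 3 + r)) = cos (pi * u + of_int m * (2 * pi))"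
    by (rule arg_cong[where f = cos]) (simp add: u_def algebra_simps)
  also have "\<dots> = cos (pi * u)"
    by (metis add.commute cos_int_2pin cos_add sin_int_2pin mult_1_right mult_zero_right diff_zero mult.commute)
  finally have c: "cos (pi * (2 * of_int m + 2 * of_int a / 3 + r)) = cos (pi * u)" .
  show ?thesis
  proof (cases "a = 0")
    case True
    have "cos (pi * u) \<ge> cos (pi / 3)"
      using assms True by (intro cos_monotone_0_pi_le) (auto simp: u_def)
    then show ?thesis
      unfolding schoenberg_wave_def c by (simp add: cos_60 True)
  next
    case False
    with assms have a: "a = 1" by auto
    have "cos (pi * u) \<le> cos (2 * pi / 3)"
    proof (rule cos_monotone_0_pi_le)
      show "pi * u \<le> pi" using assms a by (simp add: u_def)
      have "pi * (2 / 3) \<le> pi * u" using assms a by (intro mult_left_mono) (auto simp: u_def)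
      then show "2 * pi / 3 \<le> pi * u" by simp
    qed auto
    then show ?thesis
      unfolding schoenberg_wave_def c by (simp add: cos_120 a)
  qed
qed

lemma binary_digit_01: "binary_digit x k \<in> {0, 1}"
proof -
  define y where "y = 2 ^ k * x"
  have "binary_digit x k = \<lfloor>2 * y\<rfloor> - 2 * \<lfloor>y\<rfloor>" by (simp add: binary_digit_def y_def mult_ac)
  moreover have "\<lfloor>2 * y\<rfloor> - 2 * \<lfloor>y\<rfloor> = 0 \<or> \<lfloor>2 * y\<rfloor> - 2 * \<lfloor>y\<rfloor> = 1" by linarith
  ultimately show ?thesis by simp
qed

text \<open>The digit formula telescopes: a partial sum is the floor of \<open>2 ^ n * x\<close>
  divided by \<open>2 ^ n\<close>, hence within \<open>2 ^ (-n)\<close> of \<open>x\<close>. The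
  bounds on \<open>x\<close> make the initial floor zero.\<close>

lemma binary_digits_sums:
  assumes "0 \<le> x" "x < 1"
  shows "(\<lambda>k. real_of_int (binary_digit x k) / 2 ^ Suc k) sums x"
proof -
  have part: "(\<Sum>k<n. real_of_int (binary_digit x k) / 2 ^ Suc k) = of_int \<lfloor>2 ^ n * x\<rfloor> / 2 ^ n" for n
  proof (induction n)
    case 0
    then show ?case using assms by (simp add: floor_eq_iff)
  next
    case (Suc n)
    then show ?case by (simp add: binary_digit_def field_simps)
  qed
  have "(\<lambda>n. real_of_int \<lfloor>2 ^ n * x\<rfloor> / 2 ^ n) \<longlonglongrightarrow> x"
  proof (rule real_tendsto_sandwich)
    show "\<forall>\<^sub>F n in sequentially. x - (1 / 2) ^ n \<le> real_of_int \<lfloor>2 ^ n * x\<rfloor> / 2 ^ n"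
    proof (intro always_eventually allI)
      fix n :: nat
      have "2 ^ n * x - 1 \<le> of_int \<lfloor>2 ^ n * x\<rfloor>" by linarith
      then have "(2 ^ n * x - 1) / 2 ^ n \<le> of_int \<lfloor>2 ^ n * x\<rfloor> / 2 ^ n"
        by (intro divide_right_mono) auto
      then show "x - (1 / 2) ^ n \<le> real_of_int \<lfloor>2 ^ n * x\<rfloor> / 2 ^ n"
        by (simp add: field_simps power_one_over)
    qed
    show "\<forall>\<^sub>F n in sequentially. real_of_int \<lfloor>2 ^ n * x\<rfloor> / 2 ^ n \<le> x"
    proof (intro always_eventually allI)
      fix n :: nat
      have "of_int \<lfloor>2 ^ n * x\<rfloor> \<le> 2 ^ n * x" by linarith
      then show "real_of_int \<lfloor>2 ^ n * x\<rfloor> / 2 ^ n \<le> x" by (simp add: field_simps)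
    qed
    have "(\<lambda>n. (1 / 2 :: real) ^ n) \<longlonglongrightarrow> 0" by (rule LIMSEQ_power_zero) simp
    from tendsto_diff[OF tendsto_const this, of x]
    show "(\<lambda>n. x - (1 / 2) ^ n) \<longlonglongrightarrow> x" by simp
  qed simp
  then show ?thesis unfolding sums_def part .
qed

lemma interleaved_digit_01: "interleaved_digit z k \<in> {0, 1}"
  unfolding interleaved_digit_def by (rule binary_digit_01)

lemma ternary_digit_summable:
  assumes "\<And>k. a k \<in> {0, 1 :: int}"
  shows "summable (\<lambda>k. 2 * real_of_int (a (k + m)) / 3 ^ Suc k)"
    "0 \<le> (\<Sum>k. 2 * real_of_int (a (k + m)) / 3 ^ Suc k)"
    "(\<Sum>k. 2 * real_of_int (a (k + m)) / 3 ^ Suc k) \<le> 1"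
proof -
  have geo: "(\<lambda>k. 2 / 3 * (1 / 3 :: real) ^ k) sums (2 / 3 * (1 / (1 - 1 / 3)))"
    by (intro sums_mult geometric_sums) auto
  have b: "0 \<le> a k" "a k \<le> 1" for k using assms[of k] by auto
  have le: "2 * real_of_int (a (k + m)) / 3 ^ Suc k \<le> 2 / 3 * (1 / 3) ^ k" for k
    using b[of "k + m"] by (simp add: field_simps power_one_over)
  have nn: "0 \<le> 2 * real_of_int (a (k + m)) / 3 ^ Suc k" for k using b by simp
  show s: "summable (\<lambda>k. 2 * real_of_int (a (k + m)) / 3 ^ Suc k)"
    by (rule summable_comparison_test'[OF sums_summable[OF geo]]) (metis le nn abs_of_nonneg real_norm_def)
  show "0 \<le> (\<Sum>k. 2 * real_of_int (a (k + m)) / 3 ^ Suc k)"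
    using s nn by (rule suminf_nonneg)
  show "(\<Sum>k. 2 * real_of_int (a (k + m)) / 3 ^ Suc k) \<le> 1"
    using suminf_le[OF le s sums_summable[OF geo]] sums_unique[OF geo] by simp
qed

text \<open>Multiplication by \<open>3 ^ j\<close> shifts the expansion. The digits passed over are
  0 or 2, so the integer split off is even and disappears by the period 2 of the wave. What remains
  starts with the digit \<open>2 * a j\<close>, followed by a tail of at most 1/3.\<close>

lemma ternary_shift_wave:
  assumes a: "\<And>k. a k \<in> {0, 1 :: int}"
  shows "schoenberg_wave (3 ^ j * (\<Sum>k. 2 * real_of_int (a k) / 3 ^ Suc k)) = of_int (a j)"
proof -
  define t where "t m = (\<Sum>k. 2 * real_of_int (a (k + m)) / 3 ^ Suc k)" for m
  have step: "3 * t m = 2 * a m + t (Suc m)" for m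
  proof -
    have "t m = 2 * real_of_int (a m) / 3 + (\<Sum>k. 2 * real_of_int (a (Suc k + m)) / 3 ^ Suc (Suc k))"
      unfolding t_def using suminf_split_head[OF ternary_digit_summable(1)[of a m, OF a]] by simp
    also have "(\<Sum>k. 2 * real_of_int (a (Suc k + m)) / 3 ^ Suc (Suc k))
        = (\<Sum>k. 2 * real_of_int (a (k + Suc m)) / 3 ^ Suc k / 3)"
      by (simp add: field_simps)
    also have "\<dots> = t (Suc m) / 3"
      unfolding t_def by (rule suminf_divide[OF ternary_digit_summable(1)[of a, OF a]])
    finally show ?thesis by simp
  qed
  have "\<exists>i :: int. 3 ^ j * t 0 = 2 * of_int i + t j" for j
  proof (induction j)
    case 0
    show ?case by (rule exI[of _ 0]) simp
  next
    case (Suc j)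
    then obtain i :: int where "3 ^ j * t 0 = 2 * of_int i + t j" by blast
    then have "3 ^ Suc j * t 0 = 3 * (2 * of_int i) + 3 * t j" by simp
    also have "\<dots> = 2 * of_int (3 * i + a j) + t (Suc j)" unfolding step by simp
    finally show ?case by blast
  qed
  then obtain i :: int where i: "3 ^ j * t 0 = 2 * of_int i + t j" by blast
  have "3 ^ j * t 0 = 2 * of_int i + 2 * of_int (a j) / 3 + t (Suc j) / 3"
    unfolding i using step[of j] by simp
  moreover have "0 \<le> t (Suc j) / 3" "t (Suc j) / 3 \<le> 1 / 3"
    using ternary_digit_summable(2,3)[of a "Suc j", OF a] by (auto simp: t_def)
  ultimately have "schoenberg_wave (3 ^ j * t 0) = of_int (a j)"
    using schoenberg_wave_digit[OF a] by simp
  then show ?thesis by (simp add: t_def)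
qed

lemma schoenberg_curve_section:
  assumes "0 \<le> Re z" "Re z < 1" "0 \<le> Im z" "Im z < 1"
  shows "schoenberg_curve (schoenberg_section z) = z"
proof -
  have w: "schoenberg_wave (3 ^ j * schoenberg_section z) = of_int (interleaved_digit z j)" for j
    unfolding schoenberg_section_def by (rule ternary_shift_wave[OF interleaved_digit_01])
  show ?thesis
    unfolding schoenberg_curve_def w
    using sums_unique[OF binary_digits_sums[of "Re z"]] sums_unique[OF binary_digits_sums[of "Im z"]] assms
    by (simp add: interleaved_digit_def complex_eq_iff)
qed

lemma schoenberg_section_range: "0 \<le> schoenberg_section z" "schoenberg_section z \<le> 1"
  using ternary_digit_summable(2,3)[of "interleaved_digit z" 0, OF interleaved_digit_01]
  by (simp_all add: schoenberg_section_def)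

lemma schoenberg_section_measurable [measurable]: "schoenberg_section \<in> borel_measurable borel"
  unfolding schoenberg_section_def interleaved_digit_def binary_digit_def by measurable

lemma schoenberg_series_continuous:
  "continuous_on UNIV (\<lambda>t. \<Sum>k. schoenberg_wave (c k * t) / 2 ^ Suc k)"
proof (rule uniform_limit_theorem[OF _ Weierstrass_m_test])
  show "\<forall>\<^sub>F n in sequentially. continuous_on UNIV (\<lambda>t. \<Sum>k<n. schoenberg_wave (c k * t) / 2 ^ Suc k)"
    by (intro always_eventually allI)
       (auto simp: schoenberg_wave_def intro!: continuous_intros)
  show "norm (schoenberg_wave (c k * t) / 2 ^ Suc k) \<le> (1 / 2) ^ Suc k" for k t
    using schoenberg_wave_bounds[of "c k * t"] by (simp add: field_simps power_one_over)
  show "summable (\<lambda>k. (1 / 2 :: real) ^ Suc k)"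
    using summable_geometric[of "1 / 2 :: real"] by (simp add: summable_mult)
qed simp

lemma schoenberg_curve_continuous: "continuous_on UNIV schoenberg_curve"
proof -
  have "schoenberg_curve = (\<lambda>t. complex_of_real (\<Sum>k. schoenberg_wave (3 ^ (2 * k) * t) / 2 ^ Suc k)
      + \<i> * complex_of_real (\<Sum>k. schoenberg_wave (3 ^ Suc (2 * k) * t) / 2 ^ Suc k))"
    by (simp add: fun_eq_iff schoenberg_curve_def complex_eq_iff)
  moreover have "continuous_on UNIV \<dots>"
    by (intro continuous_intros schoenberg_series_continuous)
  ultimately show ?thesis by metis
qed

lemma schoenberg_curve_bound: "cmod (schoenberg_curve t) \<le> 2"
proof -
  have *: "\<bar>\<Sum>k. schoenberg_wave (c k * t) / 2 ^ Suc k\<bar> \<le> 1" for c :: "nat \<Rightarrow> real"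
  proof -
    have b: "norm (schoenberg_wave (c k * t) / 2 ^ Suc k) \<le> (1 / 2) ^ Suc k" for k
      using schoenberg_wave_bounds[of "c k * t"] by (simp add: field_simps power_one_over)
    show ?thesis
      using norm_suminf_le[OF b sums_summable[OF power_half_series]] sums_unique[OF power_half_series]
      by simp
  qed
  show ?thesis
    using cmod_le[of "schoenberg_curve t"] *[of "\<lambda>k. 3 ^ (2 * k)"] *[of "\<lambda>k. 3 ^ Suc (2 * k)"]
    by (simp add: schoenberg_curve_def)
qed

section \<open>Weak sequential compactness\<close>

lemma prob_measures_onD:
  assumes "\<mu> \<in> prob_measures_on C"
  shows "prob_space \<mu>" "sets \<mu> = sets borel" "space \<mu> = UNIV" "emeasure \<mu> C = 1"
  using assms sets_eq_imp_space_eq[of \<mu> borel] by (auto simp: prob_measures_on_def)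

lemma prob_measures_on_AE:
  assumes "\<mu> \<in> prob_measures_on C" "C \<in> sets borel"
  shows "AE z in \<mu>. z \<in> C"
proof -
  interpret prob_space \<mu> using assms prob_measures_onD by blast
  show ?thesis
    using prob_measures_onD[OF assms(1)] assms(2) AE_in_set_eq_1[of C]
    by (simp add: measure_def)
qed

lemma prob_measures_onI:
  assumes "prob_space \<mu>" "sets \<mu> = sets borel" "C \<in> sets borel" "AE z in \<mu>. z \<in> C"
  shows "\<mu> \<in> prob_measures_on C"
proof -
  interpret prob_space \<mu> by fact
  have "prob C = 1" using assms AE_in_set_eq_1[of C] by simp
  then show ?thesis using assms by (simp add: prob_measures_on_def emeasure_eq_measure)
qed

lemma prob_measures_on_mono:
  assumes "\<mu> \<in> prob_measures_on C" "C \<subseteq> B" "B \<in> sets borel" "C \<in> sets borel"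
  shows "\<mu> \<in> prob_measures_on B"
  using prob_measures_onD[OF assms(1)] prob_measures_on_AE[OF assms(1,4)] assms(2,3)
  by (intro prob_measures_onI) (auto elim: eventually_mono)

text \<open>Weak sequential compactness in coupled form: the laws are lifted to the line through the
  Borel section of the Schoenberg curve, where Helly's and Skorohod's theorems apply.\<close>

lemma skorohod_subsequence:
  assumes \<mu>: "\<And>n. \<mu> n \<in> prob_measures_on (cball 0 \<rho>)" and \<rho>: "\<rho> > 0"
  obtains r \<Omega> X Y where "strict_mono (r :: nat \<Rightarrow> nat)" "prob_space (\<Omega> :: real measure)"
    "\<And>n. X n \<in> borel_measurable \<Omega>" "Y \<in> borel_measurable \<Omega>"
    "\<And>n. distr \<Omega> borel (X n) = \<mu> (r n)"
    "\<And>\<omega>. \<omega> \<in> space \<Omega> \<Longrightarrow> (\<lambda>n. X n \<omega>) \<longlonglongrightarrow> Y \<omega>"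
    "\<And>n \<omega>. cmod (X n \<omega>) \<le> 10 * \<rho>" "\<And>\<omega>. cmod (Y \<omega>) \<le> 10 * \<rho>"
proof -
  \<comment> \<open>The square of side \<open>2 * \<rho>\<close> around the disc is scaled into
    \<open>[0, 1/2]\<close> in each coordinate, well inside the half-open square on which the
    section works. The curve has modulus at most 2, whence \<open>4 * 2 + 2 = 10\<close> in the
    bounds.\<close>
  define c where "c t = of_real (4 * \<rho>) * schoenberg_curve t - Complex \<rho> \<rho>" for t
  define s where "s z = schoenberg_section ((z + Complex \<rho> \<rho>) / of_real (4 * \<rho>))" for z
  have cont: "continuous_on UNIV c"
    unfolding c_def by (intro continuous_intros schoenberg_curve_continuous)
  then have [measurable]: "c \<in> borel_measurable borel" by (rule borel_measurable_continuous_onI)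
  have [measurable]: "s \<in> borel_measurable borel" unfolding s_def by measurable
  have cs: "c (s z) = z" if "cmod z \<le> \<rho>" for z
  proof -
    have "\<bar>Re z\<bar> \<le> \<rho>" "\<bar>Im z\<bar> \<le> \<rho>"
      using abs_Re_le_cmod[of z] abs_Im_le_cmod[of z] that by linarith+
    then have "schoenberg_curve (s z) = (z + Complex \<rho> \<rho>) / of_real (4 * \<rho>)"
      unfolding s_def using \<rho> by (intro schoenberg_curve_section) (auto simp: Re_divide_of_real Im_divide_of_real)
    then show ?thesis unfolding c_def using \<rho> by simp
  qed
  have cb: "cmod (c t) \<le> 10 * \<rho>" for t
  proof -
    have "cmod (c t) \<le> cmod (of_real (4 * \<rho>) * schoenberg_curve t) + cmod (Complex \<rho> \<rho>)"
      unfolding c_def by (rule norm_triangle_ineq4)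
    also have "\<dots> \<le> 4 * \<rho> * 2 + (\<bar>\<rho>\<bar> + \<bar>\<rho>\<bar>)"
      using schoenberg_curve_bound[of t] cmod_le[of "Complex \<rho> \<rho>"] \<rho>
      by (intro add_mono) (auto simp: norm_mult)
    finally show ?thesis using \<rho> by simp
  qed
  note D = prob_measures_onD[OF \<mu>]
  have [measurable_cong]: "sets (\<mu> n) = sets borel" for n using D(2) .
  define M where "M n = distr (\<mu> n) borel s" for n
  have real_distribution: "real_distribution (M n)" for n
  proof -
    interpret prob_space "\<mu> n" using D(1) .
    show ?thesis unfolding real_distribution_def real_distribution_axioms_def M_def
      by (simp add: prob_space_distr)
  qed
  have "tight M"
    unfolding tight_def
  proof (intro conjI allI impI real_distribution)
    fix \<epsilon> :: real assume "\<epsilon> > 0"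
    have "measure (M n) {-1<..1} = 1" for n
    proof -
      interpret prob_space "\<mu> n" using D(1) .
      have "-1 < s z" "s z \<le> 1" for z
        using schoenberg_section_range[of "(z + Complex \<rho> \<rho>) / of_real (4 * \<rho>)"]
        unfolding s_def by linarith+
      then have "s -` {-1<..1} \<inter> space (\<mu> n) = space (\<mu> n)" by auto
      then show ?thesis by (simp add: M_def measure_distr prob_space)
    qed
    then show "\<exists>a b. a < b \<and> (\<forall>n. 1 - \<epsilon> < measure (M n) {a<..b})"
      using \<open>\<epsilon> > 0\<close> by (intro exI[of _ "-1"] exI[of _ 1]) auto
  qed
  from tight_imp_convergent_subsubsequence[OF this strict_mono_id]
  obtain r N where r: "strict_mono (r :: nat \<Rightarrow> nat)" and N: "real_distribution N"
    and conv: "weak_conv_m (\<lambda>n. M (r n)) N" by (auto simp: o_def)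
  from Skorohod[OF real_distribution N conv] obtain \<Omega> :: "real measure" and Ys :: "nat \<Rightarrow> real \<Rightarrow> real" and Y where
    \<Omega>: "prob_space \<Omega>" and Ys [measurable]: "\<And>n. Ys n \<in> borel_measurable \<Omega>"
    and law: "\<And>n. distr \<Omega> borel (Ys n) = M (r n)"
    and Y: "Y \<in> measurable \<Omega> lborel" and lim: "\<And>x. x \<in> space \<Omega> \<Longrightarrow> (\<lambda>n. Ys n x) \<longlonglongrightarrow> Y x"
    by blast
  have [measurable]: "Y \<in> borel_measurable \<Omega>" using Y by simp
  show thesis
  proof
    show "strict_mono r" "prob_space \<Omega>" by fact+
    show "(\<lambda>\<omega>. c (Ys n \<omega>)) \<in> borel_measurable \<Omega>" for n by measurable
    show "(\<lambda>\<omega>. c (Y \<omega>)) \<in> borel_measurable \<Omega>" by measurable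
    show "distr \<Omega> borel (\<lambda>\<omega>. c (Ys n \<omega>)) = \<mu> (r n)" for n
    proof -
      have "distr \<Omega> borel (\<lambda>\<omega>. c (Ys n \<omega>)) = distr (distr \<Omega> borel (Ys n)) borel c"
        by (subst distr_distr) (auto simp: o_def)
      also have "\<dots> = distr (\<mu> (r n)) borel (\<lambda>z. c (s z))"
        unfolding law M_def by (subst distr_distr) (auto simp: o_def)
      \<comment> \<open>The curve undoes the section only near the disc, but the disc carries the
        measure.\<close>
      also have "\<dots> = distr (\<mu> (r n)) borel (\<lambda>z. z)"
        using prob_measures_on_AE[OF \<mu>[of "r n"]]
        by (intro distr_cong_AE) (auto elim!: eventually_mono simp: cs)
      also have "\<dots> = \<mu> (r n)" by (intro distr_id2) (simp add: D)
      finally show ?thesis .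
    qed
    show "(\<lambda>n. c (Ys n \<omega>)) \<longlonglongrightarrow> c (Y \<omega>)" if "\<omega> \<in> space \<Omega>" for \<omega>
      using cont lim[OF that] by (metis continuous_on_tendsto_compose UNIV_I eventually_sequentiallyI)
    show "cmod (c (Ys n \<omega>)) \<le> 10 * \<rho>" "cmod (c (Y \<omega>)) \<le> 10 * \<rho>" for n \<omega> by (rule cb)+
  qed
qed

section \<open>Energy through a nonnegative kernel\<close>

text \<open>The kernel \<open>ln D - ln |z - w|\<close> is nonnegative on sets of diameter at most \<open>D\<close>, where minimising its
  energy means maximising the logarithmic energy. At larger distances \<^const>\<open>ennreal\<close> cuts it off at \<open>0\<close>.\<close>

definition log_gap :: "real \<Rightarrow> complex \<Rightarrow> complex \<Rightarrow> ennreal" where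
  "log_gap D z w = (if z = w then \<infinity> else ennreal (ln (D / cmod (z - w))))"

definition gap_potential :: "real \<Rightarrow> complex measure \<Rightarrow> complex \<Rightarrow> ennreal" where
  "gap_potential D \<mu> z = (\<integral>\<^sup>+ w. log_gap D z w \<partial>\<mu>)"

definition mutual_energy :: "real \<Rightarrow> complex measure \<Rightarrow> complex measure \<Rightarrow> ennreal" where
  "mutual_energy D \<mu> \<nu> = (\<integral>\<^sup>+ z. gap_potential D \<nu> z \<partial>\<mu>)"

lemma log_gap_commute: "log_gap D z w = log_gap D w z"
  by (simp add: log_gap_def norm_minus_commute)

lemma log_gap_measurable [measurable]:
  assumes [measurable]: "f \<in> borel_measurable M" "g \<in> borel_measurable M"
  shows "(\<lambda>x. log_gap D (f x) (g x)) \<in> borel_measurable M"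
  unfolding log_gap_def by measurable

lemma gap_potential_measurable:
  assumes "sigma_finite_measure \<nu>" "sets \<nu> = sets borel"
  shows "gap_potential D \<nu> \<in> borel_measurable borel"
proof -
  interpret sigma_finite_measure \<nu> by fact
  have [measurable_cong]: "sets \<nu> = sets borel" by fact
  show ?thesis unfolding gap_potential_def[abs_def] by measurable
qed

text \<open>Bridge from the definition by positive and negative parts to a single nonnegative
  integral. The parts of \<open>c - g\<close> satisfy: positive part plus \<open>g\<close> equals
  \<open>c\<close> plus negative part. The positive part is at most \<open>c\<close>, so its
  integral is finite and can be subtracted even if that of \<open>g\<close> is infinite.\<close>

lemma ereal_integral_diff:
  assumes M: "prob_space M" and g [measurable]: "g \<in> borel_measurable M" and c: "c \<ge> 0"
    and f: "AE x in M. f x = ereal c - enn2ereal (g x)"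
  shows "ereal_integral M f = ereal c - enn2ereal (\<integral>\<^sup>+ x. g x \<partial>M)"
proof -
  interpret prob_space M by fact
  let ?h = "\<lambda>x. ereal c - enn2ereal (g x)"
  have eq: "e2ennreal (?h x) + g x = ennreal c + e2ennreal (- ?h x)" for x
  proof (cases "g x")
    case (real r)
    then show ?thesis using c
      by (cases "r \<le> c") (auto simp: ennreal.rep_eq max_def e2ennreal_neg ennreal_neg simp flip: ennreal.abs_eq ennreal_plus)
  next
    case top
    then show ?thesis by simp
  qed
  have le: "e2ennreal (?h x) \<le> ennreal c" for x
    using c by (cases "g x") (auto simp: ennreal.rep_eq max_def e2ennreal_neg intro: ennreal_leI simp flip: ennreal.abs_eq)
  define p where "p = (\<integral>\<^sup>+ x. e2ennreal (?h x) \<partial>M)"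
  define n where "n = (\<integral>\<^sup>+ x. e2ennreal (- ?h x) \<partial>M)"
  have "p \<le> (\<integral>\<^sup>+ x. ennreal c \<partial>M)" unfolding p_def by (intro nn_integral_mono le)
  then have p: "p \<le> ennreal c" by (simp add: emeasure_space_1)
  have "p + (\<integral>\<^sup>+ x. g x \<partial>M) = (\<integral>\<^sup>+ x. e2ennreal (?h x) + g x \<partial>M)"
    unfolding p_def by (rule nn_integral_add[symmetric]) measurable
  also have "\<dots> = ennreal c + n"
    unfolding eq n_def by (subst nn_integral_add) (auto simp: emeasure_space_1)
  finally have sum: "p + (\<integral>\<^sup>+ x. g x \<partial>M) = ennreal c + n" .
  have "ereal_integral M f = enn2ereal p - enn2ereal n"
    unfolding ereal_integral_def p_def n_def
    by (intro arg_cong2[where f = "(-)"] arg_cong[where f = enn2ereal] nn_integral_cong_AE)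
       (use f in \<open>auto elim!: eventually_mono\<close>)
  also have "\<dots> = ereal c - enn2ereal (\<integral>\<^sup>+ x. g x \<partial>M)"
  proof (cases p)
    case (real a)
    show ?thesis
    proof (cases n)
      case (real b)
      then obtain d where "(\<integral>\<^sup>+ x. g x \<partial>M) = ennreal d" "d \<ge> 0"
        using sum c real by (cases "\<integral>\<^sup>+ x. g x \<partial>M") (auto simp flip: ennreal_plus)
      then show ?thesis
        using sum real \<open>p = ennreal a\<close> \<open>0 \<le> a\<close> c
        by (auto simp: ennreal.rep_eq max_def simp flip: ennreal_plus)
    next
      case top
      then show ?thesis using sum real by (cases "\<integral>\<^sup>+ x. g x \<partial>M") (auto simp: ennreal.rep_eq max_def simp flip: ennreal_plus)
    qed
  next
    case top
    then show ?thesis using p by (auto simp: top_unique)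
  qed
  finally show ?thesis .
qed

lemma log_kernel_gap:
  assumes "cmod (z - w) \<le> D" "0 < D"
  shows "log_kernel z w = ereal (ln D) - enn2ereal (log_gap D z w)"
  using assms
  by (auto simp: log_kernel_def log_gap_def ennreal.rep_eq ln_div max_def)

lemma log_potential_gap:
  assumes "prob_space \<mu>" "sets \<mu> = sets borel" "D \<ge> 1" "AE w in \<mu>. cmod (z - w) \<le> D"
  shows "log_potential \<mu> z = ereal (ln D) - enn2ereal (gap_potential D \<mu> z)"
proof -
  have [measurable_cong]: "sets \<mu> = sets borel" by fact
  show ?thesis
    unfolding log_potential_def gap_potential_def
    using assms(3,4) log_kernel_gap[of z _ D]
    by (intro ereal_integral_diff assms) (auto elim!: eventually_mono)
qed

text \<open>\<open>D \<ge> 2 * \<rho>\<close> keeps the kernel from being cut off on pairs of points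
  of the disc; \<open>D \<ge> 1\<close> makes \<open>ln D\<close> nonnegative, as
  \<open>ereal_integral_diff\<close> requires. The order of energies is reversed, so maximisers
  become minimisers.\<close>

lemma log_energy_gap:
  assumes \<mu>: "\<mu> \<in> prob_measures_on (cball 0 \<rho>)" and D: "D \<ge> 1" "D \<ge> 2 * \<rho>"
  shows "log_energy \<mu> = ereal (ln D) - enn2ereal (mutual_energy D \<mu> \<mu>)"
proof -
  note P = prob_measures_onD[OF \<mu>]
  interpret prob_space \<mu> using P by blast
  have [measurable_cong]: "sets \<mu> = sets borel" by (rule P)
  have AE: "AE z in \<mu>. z \<in> cball 0 \<rho>" by (rule prob_measures_on_AE[OF \<mu>]) auto
  have "log_potential \<mu> z = ereal (ln D) - enn2ereal (gap_potential D \<mu> z)" if "z \<in> cball 0 \<rho>" for z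
  proof (rule log_potential_gap[OF P(1,2) D(1)])
    show "AE w in \<mu>. cmod (z - w) \<le> D"
      using AE
    proof eventually_elim
      case (elim w)
      then show ?case using that norm_triangle_ineq4[of z w] D by simp
    qed
  qed
  moreover have "gap_potential D \<mu> \<in> borel_measurable \<mu>"
    using gap_potential_measurable[OF sigma_finite_measure_axioms P(2)] P(2) by measurable
  ultimately show ?thesis
    unfolding log_energy_def mutual_energy_def
    using AE D(1) by (intro ereal_integral_diff P) (auto elim!: eventually_mono)
qed

lemma mutual_energy_commute:
  assumes "prob_space \<mu>" "sets \<mu> = sets borel" "prob_space \<nu>" "sets \<nu> = sets borel"
  shows "mutual_energy D \<mu> \<nu> = mutual_energy D \<nu> \<mu>"
proof -
  interpret \<mu>: prob_space \<mu> by fact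
  interpret \<nu>: prob_space \<nu> by fact
  interpret pair_sigma_finite \<mu> \<nu> ..
  have [measurable_cong]: "sets \<mu> = sets borel" "sets \<nu> = sets borel" by fact+
  have "(\<integral>\<^sup>+ z. \<integral>\<^sup>+ w. log_gap D z w \<partial>\<nu> \<partial>\<mu>) = (\<integral>\<^sup>+ w. \<integral>\<^sup>+ z. log_gap D z w \<partial>\<mu> \<partial>\<nu>)"
    by (rule Fubini'[symmetric]) measurable
  then show ?thesis
    unfolding mutual_energy_def gap_potential_def by (simp add: log_gap_commute)
qed

section \<open>Positive definiteness\<close>

lemma closed_indicator_limit:
  fixes A :: "'a :: metric_space set"
  assumes "closed A"
  obtains f :: "nat \<Rightarrow> 'a \<Rightarrow> real" where "\<And>n. continuous_on UNIV (f n)"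
    "\<And>n x. 0 \<le> f n x" "\<And>n x. f n x \<le> 1" "\<And>x. (\<lambda>n. f n x) \<longlonglongrightarrow> indicator A x"
proof (cases "A = {}")
  case True
  then show thesis by (intro that[of "\<lambda>_ _. 0"]) auto
next
  case False
  define f where "f n x = max 0 (1 - real n * infdist x A)" for n x
  have lim: "(\<lambda>n. f n x) \<longlonglongrightarrow> indicator A x" for x
  proof (cases "x \<in> A")
    case True
    then show ?thesis by (simp add: f_def)
  next
    case out: False
    then have "infdist x A > 0"
      using in_closed_iff_infdist_zero[OF assms False, of x] infdist_nonneg[of x A] by linarith
    then obtain N :: nat where N: "1 < real N * infdist x A"
      by (metis reals_Archimedean3)
    have "f n x = 0" if "n \<ge> N" for n
    proof -
      have "real N * infdist x A \<le> real n * infdist x A"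
        using that infdist_nonneg by (intro mult_right_mono) auto
      then show ?thesis using N by (simp add: f_def)
    qed
    then have "\<forall>\<^sub>F n in sequentially. f n x = indicator A x"
      using out unfolding eventually_sequentially by auto
    then show ?thesis by (rule tendsto_eventually)
  qed
  show thesis
  proof (rule that[of f])
    show "continuous_on UNIV (f n)" for n unfolding f_def by (intro continuous_intros)
    show "0 \<le> f n x" "f n x \<le> 1" for n x using infdist_nonneg[of x A] by (auto simp: f_def)
  qed (rule lim)
qed

lemma measure_eqI_continuous:
  fixes \<mu> \<nu> :: "'a :: metric_space measure"
  assumes \<mu>: "prob_space \<mu>" "sets \<mu> = sets borel" and \<nu>: "prob_space \<nu>" "sets \<nu> = sets borel"
    and eq: "\<And>f :: 'a \<Rightarrow> real. continuous_on UNIV f \<Longrightarrow> (LINT x|\<mu>. f x) = (LINT x|\<nu>. f x)"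
  shows "\<mu> = \<nu>"
proof -
  interpret \<mu>: prob_space \<mu> by fact
  interpret \<nu>: prob_space \<nu> by fact
  have [measurable_cong]: "sets \<mu> = sets borel" "sets \<nu> = sets borel" by fact+
  have space: "space \<mu> = UNIV" "space \<nu> = UNIV"
    using \<mu>(2) \<nu>(2) by (auto dest: sets_eq_imp_space_eq)
  have closed_eq: "measure \<mu> A = measure \<nu> A" if "closed A" for A
  proof -
    obtain f :: "nat \<Rightarrow> 'a \<Rightarrow> real" where cont: "\<And>n. continuous_on UNIV (f n)"
      and f: "\<And>n x. 0 \<le> f n x" "\<And>n x. f n x \<le> 1" and lim: "\<And>x. (\<lambda>n. f n x) \<longlonglongrightarrow> indicator A x"
      using closed_indicator_limit[OF \<open>closed A\<close>] by metis
    have [measurable]: "f n \<in> borel_measurable borel" for n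
      using cont by (rule borel_measurable_continuous_onI)
    have A: "A \<in> sets borel" using that by simp
    have "(\<lambda>n. LINT x|\<mu>. f n x) \<longlonglongrightarrow> (LINT x|\<mu>. indicator A x)"
      by (rule integral_dominated_convergence[where w = "\<lambda>_. 1"]) (use A lim f in auto)
    moreover have "(\<lambda>n. LINT x|\<nu>. f n x) \<longlonglongrightarrow> (LINT x|\<nu>. indicator A x)"
      by (rule integral_dominated_convergence[where w = "\<lambda>_. 1"]) (use A lim f in auto)
    ultimately have "(LINT x|\<mu>. indicat_real A x) = (LINT x|\<nu>. indicator A x)"
      unfolding eq[OF cont] by (rule LIMSEQ_unique)
    then show ?thesis using A by (simp add: space)
  qed
  show ?thesis
  proof (rule measure_eqI_generator_eq[where E = "Collect closed" and \<Omega> = UNIV and A = "\<lambda>_. UNIV"])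
    show "Int_stable (Collect closed :: 'a set set)" by (auto simp: Int_stable_def)
    show "sets \<mu> = sigma_sets UNIV (Collect closed)" "sets \<nu> = sigma_sets UNIV (Collect closed)"
      using \<mu>(2) \<nu>(2) by (simp_all add: borel_eq_closed)
    show "emeasure \<mu> X = emeasure \<nu> X" if "X \<in> Collect closed" for X
      using closed_eq[of X] that by (simp add: \<mu>.emeasure_eq_measure \<nu>.emeasure_eq_measure)
  qed auto
qed

lemma integrable_on_ball:
  fixes f :: "complex \<Rightarrow> real"
  assumes \<mu>: "\<mu> \<in> prob_measures_on (cball 0 \<rho>)" and f: "continuous_on UNIV f"
  shows "integrable \<mu> f"
proof -
  interpret prob_space \<mu> using prob_measures_onD[OF \<mu>] by blast
  have [measurable_cong]: "sets \<mu> = sets borel" by (rule prob_measures_onD[OF \<mu>])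
  have [measurable]: "f \<in> borel_measurable borel" using f by (rule borel_measurable_continuous_onI)
  have "bounded (f ` cball 0 \<rho>)"
    by (intro compact_imp_bounded compact_continuous_image) (auto intro: continuous_on_subset[OF f])
  then obtain B where B: "\<And>z. z \<in> cball 0 \<rho> \<Longrightarrow> norm (f z) \<le> B"
    unfolding bounded_iff by blast
  show ?thesis
    by (rule integrable_const_bound[of _ B])
       (use prob_measures_on_AE[OF \<mu>] B in \<open>auto elim!: eventually_mono\<close>)
qed

section \<open>Gaussian moments and the Gaussian kernel\<close>

definition gauss_moment :: "real \<Rightarrow> nat \<Rightarrow> nat \<Rightarrow> complex measure \<Rightarrow> real" where
  "gauss_moment t i j \<mu> = (LINT z|\<mu>. exp (- t * (cmod z)\<^sup>2) * Re z ^ i * Im z ^ j)"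

text \<open>The Gaussian weight is positive and continuous, so by Stone-Weierstrass \<open>f\<close>
  divided by it is a uniform limit of polynomials on the disc; equal moments mean equal integrals of
  weight times polynomial.\<close>

lemma gauss_moment_determines:
  assumes \<mu>: "\<mu> \<in> prob_measures_on (cball 0 \<rho>)" and \<nu>: "\<nu> \<in> prob_measures_on (cball 0 \<rho>)"
    and eq: "\<And>i j. gauss_moment t i j \<mu> = gauss_moment t i j \<nu>"
  shows "\<mu> = \<nu>"
proof -
  interpret \<mu>: prob_space \<mu> using prob_measures_onD[OF \<mu>] by blast
  interpret \<nu>: prob_space \<nu> using prob_measures_onD[OF \<nu>] by blast
  define e where "e i j z = exp (- t * (cmod z)\<^sup>2) * Re z ^ i * Im z ^ j" for i j z
  have e_cont: "continuous_on UNIV (e i j)" for i j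
    unfolding e_def by (intro continuous_intros)
  \<comment> \<open>Quantifying over all \<open>i\<close> and \<open>j\<close> makes the property
    stable under multiplication by \<open>Re\<close> and \<open>Im\<close>, which merely shift the
    indices. Polynomials then follow by induction.\<close>
  define W where "W f \<longleftrightarrow> continuous_on UNIV f \<and>
    (\<forall>i j. (LINT z|\<mu>. e i j z * f z) = (LINT z|\<nu>. e i j z * f z))" for f :: "complex \<Rightarrow> real"
  have W_add: "W (\<lambda>z. f z + g z)" if "W f" "W g" for f g
  proof -
    have c: "continuous_on UNIV (\<lambda>z. e i j z * f z)" "continuous_on UNIV (\<lambda>z. e i j z * g z)" for i j
      using that e_cont by (auto simp: W_def intro!: continuous_intros)
    show ?thesis
      using that integrable_on_ball[OF \<mu> c(1)] integrable_on_ball[OF \<mu> c(2)]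
        integrable_on_ball[OF \<nu> c(1)] integrable_on_ball[OF \<nu> c(2)]
      by (auto simp: W_def distrib_left intro!: continuous_intros)
  qed
  have W_scale: "W (\<lambda>z. c * f z)" if "W f" for f c
  proof -
    have "(LINT z|M. e i j z * (c * f z)) = c * (LINT z|M. e i j z * f z)" for M :: "complex measure" and i j
      by (simp add: mult.left_commute[of "e i j _" c])
    then show ?thesis using that by (auto simp: W_def intro!: continuous_intros)
  qed
  have W_Re: "W (\<lambda>z. Re z * f z)" if "W f" for f
  proof -
    have "(LINT z|M. e i j z * (Re z * f z)) = (LINT z|M. e (Suc i) j z * f z)" for M :: "complex measure" and i j
      by (rule Bochner_Integration.integral_cong) (auto simp: e_def)
    then show ?thesis using that by (auto simp: W_def intro!: continuous_intros)
  qed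
  have W_Im: "W (\<lambda>z. Im z * f z)" if "W f" for f
  proof -
    have "(LINT z|M. e i j z * (Im z * f z)) = (LINT z|M. e i (Suc j) z * f z)" for M :: "complex measure" and i j
      by (rule Bochner_Integration.integral_cong) (auto simp: e_def)
    then show ?thesis using that by (auto simp: W_def intro!: continuous_intros)
  qed
  have poly: "W (\<lambda>z. p z * f z)" if "real_polynomial_function p" "W f" for p f
    using that
  proof (induction p arbitrary: f rule: real_polynomial_function.induct)
    case (linear p)
    then interpret bounded_linear p by simp
    have "p z * f z = p 1 * (Re z * f z) + p \<i> * (Im z * f z)" for z
    proof -
      have "p z = p (Re z *\<^sub>R 1 + Im z *\<^sub>R \<i>)"
        by (rule arg_cong[where f = p]) (simp add: complex_eq_iff)
      also have "\<dots> = Re z * p 1 + Im z * p \<i>"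
        by (simp only: add scaleR real_scaleR_def)
      finally have "p z * f z = (Re z * p 1 + Im z * p \<i>) * f z" by (rule arg_cong)
      also have "\<dots> = p 1 * (Re z * f z) + p \<i> * (Im z * f z)" by (simp add: algebra_simps)
      finally show ?thesis .
    qed
    then have "(\<lambda>z. p z * f z) = (\<lambda>z. p 1 * (Re z * f z) + p \<i> * (Im z * f z))" by (rule ext)
    then show ?case using W_add[OF W_scale[OF W_Re[OF linear.prems]] W_scale[OF W_Im[OF linear.prems]]] by metis
  next
    case (const c)
    then show ?case by (rule W_scale)
  next
    case (add p q)
    then show ?case using W_add[of "\<lambda>z. p z * f z" "\<lambda>z. q z * f z"] by (simp add: distrib_right)
  next
    case (mult p q)
    then have "W (\<lambda>z. p z * (q z * f z))" by blast
    then show ?case by (simp add: mult.assoc)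
  qed
  have W1: "W (\<lambda>_. 1)"
    using eq by (auto simp: W_def e_def gauss_moment_def)
  have poly_eq: "(LINT z|\<mu>. e 0 0 z * p z) = (LINT z|\<nu>. e 0 0 z * p z)" if "real_polynomial_function p" for p
    using poly[OF that W1] by (simp add: W_def)
  have e0: "e 0 0 z > 0" for z by (simp add: e_def)
  have e0_neq: "e 0 0 z \<noteq> 0" for z using e0[of z] by simp
  define C where "C = exp (\<bar>t\<bar> * \<rho>\<^sup>2)"
  have e0_le: "e 0 0 z \<le> C" if "z \<in> cball 0 \<rho>" for z
  proof -
    have "- t * (cmod z)\<^sup>2 \<le> \<bar>t\<bar> * \<rho>\<^sup>2"
      using that by (intro mult_mono power_mono) auto
    then show ?thesis by (simp add: e_def C_def)
  qed
  show ?thesis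
  proof (rule measure_eqI_continuous)
    fix f :: "complex \<Rightarrow> real" assume f: "continuous_on UNIV f"
    have "\<bar>(LINT z|\<mu>. f z) - (LINT z|\<nu>. f z)\<bar> \<le> 2 * C * \<epsilon>" if "\<epsilon> > 0" for \<epsilon>
    proof -
      have "continuous_on (cball 0 \<rho>) (\<lambda>z. f z / e 0 0 z)"
        using e0_neq by (intro continuous_on_divide continuous_on_subset[OF f] continuous_on_subset[OF e_cont]) auto
      from Stone_Weierstrass_real_polynomial_function[OF compact_cball this \<open>\<epsilon> > 0\<close>]
      obtain p where p: "real_polynomial_function p"
        and approx: "\<And>z. z \<in> cball 0 \<rho> \<Longrightarrow> \<bar>f z / e 0 0 z - p z\<bar> < \<epsilon>" by metis
      have p_cont: "continuous_on UNIV (\<lambda>z. e 0 0 z * p z)"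
        using continuous_real_polymonial_function[OF p]
        by (intro continuous_intros e_cont continuous_at_imp_continuous_on ballI)
      have close: "\<bar>(LINT z|M. f z) - (LINT z|M. e 0 0 z * p z)\<bar> \<le> C * \<epsilon>"
        if M: "M \<in> prob_measures_on (cball 0 \<rho>)" for M
      proof -
        interpret M: prob_space M using prob_measures_onD[OF M] by blast
        note int = integrable_on_ball[OF M f] integrable_on_ball[OF M p_cont]
        have bnd: "AE z in M. norm (f z - e 0 0 z * p z) \<le> C * \<epsilon>"
          using prob_measures_on_AE[OF M]
        proof (rule eventually_mono)
          fix z :: complex assume z: "z \<in> cball 0 \<rho>"
          have "norm (f z - e 0 0 z * p z) = e 0 0 z * \<bar>f z / e 0 0 z - p z\<bar>"
            using e0[of z] by (simp add: abs_mult_pos' right_diff_distrib)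
          also have "\<dots> \<le> C * \<epsilon>"
            using e0_le[OF z] approx[OF z] e0[of z] by (intro mult_mono) auto
          finally show "norm (f z - e 0 0 z * p z) \<le> C * \<epsilon>" .
        qed simp
        have "\<bar>LINT z|M. f z - e 0 0 z * p z\<bar> \<le> (LINT z|M. \<bar>f z - e 0 0 z * p z\<bar>)"
          by (rule integral_abs_bound)
        also have "\<dots> \<le> (LINT z|M. C * \<epsilon>)"
          using bnd int by (intro integral_mono_AE) auto
        also have "\<dots> = C * \<epsilon>" by (simp add: M.prob_space)
        finally show ?thesis using int by simp
      qed
      show ?thesis using close[OF \<mu>] close[OF \<nu>] poly_eq[OF p] by linarith
    qed
    note bound = this
    show "(LINT z|\<mu>. f z) = (LINT z|\<nu>. f z)"
    proof (rule ccontr)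
      assume "\<not> ?thesis"
      then have pos: "\<bar>(LINT z|\<mu>. f z) - (LINT z|\<nu>. f z)\<bar> > 0" by simp
      have C: "C > 0" by (simp add: C_def)
      show False
        using bound[of "\<bar>(LINT z|\<mu>. f z) - (LINT z|\<nu>. f z)\<bar> / (4 * C)"] pos C by (simp add: field_simps)
    qed
  qed (use prob_measures_onD[OF \<mu>] prob_measures_onD[OF \<nu>] in auto)
qed

definition gauss_energy :: "real \<Rightarrow> complex measure \<Rightarrow> complex measure \<Rightarrow> real" where
  "gauss_energy t \<mu> \<nu> = (LINT z|\<mu>. LINT w|\<nu>. exp (- t * (cmod (z - w))\<^sup>2))"

lemma AE_pair_ball:
  assumes \<mu>: "\<mu> \<in> prob_measures_on (cball 0 \<rho>)" and \<nu>: "\<nu> \<in> prob_measures_on (cball 0 \<rho>)"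
  shows "AE p in \<mu> \<Otimes>\<^sub>M \<nu>. cmod (fst p) \<le> \<rho> \<and> cmod (snd p) \<le> \<rho>"
proof -
  interpret \<mu>: prob_space \<mu> using prob_measures_onD[OF \<mu>] by blast
  interpret \<nu>: prob_space \<nu> using prob_measures_onD[OF \<nu>] by blast
  interpret pair_sigma_finite \<mu> \<nu> ..
  have [measurable_cong]: "sets \<mu> = sets borel" "sets \<nu> = sets borel"
    using prob_measures_onD \<mu> \<nu> by auto
  show ?thesis
  proof (rule AE_pair_measure)
    show "AE z in \<mu>. AE w in \<nu>. cmod (fst (z, w)) \<le> \<rho> \<and> cmod (snd (z, w)) \<le> \<rho>"
      using prob_measures_on_AE[OF \<mu>] prob_measures_on_AE[OF \<nu>]
      by (auto elim!: eventually_mono)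
  qed measurable
qed

text \<open>The factor \<open>exp (2t Re(z * cnj w))\<close> of the Gaussian kernel is a power series with
  positive coefficients in \<open>Re z * Re w\<close> and \<open>Im z * Im w\<close>: this is where positive definiteness comes from.\<close>

lemma gauss_energy_sums:
  assumes \<mu>: "\<mu> \<in> prob_measures_on (cball 0 \<rho>)" and \<nu>: "\<nu> \<in> prob_measures_on (cball 0 \<rho>)"
    and t: "t \<ge> 0"
  shows "(\<lambda>k. (2 * t) ^ k / fact k * (\<Sum>j\<le>k. of_nat (k choose j) *
            (gauss_moment t j (k - j) \<mu> * gauss_moment t j (k - j) \<nu>))) sums gauss_energy t \<mu> \<nu>"
proof -
  interpret \<mu>: prob_space \<mu> using prob_measures_onD[OF \<mu>] by blast
  interpret \<nu>: prob_space \<nu> using prob_measures_onD[OF \<nu>] by blast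
  interpret pair_prob_space \<mu> \<nu> ..
  have [measurable_cong]: "sets \<mu> = sets borel" "sets \<nu> = sets borel"
    using prob_measures_onD \<mu> \<nu> by auto
  note ball = AE_pair_ball[OF \<mu> \<nu>]
  define e where "e z = exp (- t * (cmod z)\<^sup>2)" for z
  have e_cont: "continuous_on UNIV e" unfolding e_def by (intro continuous_intros)
  have e_meas [measurable]: "e \<in> borel_measurable borel"
    using e_cont by (rule borel_measurable_continuous_onI)
  have e_bounds: "0 \<le> e z" "e z \<le> 1" for z using t by (auto simp: e_def)
  \<comment> \<open>The term of order \<open>k\<close> in the exponential series of the mixed
    factor, with both Gaussian weights kept outside. On the discs it is dominated by the
    corresponding term of \<open>exp (2 * t * \<rho>\<^sup>2)\<close>.\<close>
  define F where "F k p = (2 * t) ^ k / fact k * (e (fst p) * e (snd p) *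
      (Re (fst p) * Re (snd p) + Im (fst p) * Im (snd p)) ^ k)" for k and p :: "complex \<times> complex"
  have F_meas [measurable]: "F k \<in> borel_measurable (\<mu> \<Otimes>\<^sub>M \<nu>)" for k
    unfolding F_def by measurable
  have F_bound: "norm (F k p) \<le> (2 * t * \<rho>\<^sup>2) ^ k / fact k"
    if "cmod (fst p) \<le> \<rho> \<and> cmod (snd p) \<le> \<rho>" for k p
  proof -
    have "\<bar>Re (fst p) * Re (snd p) + Im (fst p) * Im (snd p)\<bar> \<le> cmod (fst p) * cmod (snd p)"
      using Cauchy_Schwarz_ineq2[of "fst p" "snd p"] by (simp add: inner_complex_def)
    also have "\<dots> \<le> \<rho> * \<rho>"
      using that norm_ge_zero order_trans by (intro mult_mono) blast+
    finally have "\<bar>Re (fst p) * Re (snd p) + Im (fst p) * Im (snd p)\<bar> ^ k \<le> (\<rho>\<^sup>2) ^ k"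
      by (intro power_mono) (auto simp: power2_eq_square)
    then have "e (fst p) * e (snd p) * \<bar>Re (fst p) * Re (snd p) + Im (fst p) * Im (snd p)\<bar> ^ k \<le> 1 * 1 * (\<rho>\<^sup>2) ^ k"
      using e_bounds by (intro mult_mono) auto
    then have "(2 * t) ^ k / fact k * (e (fst p) * e (snd p) * \<bar>Re (fst p) * Re (snd p) + Im (fst p) * Im (snd p)\<bar> ^ k)
      \<le> (2 * t) ^ k / fact k * (\<rho>\<^sup>2) ^ k"
      using t by (intro mult_left_mono) auto
    then show ?thesis
      using t e_bounds by (simp add: F_def abs_mult power_abs power_mult_distrib)
  qed
  have F_int: "integrable (\<mu> \<Otimes>\<^sub>M \<nu>) (F k)" for k
    by (rule P.integrable_const_bound[of _ "(2 * t * \<rho>\<^sup>2) ^ k / fact k"])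
       (rule eventually_mono[OF ball F_bound], auto)
  have exp_summable: "summable (\<lambda>k. (2 * t * \<rho>\<^sup>2) ^ k / fact k)"
    using summable_exp[of "2 * t * \<rho>\<^sup>2"] by (simp add: field_simps)
  have F_sums: "(\<lambda>k. F k p) sums exp (- t * (cmod (fst p - snd p))\<^sup>2)" for p
  proof -
    define s where "s = Re (fst p) * Re (snd p) + Im (fst p) * Im (snd p)"
    have "(\<lambda>k. e (fst p) * e (snd p) * ((2 * t * s) ^ k / fact k)) sums (e (fst p) * e (snd p) * exp (2 * t * s))"
      using exp_converges[of "2 * t * s"] by (intro sums_mult) (simp add: field_simps)
    moreover have "e (fst p) * e (snd p) * exp (2 * t * s) = exp (- t * (cmod (fst p - snd p))\<^sup>2)"
      unfolding e_def s_def cmod_power2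
      by (simp add: exp_add[symmetric] algebra_simps power2_eq_square)
    moreover have "F k p = e (fst p) * e (snd p) * ((2 * t * s) ^ k / fact k)" for k
      unfolding F_def s_def[symmetric] power_mult_distrib[of "2 * t"] by simp
    ultimately show ?thesis by (simp only:)
  qed
  have "(\<lambda>k. integral\<^sup>L (\<mu> \<Otimes>\<^sub>M \<nu>) (F k)) sums (LINT p|(\<mu> \<Otimes>\<^sub>M \<nu>). (\<Sum>k. F k p))"
  proof (rule sums_integral[OF F_int])
    show "AE p in \<mu> \<Otimes>\<^sub>M \<nu>. summable (\<lambda>k. norm (F k p))"
    proof (rule eventually_mono[OF ball])
      fix p assume "cmod (fst p) \<le> \<rho> \<and> cmod (snd p) \<le> \<rho>"
      then have "norm (norm (F k p)) \<le> (2 * t * \<rho>\<^sup>2) ^ k / fact k" for k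
        using F_bound[of p k] by simp
      then show "summable (\<lambda>k. norm (F k p))"
        by (intro summable_comparison_test'[OF exp_summable])
    qed
    show "summable (\<lambda>k. LINT p|(\<mu> \<Otimes>\<^sub>M \<nu>). norm (F k p))"
    proof (rule summable_comparison_test'[OF exp_summable, of 0])
      fix k :: nat
      have "(LINT p|(\<mu> \<Otimes>\<^sub>M \<nu>). norm (F k p)) \<le> (LINT p|(\<mu> \<Otimes>\<^sub>M \<nu>). (2 * t * \<rho>\<^sup>2) ^ k / fact k)"
        using F_int by (intro integral_mono_AE eventually_mono[OF ball F_bound]) auto
      then show "norm (LINT p|(\<mu> \<Otimes>\<^sub>M \<nu>). norm (F k p)) \<le> (2 * t * \<rho>\<^sup>2) ^ k / fact k"
        by (simp add: P.prob_space)
    qed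
  qed
  moreover have "(LINT p|(\<mu> \<Otimes>\<^sub>M \<nu>). (\<Sum>k. F k p)) = gauss_energy t \<mu> \<nu>"
  proof -
    have "integrable (\<mu> \<Otimes>\<^sub>M \<nu>) (\<lambda>p. exp (- t * (cmod (fst p - snd p))\<^sup>2))"
      using t by (intro P.integrable_const_bound[of _ 1]) auto
    from integral_fst'[OF this] show ?thesis
      using sums_unique[OF F_sums] by (simp add: gauss_energy_def)
  qed
  moreover have "integral\<^sup>L (\<mu> \<Otimes>\<^sub>M \<nu>) (F k) = (2 * t) ^ k / fact k * (\<Sum>j\<le>k. of_nat (k choose j) *
            (gauss_moment t j (k - j) \<mu> * gauss_moment t j (k - j) \<nu>))" (is "_ = ?m k") for k
  proof -
    define g where "g j z = e z * Re z ^ j * Im z ^ (k - j)" for j z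
    have g_int: "integrable \<mu> (g j)" "integrable \<nu> (g j)" for j
      unfolding g_def by (intro integrable_on_ball[OF \<mu>] integrable_on_ball[OF \<nu>] continuous_intros e_cont)+
    have gm: "gauss_moment t j (k - j) M = (LINT z|M. g j z)" for M j
      by (simp add: gauss_moment_def g_def e_def)
    \<comment> \<open>By the binomial theorem each summand is a function of \<open>z\<close> times
      the same function of \<open>w\<close>, so its double integral is a product of two
      moments.\<close>
    have inner: "(LINT w|\<nu>. F k (z, w)) = (2 * t) ^ k / fact k * (\<Sum>j\<le>k. of_nat (k choose j) *
            (g j z * (LINT w|\<nu>. g j w)))" for z
    proof -
      have "F k (z, w) = (2 * t) ^ k / fact k * (\<Sum>j\<le>k. of_nat (k choose j) * (g j z * g j w))" for w
        unfolding F_def binomial_ring g_def sum_distrib_left fst_conv snd_conv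
        by (rule sum.cong) (simp_all add: power_mult_distrib)
      then have "(LINT w|\<nu>. F k (z, w)) = (2 * t) ^ k / fact k *
          (LINT w|\<nu>. (\<Sum>j\<le>k. of_nat (k choose j) * (g j z * g j w)))" by simp
      also have "(LINT w|\<nu>. (\<Sum>j\<le>k. of_nat (k choose j) * (g j z * g j w)))
          = (\<Sum>j\<le>k. LINT w|\<nu>. of_nat (k choose j) * (g j z * g j w))"
        using g_int by (intro Bochner_Integration.integral_sum) auto
      finally show ?thesis by simp
    qed
    have "integral\<^sup>L (\<mu> \<Otimes>\<^sub>M \<nu>) (F k) = (LINT z|\<mu>. LINT w|\<nu>. F k (z, w))"
      by (rule integral_fst'[OF F_int, symmetric])
    also have "\<dots> = (2 * t) ^ k / fact k *
        (LINT z|\<mu>. (\<Sum>j\<le>k. of_nat (k choose j) * (g j z * (LINT w|\<nu>. g j w))))"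
      unfolding inner by simp
    also have "(LINT z|\<mu>. (\<Sum>j\<le>k. of_nat (k choose j) * (g j z * (LINT w|\<nu>. g j w))))
        = (\<Sum>j\<le>k. LINT z|\<mu>. of_nat (k choose j) * (g j z * (LINT w|\<nu>. g j w)))"
      using g_int by (intro Bochner_Integration.integral_sum) auto
    finally show ?thesis unfolding gm by simp
  qed
  ultimately show ?thesis by (simp only:)
qed

text \<open>Combining the three series gives a sum of squares of moment differences, with
  coefficients that are nonnegative and, for \<open>t > 0\<close>, positive. So the combination is
  nonnegative, and if it vanishes for some \<open>t > 0\<close> then all moments agree.\<close>

lemma
  assumes \<mu>: "\<mu> \<in> prob_measures_on (cball 0 \<rho>)" and \<nu>: "\<nu> \<in> prob_measures_on (cball 0 \<rho>)"
  shows gauss_energy_psd: "t \<ge> 0 \<Longrightarrow> 2 * gauss_energy t \<mu> \<nu> \<le> gauss_energy t \<mu> \<mu> + gauss_energy t \<nu> \<nu>"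
    and gauss_energy_definite:
      "t > 0 \<Longrightarrow> gauss_energy t \<mu> \<mu> + gauss_energy t \<nu> \<nu> \<le> 2 * gauss_energy t \<mu> \<nu> \<Longrightarrow> \<mu> = \<nu>"
proof -
  define a where "a k = (2 * t) ^ k / fact k * (\<Sum>j\<le>k. of_nat (k choose j) *
     (gauss_moment t j (k - j) \<mu> - gauss_moment t j (k - j) \<nu>)\<^sup>2)" for k
  have sums: "a sums (gauss_energy t \<mu> \<mu> + gauss_energy t \<nu> \<nu> - 2 * gauss_energy t \<mu> \<nu>)" if "t \<ge> 0"
  proof -
    note s = gauss_energy_sums[OF _ _ that]
    from sums_diff[OF sums_add[OF s[OF \<mu> \<mu>] s[OF \<nu> \<nu>]] sums_mult[OF s[OF \<mu> \<nu>], of 2]]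
    show ?thesis
      unfolding a_def
      by (rule sums_cong[THEN iffD1, rotated])
         (simp add: sum_distrib_left sum.distrib[symmetric] sum_subtractf[symmetric] algebra_simps power2_eq_square)
  qed
  have nonneg: "0 \<le> a k" if "t \<ge> 0" for k
    using that unfolding a_def by (intro mult_nonneg_nonneg sum_nonneg) auto
  {
    assume "t \<ge> 0"
    then show "2 * gauss_energy t \<mu> \<nu> \<le> gauss_energy t \<mu> \<mu> + gauss_energy t \<nu> \<nu>"
      using sums_le[OF nonneg sums_zero sums] by simp
  }
  assume t: "t > 0" and le: "gauss_energy t \<mu> \<mu> + gauss_energy t \<nu> \<nu> \<le> 2 * gauss_energy t \<mu> \<nu>"
  have "suminf a = 0"
    using sums_unique[OF sums] sums_le[OF nonneg sums_zero sums] t le by simp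
  then have a0: "a k = 0" for k
    using suminf_eq_zero_iff[OF sums_summable[OF sums] nonneg] t by simp
  show "\<mu> = \<nu>"
  proof (rule gauss_moment_determines[OF \<mu> \<nu>])
    fix i j
    \<comment> \<open>The moment with exponents \<open>i\<close> and \<open>j\<close> occurs in the
      term of order \<open>i + j\<close>.\<close>
    have "(\<Sum>l\<le>i + j. of_nat ((i + j) choose l) *
       (gauss_moment t l (i + j - l) \<mu> - gauss_moment t l (i + j - l) \<nu>)\<^sup>2) = 0"
      using a0[of "i + j"] t by (simp add: a_def)
    then have "of_nat ((i + j) choose i) *
       (gauss_moment t i (i + j - i) \<mu> - gauss_moment t i (i + j - i) \<nu>)\<^sup>2 = 0"
      by (subst (asm) sum_nonneg_eq_0_iff) (auto dest: bspec[of _ _ i])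
    then show "gauss_moment t i j \<mu> = gauss_moment t i j \<nu>" by simp
  qed
qed

text \<open>The quotient is the integral of \<open>exp (- t * s)\<close> over \<open>s\<close> in
  \<open>[a, b]\<close>; exchanging the order of integration leaves the integral of
  \<open>1 / s\<close>.\<close>

lemma frullani:
  assumes a: "0 < a" and ab: "a \<le> b"
  shows "(\<integral>\<^sup>+ t. ennreal ((exp (- t * a) - exp (- t * b)) / t) * indicator {0<..} t \<partial>lborel) = ennreal (ln (b / a))"
proof -
  have inner: "ennreal ((exp (- t * a) - exp (- t * b)) / t) * indicator {0<..} t
      = (\<integral>\<^sup>+ s. ennreal (exp (- t * s)) * indicator {a..b} s * indicator {0<..} t \<partial>lborel)" for t :: real
  proof (cases "t > 0")
    case True
    have "(\<integral>\<^sup>+ s. ennreal (exp (- t * s)) * indicator {a..b} s \<partial>lborel)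
        = ennreal (- exp (- t * b) / t - (- exp (- t * a) / t))"
      using True ab
      by (intro nn_integral_FTC_Icc) (auto intro!: derivative_eq_intros)
    then show ?thesis
      using True by (simp add: diff_divide_distrib)
  qed simp
  have outer: "(\<integral>\<^sup>+ t. ennreal (exp (- t * s)) * indicator {a..b} s * indicator {0<..} t \<partial>lborel)
      = ennreal (1 / s) * indicator {a..b} s" for s :: real
  proof (cases "s \<in> {a..b}")
    case True
    then have s: "s > 0" using a by simp
    have lim: "((\<lambda>t. - exp (- t * s) / s) \<longlongrightarrow> 0) at_top"
      using s by real_asymp
    have "(\<integral>\<^sup>+ t. ennreal (exp (- t * s)) * indicator {0..} t \<partial>lborel)
        = ennreal (0 - (- exp (- 0 * s) / s))"
      using s by (intro nn_integral_FTC_atLeast[OF _ _ _ lim]) (auto intro!: derivative_eq_intros)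
    moreover have "(\<integral>\<^sup>+ t. ennreal (exp (- t * s)) * indicator {0<..} t \<partial>lborel)
        = (\<integral>\<^sup>+ t. ennreal (exp (- t * s)) * indicator {0..} t \<partial>lborel)"
      using AE_lborel_singleton[of 0]
      by (intro nn_integral_cong_AE) (auto elim!: eventually_mono split: split_indicator)
    ultimately show ?thesis using True by simp
  qed simp
  have "(\<integral>\<^sup>+ t. ennreal ((exp (- t * a) - exp (- t * b)) / t) * indicator {0<..} t \<partial>lborel)
      = (\<integral>\<^sup>+ t. (\<integral>\<^sup>+ s. ennreal (exp (- t * s)) * indicator {a..b} s * indicator {0<..} t \<partial>lborel) \<partial>lborel)"
    unfolding inner ..
  also have "\<dots> = (\<integral>\<^sup>+ s. (\<integral>\<^sup>+ t. ennreal (exp (- t * s)) * indicator {a..b} s * indicator {0<..} t \<partial>lborel) \<partial>lborel)"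
    by (rule lborel_pair.Fubini'[symmetric]) measurable
  also have "\<dots> = (\<integral>\<^sup>+ s. ennreal (1 / s) * indicator {a..b} s \<partial>lborel)"
    unfolding outer ..
  also have "\<dots> = ennreal (ln b - ln a)"
    using a ab by (intro nn_integral_FTC_Icc) (auto intro!: derivative_eq_intros simp: field_simps)
  finally show ?thesis using a ab by (simp add: ln_div)
qed

text \<open>Frullani's integral exhibits the kernel as a positive mixture of Gaussians, up to constants that
  cancel on measures of total mass zero.\<close>

lemma log_gap_frullani:
  assumes D: "D > 0"
  shows "(\<integral>\<^sup>+ t. ennreal ((exp (- t * (cmod (z - w))\<^sup>2) - exp (- t * D\<^sup>2)) / t) * indicator {0<..} t \<partial>lborel)
     = 2 * log_gap D z w" (is "?I = _")
proof -
  define d where "d = cmod (z - w)"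
  \<comment> \<open>Beyond distance \<open>D\<close> both sides are zero, since
    \<open>ennreal\<close> discards negative values. On the diagonal both are infinite: replacing
    the squared distance by \<open>D\<^sup>2 * exp (- n)\<close> lowers the integral, and already
    gives \<open>n\<close>.\<close>
  consider "d = 0" | "0 < d" "d \<le> D" | "d > D" using D by (fastforce simp: d_def)
  then show ?thesis
  proof cases
    case 1
    have "ennreal (real n) \<le> ?I" for n :: nat
    proof -
      have "ennreal (real n) = ennreal (ln (D\<^sup>2 / (D\<^sup>2 * exp (- real n))))"
        using D by (simp add: exp_minus field_simps)
      also have "\<dots> = (\<integral>\<^sup>+ t. ennreal ((exp (- t * (D\<^sup>2 * exp (- real n))) - exp (- t * D\<^sup>2)) / t) * indicator {0<..} t \<partial>lborel)"
        using D by (intro frullani[symmetric]) auto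
      also have "\<dots> \<le> ?I"
      proof (rule nn_integral_mono)
        fix t :: real
        have "exp (- t * (D\<^sup>2 * exp (- real n))) \<le> exp (- t * (cmod (z - w))\<^sup>2)" if "t > 0"
          using 1 that unfolding d_def by simp
        then have "(exp (- t * (D\<^sup>2 * exp (- real n))) - exp (- t * D\<^sup>2)) / t
            \<le> (exp (- t * (cmod (z - w))\<^sup>2) - exp (- t * D\<^sup>2)) / t" if "t > 0"
          using that by (intro divide_right_mono diff_right_mono) auto
        then show "ennreal ((exp (- t * (D\<^sup>2 * exp (- real n))) - exp (- t * D\<^sup>2)) / t) * indicator {0<..} t
            \<le> ennreal ((exp (- t * (cmod (z - w))\<^sup>2) - exp (- t * D\<^sup>2)) / t) * indicator {0<..} t"
          by (cases "t > 0") (simp_all only: ennreal_leI indicator_simps greaterThan_iff mult_1_right mult_zero_right order_refl not_False_eq_True)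
      qed
      finally show ?thesis .
    qed
    note large = this
    have "?I = \<infinity>"
    proof (rule ccontr)
      assume "?I \<noteq> \<infinity>"
      then obtain n :: nat where "?I < ennreal (real n)"
        using ennreal_Ex_less_of_nat[of ?I] unfolding infinity_ennreal_def top.not_eq_extremum ennreal_of_nat_eq_real_of_nat
        by blast
      with large[of n] show False by (rule leD[THEN notE])
    qed
    moreover have "2 * log_gap D z w = \<infinity>" using 1 by (simp add: log_gap_def d_def ennreal_mult_top)
    ultimately show ?thesis by (simp only:)
  next
    case 2
    have "?I = ennreal (ln (D\<^sup>2 / d\<^sup>2))"
      unfolding d_def[symmetric] using 2 by (intro frullani power_mono) auto
    also have "ln (D\<^sup>2 / d\<^sup>2) = 2 * ln (D / d)"
      using 2 D by (simp add: ln_div ln_realpow)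
    also have "ennreal (2 * ln (D / d)) = 2 * ennreal (ln (D / d))"
      using 2 by (subst ennreal_mult) auto
    finally show ?thesis using 2 by (auto simp: log_gap_def d_def)
  next
    case 3
    have "ennreal ((exp (- t * (cmod (z - w))\<^sup>2) - exp (- t * D\<^sup>2)) / t) * indicator {0<..} t = 0" for t
    proof (cases "t > 0")
      case True
      have "D\<^sup>2 \<le> (cmod (z - w))\<^sup>2" using 3 D unfolding d_def by (intro power_mono) auto
      then have "(exp (- t * (cmod (z - w))\<^sup>2) - exp (- t * D\<^sup>2)) / t \<le> 0"
        using True by (intro divide_nonpos_pos) auto
      then show ?thesis by (simp add: ennreal_neg)
    qed simp
    then have "?I = (\<integral>\<^sup>+ t. 0 \<partial>(lborel :: real measure))" by (rule nn_integral_cong)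
    moreover have "z \<noteq> w" using 3 D by (auto simp: d_def)
    then have "log_gap D z w = 0"
      using 3 D by (auto simp: log_gap_def d_def[symmetric] ennreal_neg)
    ultimately show ?thesis by simp
  qed
qed

text \<open>The kernel identity is integrated over the product measure, and Tonelli moves the
  integral over \<open>t\<close> outside. On the disc distances are at most \<open>D\<close>, so the
  integrand is nonnegative and the truncation by \<open>ennreal\<close> never acts; the second claim
  is the integrated form of this positivity.\<close>

lemma mutual_energy_frullani:
  assumes \<mu>: "\<mu> \<in> prob_measures_on (cball 0 \<rho>)" and \<nu>: "\<nu> \<in> prob_measures_on (cball 0 \<rho>)"
    and D: "D > 0" "D \<ge> 2 * \<rho>"
  shows "2 * mutual_energy D \<mu> \<nu>
    = (\<integral>\<^sup>+ t. ennreal ((gauss_energy t \<mu> \<nu> - exp (- t * D\<^sup>2)) / t) * indicator {0<..} t \<partial>lborel)"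
    and "t > 0 \<Longrightarrow> exp (- t * D\<^sup>2) \<le> gauss_energy t \<mu> \<nu>"
proof -
  interpret \<mu>: prob_space \<mu> using prob_measures_onD[OF \<mu>] by blast
  interpret \<nu>: prob_space \<nu> using prob_measures_onD[OF \<nu>] by blast
  interpret pair_prob_space \<mu> \<nu> ..
  interpret L: pair_sigma_finite "\<mu> \<Otimes>\<^sub>M \<nu>" "lborel :: real measure" ..
  have [measurable_cong]: "sets \<mu> = sets borel" "sets \<nu> = sets borel"
    using prob_measures_onD \<mu> \<nu> by auto
  define k where "k t p = exp (- t * (cmod (fst p - snd p))\<^sup>2) - exp (- t * D\<^sup>2)" for t and p :: "complex \<times> complex"
  have k_int: "integrable (\<mu> \<Otimes>\<^sub>M \<nu>) (k t)" if "t > 0" for t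
    unfolding k_def using that
    by (intro Bochner_Integration.integrable_diff P.integrable_const_bound[of "\<lambda>p. exp (- t * (cmod (fst p - snd p))\<^sup>2)" 1]) auto
  have k_nonneg: "AE p in \<mu> \<Otimes>\<^sub>M \<nu>. 0 \<le> k t p" if "t > 0" for t
    using AE_pair_ball[OF \<mu> \<nu>]
  proof (rule eventually_mono)
    fix p assume "cmod (fst p) \<le> \<rho> \<and> cmod (snd p) \<le> \<rho>"
    then have "cmod (fst p - snd p) \<le> D"
      using norm_triangle_ineq4[of "fst p" "snd p"] D by linarith
    then have "(cmod (fst p - snd p))\<^sup>2 \<le> D\<^sup>2" by (intro power_mono) auto
    then show "0 \<le> k t p" using that by (simp add: k_def)
  qed
  have k_integral: "integral\<^sup>L (\<mu> \<Otimes>\<^sub>M \<nu>) (k t) = gauss_energy t \<mu> \<nu> - exp (- t * D\<^sup>2)" if "t > 0" for t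
  proof -
    have "integrable (\<mu> \<Otimes>\<^sub>M \<nu>) (\<lambda>p. exp (- t * (cmod (fst p - snd p))\<^sup>2))"
      using that by (intro P.integrable_const_bound[of _ 1]) auto
    from integral_fst'[OF this] this show ?thesis
      by (simp add: k_def[abs_def] gauss_energy_def P.prob_space)
  qed
  show "exp (- t * D\<^sup>2) \<le> gauss_energy t \<mu> \<nu>" if "t > 0"
    using integral_nonneg_AE[OF k_nonneg[OF that]] k_integral[OF that] by simp
  have "2 * mutual_energy D \<mu> \<nu> = (\<integral>\<^sup>+ z. \<integral>\<^sup>+ w. 2 * log_gap D z w \<partial>\<nu> \<partial>\<mu>)"
    unfolding mutual_energy_def gap_potential_def
    by (subst nn_integral_cmult[symmetric], measurable) (subst nn_integral_cmult, auto)
  also have "\<dots> = (\<integral>\<^sup>+ p. 2 * log_gap D (fst p) (snd p) \<partial>(\<mu> \<Otimes>\<^sub>M \<nu>))"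
    by (subst \<nu>.nn_integral_fst[symmetric]) auto
  also have "\<dots> = (\<integral>\<^sup>+ p. \<integral>\<^sup>+ t. ennreal (k t p / t) * indicator {0<..} t \<partial>lborel \<partial>(\<mu> \<Otimes>\<^sub>M \<nu>))"
    unfolding k_def by (subst log_gap_frullani[OF D(1)]) simp
  also have "\<dots> = (\<integral>\<^sup>+ t. \<integral>\<^sup>+ p. ennreal (k t p / t) * indicator {0<..} t \<partial>(\<mu> \<Otimes>\<^sub>M \<nu>) \<partial>lborel)"
    unfolding k_def by (rule L.Fubini'[symmetric]) measurable
  also have "\<dots> = (\<integral>\<^sup>+ t. ennreal ((gauss_energy t \<mu> \<nu> - exp (- t * D\<^sup>2)) / t) * indicator {0<..} t \<partial>lborel)"
  proof (rule nn_integral_cong)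
    fix t :: real
    show "(\<integral>\<^sup>+ p. ennreal (k t p / t) * indicator {0<..} t \<partial>(\<mu> \<Otimes>\<^sub>M \<nu>))
        = ennreal ((gauss_energy t \<mu> \<nu> - exp (- t * D\<^sup>2)) / t) * indicator {0<..} t"
    proof (cases "t > 0")
      case True
      have "(\<integral>\<^sup>+ p. ennreal (k t p / t) \<partial>(\<mu> \<Otimes>\<^sub>M \<nu>)) = ennreal (LINT p|(\<mu> \<Otimes>\<^sub>M \<nu>). k t p / t)"
        using k_int[OF True] k_nonneg[OF True] True
        by (intro nn_integral_eq_integral) (auto elim!: eventually_mono)
      then show ?thesis using True k_integral[OF True] by simp
    qed simp
  qed
  finally show "2 * mutual_energy D \<mu> \<nu>
    = (\<integral>\<^sup>+ t. ennreal ((gauss_energy t \<mu> \<nu> - exp (- t * D\<^sup>2)) / t) * indicator {0<..} t \<partial>lborel)" .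
qed

lemma gauss_energy_measurable [measurable]:
  assumes "prob_space \<mu>" "sets \<mu> = sets borel" "prob_space \<nu>" "sets \<nu> = sets borel"
  shows "(\<lambda>t. gauss_energy t \<mu> \<nu>) \<in> borel_measurable borel"
proof -
  interpret \<mu>: prob_space \<mu> by fact
  interpret \<nu>: prob_space \<nu> by fact
  have [measurable_cong]: "sets \<mu> = sets borel" "sets \<nu> = sets borel" by fact+
  show ?thesis unfolding gauss_energy_def by measurable
qed

text \<open>The terms \<open>exp (- t * D\<^sup>2)\<close> cancel because all measures have mass
  one, so Gaussian positivity passes through the integral over \<open>t\<close>. If equality holds
  with finite energies, the nonnegative defect vanishes for almost every \<open>t\<close>, and
  \<open>gauss_energy_definite\<close> at a single \<open>t > 0\<close> finishes.\<close>

lemma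
  assumes \<mu>: "\<mu> \<in> prob_measures_on (cball 0 \<rho>)" and \<nu>: "\<nu> \<in> prob_measures_on (cball 0 \<rho>)"
    and D: "D > 0" "D \<ge> 2 * \<rho>"
  shows mutual_energy_psd: "2 * mutual_energy D \<mu> \<nu> \<le> mutual_energy D \<mu> \<mu> + mutual_energy D \<nu> \<nu>"
    and mutual_energy_definite:
      "mutual_energy D \<mu> \<mu> + mutual_energy D \<nu> \<nu> \<le> 2 * mutual_energy D \<mu> \<nu> \<Longrightarrow>
       mutual_energy D \<mu> \<mu> < \<infinity> \<Longrightarrow> mutual_energy D \<nu> \<nu> < \<infinity> \<Longrightarrow> \<mu> = \<nu>"
proof -
  note P = prob_measures_onD[OF \<mu>] prob_measures_onD[OF \<nu>]
  have [measurable]: "(\<lambda>t. gauss_energy t \<mu> \<nu>) \<in> borel_measurable borel"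
    "(\<lambda>t. gauss_energy t \<mu> \<mu>) \<in> borel_measurable borel" "(\<lambda>t. gauss_energy t \<nu> \<nu>) \<in> borel_measurable borel"
    by (intro gauss_energy_measurable P)+
  define h where "h t M N = ennreal ((gauss_energy t M N - exp (- t * D\<^sup>2)) / t) * indicator {0<..} t" for t M N
  have eq: "2 * mutual_energy D M N = (\<integral>\<^sup>+ t. h t M N \<partial>lborel)"
    if "M \<in> prob_measures_on (cball 0 \<rho>)" "N \<in> prob_measures_on (cball 0 \<rho>)" for M N
    unfolding h_def using that D by (rule mutual_energy_frullani)
  have [measurable]: "(\<lambda>t. h t \<mu> \<nu>) \<in> borel_measurable lborel" "(\<lambda>t. h t \<mu> \<mu>) \<in> borel_measurable lborel"
    "(\<lambda>t. h t \<nu> \<nu>) \<in> borel_measurable lborel"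
    unfolding h_def by measurable
  have pos: "0 \<le> (gauss_energy t M N - exp (- t * D\<^sup>2)) / t"
    if "M \<in> prob_measures_on (cball 0 \<rho>)" "N \<in> prob_measures_on (cball 0 \<rho>)" "t > 0" for t M N
    using mutual_energy_frullani(2)[OF that(1,2) D that(3)] that(3) by simp
  have h2: "2 * h t \<mu> \<nu> = ennreal (2 * ((gauss_energy t \<mu> \<nu> - exp (- t * D\<^sup>2)) / t)) * indicator {0<..} t" for t
  proof -
    have dbl: "2 * ennreal x = ennreal (2 * x)" if "x \<ge> 0" for x using that by (simp add: ennreal_mult)
    show ?thesis
    proof (cases "t > 0")
      case True
      then show ?thesis
        unfolding h_def mult.assoc[symmetric] using dbl[OF pos[OF \<mu> \<nu> True]] by (simp only:)
    qed (simp add: h_def)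
  qed
  have h11: "h t \<mu> \<mu> + h t \<nu> \<nu> = ennreal ((gauss_energy t \<mu> \<mu> - exp (- t * D\<^sup>2)) / t +
      (gauss_energy t \<nu> \<nu> - exp (- t * D\<^sup>2)) / t) * indicator {0<..} t" for t
    unfolding h_def using pos[OF \<mu> \<mu>, of t] pos[OF \<nu> \<nu>, of t]
    by (cases "t > 0") simp_all
  have le: "2 * h t \<mu> \<nu> \<le> h t \<mu> \<mu> + h t \<nu> \<nu>" for t
  proof (cases "t > 0")
    case True
    have "2 * ((gauss_energy t \<mu> \<nu> - exp (- t * D\<^sup>2)) / t) = (2 * gauss_energy t \<mu> \<nu> - 2 * exp (- t * D\<^sup>2)) / t"
      by (simp add: algebra_simps)
    also have "\<dots> \<le> (gauss_energy t \<mu> \<mu> + gauss_energy t \<nu> \<nu> - 2 * exp (- t * D\<^sup>2)) / t"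
      using gauss_energy_psd[OF \<mu> \<nu>, of t] True by (intro divide_right_mono) auto
    also have "\<dots> = (gauss_energy t \<mu> \<mu> - exp (- t * D\<^sup>2)) / t + (gauss_energy t \<nu> \<nu> - exp (- t * D\<^sup>2)) / t"
      by (simp add: add_divide_distrib diff_divide_distrib)
    finally show ?thesis unfolding h2 h11 by (intro mult_right_mono ennreal_leI) auto
  qed (simp add: h_def)
  have I2: "2 * (2 * mutual_energy D \<mu> \<nu>) = (\<integral>\<^sup>+ t. 2 * h t \<mu> \<nu> \<partial>lborel)"
    unfolding eq[OF \<mu> \<nu>] by (subst nn_integral_cmult) auto
  have I11: "2 * (mutual_energy D \<mu> \<mu> + mutual_energy D \<nu> \<nu>) = (\<integral>\<^sup>+ t. h t \<mu> \<mu> + h t \<nu> \<nu> \<partial>lborel)"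
    unfolding distrib_left eq[OF \<mu> \<mu>] eq[OF \<nu> \<nu>] by (subst nn_integral_add) auto
  have "2 * (2 * mutual_energy D \<mu> \<nu>) \<le> 2 * (mutual_energy D \<mu> \<mu> + mutual_energy D \<nu> \<nu>)"
    unfolding I2 I11 by (intro nn_integral_mono le)
  then show "2 * mutual_energy D \<mu> \<nu> \<le> mutual_energy D \<mu> \<mu> + mutual_energy D \<nu> \<nu>"
    by (subst (asm) ennreal_mult_le_mult_iff) auto
  assume rev: "mutual_energy D \<mu> \<mu> + mutual_energy D \<nu> \<nu> \<le> 2 * mutual_energy D \<mu> \<nu>"
    and fin: "mutual_energy D \<mu> \<mu> < \<infinity>" "mutual_energy D \<nu> \<nu> < \<infinity>"
  have le2: "(\<integral>\<^sup>+ t. h t \<mu> \<mu> + h t \<nu> \<nu> \<partial>lborel) \<le> (\<integral>\<^sup>+ t. 2 * h t \<mu> \<nu> \<partial>lborel)"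
    unfolding I2[symmetric] I11[symmetric] using rev by (intro mult_left_mono) auto
  have fin11: "(\<integral>\<^sup>+ t. h t \<mu> \<mu> + h t \<nu> \<nu> \<partial>lborel) < \<infinity>"
    unfolding I11[symmetric] using fin by (auto simp: ennreal_mult_less_top)
  have fin2: "(\<integral>\<^sup>+ t. 2 * h t \<mu> \<nu> \<partial>lborel) < \<infinity>"
    by (rule order_le_less_trans[OF nn_integral_mono[OF le] fin11])
  have "(\<integral>\<^sup>+ t. (h t \<mu> \<mu> + h t \<nu> \<nu>) - 2 * h t \<mu> \<nu> \<partial>lborel)
      = (\<integral>\<^sup>+ t. h t \<mu> \<mu> + h t \<nu> \<nu> \<partial>lborel) - (\<integral>\<^sup>+ t. 2 * h t \<mu> \<nu> \<partial>lborel)"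
    using fin2 le by (intro nn_integral_diff) auto
  also have "\<dots> = 0" using le2 fin11 by (subst diff_eq_0_iff_ennreal) auto
  finally have AE: "AE t in lborel. (h t \<mu> \<mu> + h t \<nu> \<nu>) - 2 * h t \<mu> \<nu> = 0"
    by (subst (asm) nn_integral_0_iff_AE) auto
  \<comment> \<open>Any nondegenerate interval of positive numbers would do: a set of full measure
    meets it.\<close>
  have "\<exists>t\<in>{1<..<2}. (h t \<mu> \<mu> + h t \<nu> \<nu>) - 2 * h t \<mu> \<nu> = 0"
  proof (rule ccontr)
    assume "\<not> ?thesis"
    then have "AE t in lborel. \<not> (t \<in> {1<..<2::real})"
      using AE by (auto elim!: eventually_mono)
    then have "{1<..<2::real} \<in> null_sets lborel" by (subst AE_iff_null_sets) auto
    then have "emeasure lborel {1<..<2::real} = 0" by (rule null_setsD1)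
    then show False by (subst (asm) emeasure_lborel_Ioo) auto
  qed
  then obtain t where t: "(h t \<mu> \<mu> + h t \<nu> \<nu>) - 2 * h t \<mu> \<nu> = 0" "t \<in> {1<..<2}" by blast
  then have t0: "t > 0" by simp
  have "h t \<mu> \<mu> + h t \<nu> \<nu> \<le> 2 * h t \<mu> \<nu>" using t(1) by (rule ennreal_minus_eq_0)
  then have "(gauss_energy t \<mu> \<mu> - exp (- t * D\<^sup>2)) / t + (gauss_energy t \<nu> \<nu> - exp (- t * D\<^sup>2)) / t
      \<le> 2 * ((gauss_energy t \<mu> \<nu> - exp (- t * D\<^sup>2)) / t)"
    unfolding h2 h11 using t0 pos[OF \<mu> \<nu> t0]
    by (subst (asm) (1 2) indicator_simps(1)) (auto simp only: greaterThan_iff mult_1_right ennreal_le_iff)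
  moreover have "a + b \<le> 2 * c" if "(a - e) / t + (b - e) / t \<le> 2 * ((c - e) / t)" for a b c e :: real
    using that t0 by (simp add: divide_simps split: if_splits)
  ultimately have "gauss_energy t \<mu> \<mu> + gauss_energy t \<nu> \<nu> \<le> 2 * gauss_energy t \<mu> \<nu>" by blast
  then show "\<mu> = \<nu>" by (rule gauss_energy_definite[OF \<mu> \<nu> t0])
qed

section \<open>Equilibrium measures\<close>

text \<open>The convex combination is realised as a Bernoulli choice between the two measures, so
  the integral formula comes from the one for \<open>bind\<close>.\<close>

lemma mixture_exists:
  assumes \<mu>: "\<mu> \<in> prob_measures_on C" and \<nu>: "\<nu> \<in> prob_measures_on C" and s: "0 \<le> s" "s \<le> 1"
    and C: "C \<in> sets borel"
  obtains M where "M \<in> prob_measures_on C"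
    "\<And>f. f \<in> borel_measurable borel \<Longrightarrow>
      (\<integral>\<^sup>+ z. f z \<partial>M) = ennreal (1 - s) * (\<integral>\<^sup>+ z. f z \<partial>\<mu>) + ennreal s * (\<integral>\<^sup>+ z. f z \<partial>\<nu>)"
proof
  note P = prob_measures_onD[OF \<mu>] prob_measures_onD[OF \<nu>]
  define M where "M = measure_pmf (bernoulli_pmf s) \<bind> (\<lambda>b. if b then \<nu> else \<mu>)"
  have kernel: "(\<lambda>b. if b then \<nu> else \<mu>) \<in> measurable (measure_pmf (bernoulli_pmf s)) (subprob_algebra borel)"
    using P by (auto simp: space_subprob_algebra prob_space_imp_subprob_space)
  have sets: "sets M = sets borel"
    unfolding M_def using P by (subst sets_bind[where N = borel]) auto
  show int: "(\<integral>\<^sup>+ z. f z \<partial>M) = ennreal (1 - s) * (\<integral>\<^sup>+ z. f z \<partial>\<mu>) + ennreal s * (\<integral>\<^sup>+ z. f z \<partial>\<nu>)"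
    if "f \<in> borel_measurable borel" for f
    unfolding M_def nn_integral_bind[OF that kernel]
    using s by (subst nn_integral_bernoulli_pmf) (auto simp: add.commute mult.commute)
  have "emeasure M X = ennreal (1 - s) * emeasure \<mu> X + ennreal s * emeasure \<nu> X" if "X \<in> sets borel" for X
    using int[of "indicator X"] that sets P by simp
  moreover have "ennreal (1 - s) + ennreal s = 1"
    using s by (simp flip: ennreal_plus)
  ultimately show "M \<in> prob_measures_on C"
    using C P prob_space.emeasure_space_1[OF P(1)] prob_space.emeasure_space_1[OF P(5)]
      sets_eq_imp_space_eq[OF sets]
    by (auto simp: prob_measures_on_def sets intro!: prob_spaceI)
qed

text \<open>The right-hand side equals \<open>A\<close> at \<open>s = 0\<close> and has derivative
  \<open>2 * (B - A)\<close> there; if \<open>B < A\<close> it would drop below \<open>A\<close> for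
  small positive \<open>s\<close>. The \<open>s\<close> chosen in the proof is small enough for the
  linear term to beat the quadratic one.\<close>

lemma mutual_energy_scaled_le:
  fixes A B S :: real
  assumes "\<And>s. 0 \<le> s \<Longrightarrow> s \<le> 1 \<Longrightarrow> A \<le> (1 - s)\<^sup>2 * A + 2 * s * (1 - s) * B + s\<^sup>2 * S"
  shows "A \<le> B"
proof (rule ccontr)
  assume "\<not> A \<le> B"
  then have AB: "A - B > 0" by simp
  define c where "c = \<bar>A - 2 * B + S\<bar> + 1"
  define s where "s = min 1 ((A - B) / c)"
  have c: "c > 0" by (simp add: c_def)
  have s: "0 < s" "s \<le> 1" "s * c \<le> A - B"
    using AB c by (auto simp: s_def min_def field_simps)
  have "0 \<le> (1 - s)\<^sup>2 * A + 2 * s * (1 - s) * B + s\<^sup>2 * S - A"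
    using assms[of s] s by simp
  also have "\<dots> = s * (s * (A - 2 * B + S) - 2 * (A - B))"
    by (simp add: algebra_simps power2_eq_square)
  finally have "2 * (A - B) \<le> s * (A - 2 * B + S)"
    using s by (simp add: zero_le_mult_iff)
  also have "\<dots> \<le> s * c" using s by (intro mult_left_mono) (auto simp: c_def)
  also have "\<dots> \<le> A - B" by (rule s)
  finally show False using AB by simp
qed

text \<open>First variation of the energy at a minimiser: the easy half of Frostman's theorem,
  integrated against \<open>\<sigma>\<close>.\<close>

lemma frostman:
  assumes C: "C \<in> sets borel"
    and \<omega>: "\<omega> \<in> prob_measures_on C" and \<sigma>: "\<sigma> \<in> prob_measures_on C"
    and min: "\<And>\<nu>. \<nu> \<in> prob_measures_on C \<Longrightarrow> mutual_energy D \<omega> \<omega> \<le> mutual_energy D \<nu> \<nu>"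
    and fin: "mutual_energy D \<omega> \<omega> < \<infinity>" "mutual_energy D \<sigma> \<sigma> < \<infinity>"
  shows "mutual_energy D \<omega> \<omega> \<le> mutual_energy D \<omega> \<sigma>"
proof (cases "mutual_energy D \<omega> \<sigma> = \<infinity>")
  case False
  note P = prob_measures_onD[OF \<omega>] prob_measures_onD[OF \<sigma>]
  obtain A where A: "mutual_energy D \<omega> \<omega> = ennreal A" "A \<ge> 0"
    using fin by (cases "mutual_energy D \<omega> \<omega>") auto
  obtain S where S: "mutual_energy D \<sigma> \<sigma> = ennreal S" "S \<ge> 0"
    using fin by (cases "mutual_energy D \<sigma> \<sigma>") auto
  obtain B where B: "mutual_energy D \<omega> \<sigma> = ennreal B" "B \<ge> 0"
    using False by (cases "mutual_energy D \<omega> \<sigma>") auto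
  have B': "mutual_energy D \<sigma> \<omega> = ennreal B"
    using mutual_energy_commute[of \<omega> \<sigma> D] P B by simp
  have meas: "gap_potential D \<nu> \<in> borel_measurable borel" if "\<nu> \<in> prob_measures_on C" for \<nu>
    using prob_measures_onD[OF that]
    by (intro gap_potential_measurable)
       (auto intro!: prob_space.finite_measure finite_measure.axioms prob_space_imp_sigma_finite)
  have "A \<le> (1 - s)\<^sup>2 * A + 2 * s * (1 - s) * B + s\<^sup>2 * S" if s: "0 \<le> s" "s \<le> 1" for s
  proof -
    obtain M where M: "M \<in> prob_measures_on C"
      and int: "\<And>f. f \<in> borel_measurable borel \<Longrightarrow>
        (\<integral>\<^sup>+ z. f z \<partial>M) = ennreal (1 - s) * (\<integral>\<^sup>+ z. f z \<partial>\<omega>) + ennreal s * (\<integral>\<^sup>+ z. f z \<partial>\<sigma>)"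
      by (rule mixture_exists[OF \<omega> \<sigma> s C], rule that)
    have pot: "gap_potential D M z = ennreal (1 - s) * gap_potential D \<omega> z + ennreal s * gap_potential D \<sigma> z" for z
      unfolding gap_potential_def by (rule int) measurable
    have sp: "mutual_energy D N M = ennreal (1 - s) * mutual_energy D N \<omega> + ennreal s * mutual_energy D N \<sigma>"
      if "sets N = sets borel" for N
    proof -
      have [measurable]: "gap_potential D \<omega> \<in> borel_measurable N" "gap_potential D \<sigma> \<in> borel_measurable N"
        using meas[OF \<omega>] meas[OF \<sigma>] that by (simp_all cong: measurable_cong_sets)
      show ?thesis
        unfolding mutual_energy_def pot by (simp add: nn_integral_add nn_integral_cmult)
    qed
    have "mutual_energy D M M = ennreal (1 - s) * mutual_energy D \<omega> M + ennreal s * mutual_energy D \<sigma> M"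
      unfolding mutual_energy_def by (rule int[OF meas[OF M]])
    also have "\<dots> = ennreal ((1 - s) * ((1 - s) * A + s * B) + s * ((1 - s) * B + s * S))"
      unfolding sp[OF P(2)] sp[OF P(6)] A B B' S
      using s A(2) B(2) S(2) by (simp flip: ennreal_mult ennreal_plus)
    also have "\<dots> = ennreal ((1 - s)\<^sup>2 * A + 2 * s * (1 - s) * B + s\<^sup>2 * S)"
      by (rule arg_cong[where f = ennreal]) (simp add: algebra_simps power2_eq_square)
    finally have "ennreal A \<le> ennreal ((1 - s)\<^sup>2 * A + 2 * s * (1 - s) * B + s\<^sup>2 * S)"
      using min[OF M] A by simp
    then show ?thesis
      using s A(2) B(2) S(2) by (subst (asm) ennreal_le_iff) auto
  qed
  then have "A \<le> B" by (rule mutual_energy_scaled_le)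
  then show ?thesis using A B by simp
qed simp

section \<open>Lower semicontinuity of the energy and existence of minimisers\<close>

lemma log_gap_liminf:
  assumes D: "D > 0" and lim: "x \<longlonglongrightarrow> a" "y \<longlonglongrightarrow> b"
  shows "log_gap D a b \<le> liminf (\<lambda>n. log_gap D (x n) (y n))"
proof -
  have d: "(\<lambda>n. cmod (x n - y n)) \<longlonglongrightarrow> cmod (a - b)"
    using lim by (intro tendsto_intros)
  show ?thesis
  proof (cases "a = b")
    case False
    then have "\<forall>\<^sub>F n in sequentially. cmod (x n - y n) > 0"
      by (intro order_tendstoD(1)[OF d]) auto
    then have "\<forall>\<^sub>F n in sequentially. log_gap D (x n) (y n) = ennreal (ln (D / cmod (x n - y n)))"
      by eventually_elim (auto simp: log_gap_def)
    moreover have "(\<lambda>n. ennreal (ln (D / cmod (x n - y n)))) \<longlonglongrightarrow> ennreal (ln (D / cmod (a - b)))"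
      using D False by (intro tendsto_ennrealI tendsto_ln tendsto_divide tendsto_const d) auto
    ultimately have lim': "(\<lambda>n. log_gap D (x n) (y n)) \<longlonglongrightarrow> log_gap D a b"
      using False by (subst tendsto_cong) (auto simp: log_gap_def)
    then show ?thesis using lim_imp_Liminf[OF _ lim'] by simp
  next
    \<comment> \<open>The limit value is infinite here, so the kernel must eventually exceed every
      finite \<open>B\<close>; indices with \<open>x n = y n\<close> do so trivially.\<close>
    case True
    show ?thesis
      unfolding le_Liminf_iff
    proof (intro allI impI)
      fix e assume "e < log_gap D a b"
      then obtain B where B: "e = ennreal B" "B \<ge> 0"
        using True by (cases e) (auto simp: log_gap_def)
      have "\<forall>\<^sub>F n in sequentially. cmod (x n - y n) < D * exp (- (B + 1))"
        using D True by (intro order_tendstoD(2)[OF d]) auto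
      then show "\<forall>\<^sub>F n in sequentially. e < log_gap D (x n) (y n)"
      proof eventually_elim
        case (elim n)
        show ?case
        proof (cases "x n = y n")
          case False
          then have pos: "cmod (x n - y n) > 0" by simp
          have "cmod (x n - y n) * exp (B + 1) < D * exp (- (B + 1)) * exp (B + 1)"
            using elim by (rule mult_strict_right_mono) simp
          also have "\<dots> = D" by (simp only: mult.assoc mult_exp_exp) simp
          finally have "exp (B + 1) < D / cmod (x n - y n)"
            using pos by (simp add: pos_less_divide_eq mult.commute)
          then have "ln (exp (B + 1)) < ln (D / cmod (x n - y n))"
            using D pos by (subst ln_less_cancel_iff) auto
          then have "B + 1 < ln (D / cmod (x n - y n))" by simp
          then show ?thesis using False B by (simp add: log_gap_def ennreal_lessI)
        qed (simp add: log_gap_def B)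
      qed
    qed
  qed
qed

lemma mutual_energy_distr:
  assumes \<Omega>: "prob_space \<Omega>" and X [measurable]: "X \<in> borel_measurable \<Omega>"
  shows "mutual_energy D (distr \<Omega> borel X) (distr \<Omega> borel X) = (\<integral>\<^sup>+ a. \<integral>\<^sup>+ b. log_gap D (X a) (X b) \<partial>\<Omega> \<partial>\<Omega>)"
proof -
  interpret prob_space \<Omega> by fact
  have pot: "gap_potential D (distr \<Omega> borel X) = (\<lambda>z. \<integral>\<^sup>+ b. log_gap D z (X b) \<partial>\<Omega>)"
    unfolding gap_potential_def by (rule ext) (subst nn_integral_distr, auto)
  show ?thesis
    unfolding mutual_energy_def pot by (subst nn_integral_distr) measurable
qed

text \<open>Fatou's lemma for the inner and then for the outer integral, once all energies are
  written over the common space \<Omega>. This is the reason for taking weak limits in coupled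
  form.\<close>

lemma mutual_energy_liminf:
  assumes \<Omega>: "prob_space \<Omega>" and X [measurable]: "\<And>n. X n \<in> borel_measurable \<Omega>" "Y \<in> borel_measurable \<Omega>"
    and lim: "\<And>\<omega>. \<omega> \<in> space \<Omega> \<Longrightarrow> (\<lambda>n. X n \<omega>) \<longlonglongrightarrow> Y \<omega>" and D: "D > 0"
  shows "mutual_energy D (distr \<Omega> borel Y) (distr \<Omega> borel Y)
    \<le> liminf (\<lambda>n. mutual_energy D (distr \<Omega> borel (X n)) (distr \<Omega> borel (X n)))"
proof -
  interpret prob_space \<Omega> by fact
  have "(\<integral>\<^sup>+ a. \<integral>\<^sup>+ b. log_gap D (Y a) (Y b) \<partial>\<Omega> \<partial>\<Omega>)
      \<le> (\<integral>\<^sup>+ a. \<integral>\<^sup>+ b. liminf (\<lambda>n. log_gap D (X n a) (X n b)) \<partial>\<Omega> \<partial>\<Omega>)"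
    by (intro nn_integral_mono log_gap_liminf D lim)
  also have "\<dots> \<le> (\<integral>\<^sup>+ a. liminf (\<lambda>n. \<integral>\<^sup>+ b. log_gap D (X n a) (X n b) \<partial>\<Omega>) \<partial>\<Omega>)"
    by (intro nn_integral_mono nn_integral_liminf) measurable
  also have "\<dots> \<le> liminf (\<lambda>n. \<integral>\<^sup>+ a. \<integral>\<^sup>+ b. log_gap D (X n a) (X n b) \<partial>\<Omega> \<partial>\<Omega>)"
    by (intro nn_integral_liminf) measurable
  finally show ?thesis using \<Omega> X by (simp add: mutual_energy_distr)
qed

lemma distr_limit_closed:
  assumes \<Omega>: "prob_space \<Omega>" and X [measurable]: "\<And>n. X n \<in> borel_measurable \<Omega>" "Y \<in> borel_measurable \<Omega>"
    and lim: "\<And>\<omega>. \<omega> \<in> space \<Omega> \<Longrightarrow> (\<lambda>n. X n \<omega>) \<longlonglongrightarrow> Y \<omega>"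
    and C: "closed C" and law: "\<And>n. distr \<Omega> borel (X n) \<in> prob_measures_on C"
  shows "distr \<Omega> borel Y \<in> prob_measures_on C"
proof (rule prob_measures_onI)
  interpret prob_space \<Omega> by fact
  show "prob_space (distr \<Omega> borel Y)" by (rule prob_space_distr) measurable
  show C': "C \<in> sets borel" using C by simp
  have "AE \<omega> in \<Omega>. X n \<omega> \<in> C" for n
    using prob_measures_on_AE[OF law[of n] C'] C' by (subst (asm) AE_distr_iff) auto
  then have "AE \<omega> in \<Omega>. \<forall>n. X n \<omega> \<in> C" by (simp add: AE_all_countable)
  then have "AE \<omega> in \<Omega>. Y \<omega> \<in> C"
  proof (rule AE_mp, intro AE_I2 impI)
    fix \<omega> assume "\<omega> \<in> space \<Omega>" "\<forall>n. X n \<omega> \<in> C"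
    then show "Y \<omega> \<in> C" using closed_sequentially[OF C _ lim] by blast
  qed
  then show "AE z in distr \<Omega> borel Y. z \<in> C" using C' by (subst AE_distr_iff) auto
qed simp

text \<open>Direct method: a minimising sequence has a coupled convergent subsequence, its limit
  stays on the closed set, and lower semicontinuity makes the limit minimal. The infimum may be
  infinite.\<close>

lemma energy_minimizer_exists:
  assumes C: "closed C" "C \<subseteq> cball 0 \<rho>" and \<rho>: "\<rho> > 0" and D: "D > 0"
    and ne: "prob_measures_on C \<noteq> {}"
  obtains \<omega> where "\<omega> \<in> prob_measures_on C"
    "\<And>\<nu>. \<nu> \<in> prob_measures_on C \<Longrightarrow> mutual_energy D \<omega> \<omega> \<le> mutual_energy D \<nu> \<nu>"
proof -
  define E where "E = (\<lambda>\<nu>. mutual_energy D \<nu> \<nu>) ` prob_measures_on C"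
  have "E \<noteq> {}" using ne by (auto simp: E_def)
  then obtain u where u: "\<And>n :: nat. u n \<in> E" "u \<longlonglongrightarrow> Inf E"
    using Inf_as_limit[of E] by blast
  have "\<forall>n. \<exists>\<nu>. \<nu> \<in> prob_measures_on C \<and> mutual_energy D \<nu> \<nu> = u n"
  proof
    fix n
    show "\<exists>\<nu>. \<nu> \<in> prob_measures_on C \<and> mutual_energy D \<nu> \<nu> = u n"
      using u(1)[of n] unfolding E_def by (elim imageE) auto
  qed
  then obtain \<mu> where \<mu>: "\<And>n. \<mu> n \<in> prob_measures_on C" "\<And>n. mutual_energy D (\<mu> n) (\<mu> n) = u n" by metis
  have C': "C \<in> sets borel" using C by simp
  have \<mu>': "\<mu> n \<in> prob_measures_on (cball 0 \<rho>)" for n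
    by (rule prob_measures_on_mono[OF \<mu>(1) C(2) _ C']) simp
  obtain r \<Omega> X Y where r: "strict_mono (r :: nat \<Rightarrow> nat)" and \<Omega>: "prob_space (\<Omega> :: real measure)"
    and X: "\<And>n. X n \<in> borel_measurable \<Omega>" "Y \<in> borel_measurable \<Omega>"
    and law: "\<And>n. distr \<Omega> borel (X n) = \<mu> (r n)"
    and lim: "\<And>\<omega>. \<omega> \<in> space \<Omega> \<Longrightarrow> (\<lambda>n. X n \<omega>) \<longlonglongrightarrow> Y \<omega>"
    by (rule skorohod_subsequence[where \<mu> = \<mu>, OF \<mu>' \<rho>]) (rule that)
  define \<omega> where "\<omega> = distr \<Omega> borel Y"
  have "\<omega> \<in> prob_measures_on C"
    unfolding \<omega>_def by (rule distr_limit_closed[OF \<Omega> X lim C(1)]) (simp_all add: law \<mu>)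
  moreover have "mutual_energy D \<omega> \<omega> \<le> mutual_energy D \<nu> \<nu>" if "\<nu> \<in> prob_measures_on C" for \<nu>
  proof -
    have "mutual_energy D \<omega> \<omega> \<le> liminf (\<lambda>n. u (r n))"
      using mutual_energy_liminf[OF \<Omega> X lim D] by (simp add: \<omega>_def law \<mu>)
    also have "\<dots> = Inf E"
      using LIMSEQ_subseq_LIMSEQ[OF u(2) r] by (intro lim_imp_Liminf) (auto simp: o_def)
    also have "\<dots> \<le> mutual_energy D \<nu> \<nu>" using that by (intro Inf_lower) (auto simp: E_def)
    finally show ?thesis .
  qed
  ultimately show thesis using that by blast
qed

text \<open>The two inequalities force the energies of \<omega> and \<mu> to add up to at most twice
  their mutual energy, the case of equality in positive definiteness. Used twice: for uniqueness of
  the equilibrium measure, and to identify weak limits, which are not known in advance to live on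
  the carrier of \<omega>.\<close>

lemma energy_minimizer_eqI:
  assumes \<omega>: "\<omega> \<in> prob_measures_on (cball 0 \<rho>)" and \<mu>: "\<mu> \<in> prob_measures_on (cball 0 \<rho>)"
    and D: "D > 0" "D \<ge> 2 * \<rho>" and fin: "mutual_energy D \<omega> \<omega> < \<infinity>"
    and le: "mutual_energy D \<omega> \<omega> \<le> mutual_energy D \<omega> \<mu>" "mutual_energy D \<mu> \<mu> \<le> mutual_energy D \<omega> \<omega>"
  shows "\<mu> = \<omega>"
proof -
  have "mutual_energy D \<omega> \<omega> + mutual_energy D \<mu> \<mu> \<le> mutual_energy D \<omega> \<mu> + mutual_energy D \<omega> \<mu>"
    using le by (intro add_mono order_trans[OF le(2,1)])
  then have "\<omega> = \<mu>"
    using fin le(2) by (intro mutual_energy_definite[OF \<omega> \<mu> D]) (auto simp: mult_2 intro: order_le_less_trans)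
  then show ?thesis ..
qed

text \<open>Justifies the definite description: the competitor \<nu> makes the minimum finite, and
  Frostman's inequality against any second maximiser yields uniqueness. The scale \<open>D\<close>
  is free within its bounds because the order of energies does not depend on it.\<close>

lemma equilibrium_measure:
  assumes C: "closed C" "C \<subseteq> cball 0 \<rho>" and \<rho>: "\<rho> > 0" and D: "D \<ge> 1" "D \<ge> 2 * \<rho>"
    and \<nu>: "\<nu> \<in> prob_measures_on C" "mutual_energy D \<nu> \<nu> < \<infinity>"
  shows "equilibrium_measure C \<in> prob_measures_on C"
    and "\<sigma> \<in> prob_measures_on C \<Longrightarrow>
      mutual_energy D (equilibrium_measure C) (equilibrium_measure C) \<le> mutual_energy D \<sigma> \<sigma>"
proof -
  have D0: "D > 0" using D by simp
  have C': "C \<in> sets borel" using C by simp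
  have ball: "\<mu> \<in> prob_measures_on (cball 0 \<rho>)" if "\<mu> \<in> prob_measures_on C" for \<mu>
    by (rule prob_measures_on_mono[OF that C(2) _ C']) simp
  obtain \<omega> where \<omega>: "\<omega> \<in> prob_measures_on C"
    and min: "\<And>\<nu>. \<nu> \<in> prob_measures_on C \<Longrightarrow> mutual_energy D \<omega> \<omega> \<le> mutual_energy D \<nu> \<nu>"
    using \<nu>(1) by (blast intro: energy_minimizer_exists[OF C \<rho> D0])
  have fin: "mutual_energy D \<omega> \<omega> < \<infinity>" using min[OF \<nu>(1)] \<nu>(2) by (rule order_le_less_trans)
  have energy_iff: "log_energy \<nu> \<le> log_energy \<mu> \<longleftrightarrow> mutual_energy D \<mu> \<mu> \<le> mutual_energy D \<nu> \<nu>"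
    if "\<mu> \<in> prob_measures_on C" "\<nu> \<in> prob_measures_on C" for \<mu> \<nu>
    unfolding log_energy_gap[OF ball[OF that(1)] D] log_energy_gap[OF ball[OF that(2)] D]
    by (cases "mutual_energy D \<mu> \<mu>"; cases "mutual_energy D \<nu> \<nu>") (auto simp: ennreal.rep_eq top_unique)
  have "equilibrium_measure C = \<omega>"
    unfolding equilibrium_measure_def
  proof (rule the_equality)
    show "\<omega> \<in> prob_measures_on C \<and> (\<forall>\<nu>\<in>prob_measures_on C. log_energy \<nu> \<le> log_energy \<omega>)"
      using \<omega> min energy_iff by blast
  next
    fix \<mu> assume \<mu>: "\<mu> \<in> prob_measures_on C \<and> (\<forall>\<nu>\<in>prob_measures_on C. log_energy \<nu> \<le> log_energy \<mu>)"
    then have "mutual_energy D \<mu> \<mu> \<le> mutual_energy D \<omega> \<omega>" using energy_iff \<omega> by blast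
    moreover from this have "mutual_energy D \<omega> \<omega> \<le> mutual_energy D \<omega> \<mu>"
      using \<mu> fin by (intro frostman[OF C' \<omega> _ min]) (auto intro: order_le_less_trans)
    ultimately show "\<mu> = \<omega>"
      using \<mu> \<omega> fin D0 D by (intro energy_minimizer_eqI[of \<omega> \<rho> \<mu> D] ball) auto
  qed
  then show "equilibrium_measure C \<in> prob_measures_on C"
    "\<sigma> \<in> prob_measures_on C \<Longrightarrow>
      mutual_energy D (equilibrium_measure C) (equilibrium_measure C) \<le> mutual_energy D \<sigma> \<sigma>"
    using \<omega> min by auto
qed

section \<open>Pull-back under a polynomial\<close>

text \<open>Roots with multiplicity, in an unspecified order. A single entry need not depend
  continuously on the coefficients; continuity and measurability are claimed only for symmetric sums
  over the list.\<close>

definition poly_root :: "complex poly \<Rightarrow> nat \<Rightarrow> complex" where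
  "poly_root p = (SOME r. smult (lead_coeff p) (\<Prod>i<degree p. [:- r i, 1:]) = p)"

definition root_measure :: "complex poly \<Rightarrow> complex measure" where
  "root_measure p = distr (uniform_count_measure {..<degree p}) borel (poly_root p)"

lemma poly_root_decompose: "smult (lead_coeff p) (\<Prod>i<degree p. [:- poly_root p i, 1:]) = p"
proof -
  obtain r where "smult (lead_coeff p) (\<Prod>i<degree p. [:- r i, 1:]) = p"
    by (rule complex_poly_decompose')
  then show ?thesis
    unfolding poly_root_def by (rule someI[where P = "\<lambda>r. smult (lead_coeff p) (\<Prod>i<degree p. [:- r i, 1:]) = p"])
qed

lemma poly_by_roots: "poly p z = lead_coeff p * (\<Prod>i<degree p. z - poly_root p i)"
proof -
  have "poly p z = poly (smult (lead_coeff p) (\<Prod>i<degree p. [:- poly_root p i, 1:])) z"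
    by (simp only: poly_root_decompose)
  then show ?thesis by (simp add: poly_prod)
qed

lemma poly_poly_root: "i < degree p \<Longrightarrow> poly p (poly_root p i) = 0"
  by (subst poly_by_roots) auto

lemma proots_linear_prod:
  fixes r :: "nat \<Rightarrow> complex"
  shows "proots (\<Prod>i<n. [:- r i, 1:]) = image_mset r (mset_set {..<n})"
proof -
  have "proots (\<Prod>i<n. [:- r i, 1:]) = (\<Sum>i<n. {#r i#})"
    by (subst proots_prod) auto
  then show ?thesis by (simp add: sum_unfold_sum_mset)
qed

lemma proots_eq_image:
  assumes "degree p > 0"
  shows "proots p = image_mset (poly_root p) (mset_set {..<degree p})"
proof -
  have "lead_coeff p \<noteq> 0" using assms by auto
  then have "proots p = proots (\<Prod>i<degree p. [:- poly_root p i, 1:])"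
    using proots_smult[of "lead_coeff p"] poly_root_decompose[of p] by metis
  then show ?thesis by (simp add: proots_linear_prod)
qed

text \<open>Every factorisation into linear factors lists the same multiset \<open>proots p\<close>,
  so symmetric sums do not see the arbitrary choice made in \<open>poly_root\<close>.\<close>

lemma sum_roots_eqI:
  fixes f :: "complex \<Rightarrow> real"
  assumes "degree p > 0" "p = smult c (\<Prod>i<degree p. [:- r i, 1:])"
  shows "(\<Sum>i<degree p. f (poly_root p i)) = (\<Sum>i<degree p. f (r i))"
proof -
  define n where "n = degree p"
  have "c \<noteq> 0" using assms by auto
  then have "image_mset (poly_root p) (mset_set {..<n}) = image_mset r (mset_set {..<n})"
    using proots_eq_image[OF assms(1)] assms(2) proots_smult[of c] proots_linear_prod[of r n]
    unfolding n_def by metis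
  then have "image_mset f (image_mset (poly_root p) (mset_set {..<n}))
      = image_mset f (image_mset r (mset_set {..<n}))" by simp
  then show ?thesis
    by (simp add: sum_unfold_sum_mset n_def image_mset.compositionality o_def)
qed

lemma
  assumes "degree p > 0"
  shows prob_space_root_measure: "prob_space (root_measure p)"
    and nn_integral_root_measure:
      "g \<in> borel_measurable borel \<Longrightarrow>
        (\<integral>\<^sup>+ z. g z \<partial>root_measure p) = ennreal (1 / degree p) * (\<Sum>i<degree p. g (poly_root p i))"
    and measure_root_measure:
      "A \<in> sets borel \<Longrightarrow> measure (root_measure p) A = (\<Sum>i<degree p. indicator A (poly_root p i)) / degree p"
    and integral_root_measure: "f \<in> borel_measurable borel \<Longrightarrow>
        (LINT z|root_measure p. f z :: real) = (\<Sum>i<degree p. f (poly_root p i)) / degree p"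
proof -
  interpret U: prob_space "uniform_count_measure {..<degree p}"
    using assms by (intro prob_space_uniform_count_measure) auto
  have [measurable]: "poly_root p \<in> measurable (uniform_count_measure {..<degree p}) borel"
    by simp
  show ps: "prob_space (root_measure p)"
    unfolding root_measure_def by (rule U.prob_space_distr) measurable
  interpret R: prob_space "root_measure p" by (rule ps)
  show "(\<integral>\<^sup>+ z. g z \<partial>root_measure p) = ennreal (1 / degree p) * (\<Sum>i<degree p. g (poly_root p i))"
    if [measurable]: "g \<in> borel_measurable borel" for g
    unfolding root_measure_def
    by (subst nn_integral_distr, measurable)
       (simp add: uniform_count_measure_def nn_integral_point_measure_finite sum_distrib_left mult.commute)
  show int: "(LINT z|root_measure p. f z :: real) = (\<Sum>i<degree p. f (poly_root p i)) / degree p"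
    if [measurable]: "f \<in> borel_measurable borel" for f :: "complex \<Rightarrow> real"
    unfolding root_measure_def
    by (subst integral_distr, measurable) (simp add: integral_uniform_count_measure)
  show "measure (root_measure p) A = (\<Sum>i<degree p. indicator A (poly_root p i)) / degree p"
    if "A \<in> sets borel" for A
    using int[of "indicator A"] that by (simp add: root_measure_def)
qed

lemma sets_root_measure [simp, measurable_cong]: "sets (root_measure p) = sets borel"
  by (simp add: root_measure_def)

lemma root_measure_prob_measures_on:
  assumes "degree p > 0" "poly p -` {0} \<subseteq> C" "C \<in> sets borel"
  shows "root_measure p \<in> prob_measures_on C"
proof -
  have "(\<Sum>i<degree p. indicator C (poly_root p i)) = (\<Sum>i<degree p. 1 :: real)"
    using assms(2) poly_poly_root[of _ p] by (intro sum.cong) (auto simp: indicator_def)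
  then have "measure (root_measure p) C = 1"
    using assms by (simp add: measure_root_measure)
  then show ?thesis
    using prob_space_root_measure[OF assms(1)]
    by (simp add: prob_measures_on_def finite_measure.emeasure_eq_measure prob_space.finite_measure)
qed

lemma measure_root_measure_proots:
  assumes "degree p > 0" "A \<in> sets borel"
  shows "measure (root_measure p) A = size {#z \<in># proots p. z \<in> A#} / degree p"
proof -
  have "size {#z \<in># proots p. z \<in> A#} = card {i \<in> {..<degree p}. poly_root p i \<in> A}"
    using assms by (simp add: proots_eq_image filter_mset_image_mset)
  also have "real \<dots> = (\<Sum>i<degree p. indicator A (poly_root p i))"
    by (simp add: indicator_def of_bool_def sum.If_cases Int_def conj_commute)
  finally show ?thesis using assms by (simp add: measure_root_measure)
qed

section \<open>Continuity and measurability of the fibres of a polynomial\<close>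

lemma bounded_tuple_subsequence:
  fixes x :: "nat \<Rightarrow> nat \<Rightarrow> complex"
  assumes "\<And>j i. i < n \<Longrightarrow> cmod (x j i) \<le> B"
  shows "\<exists>s l. strict_mono (s :: nat \<Rightarrow> nat) \<and> (\<forall>i<n. (\<lambda>j. x (s j) i) \<longlonglongrightarrow> l i)"
  using assms
proof (induction n)
  case 0
  show ?case by (auto intro: strict_mono_id)
next
  case (Suc n)
  then obtain s l where s: "strict_mono (s :: nat \<Rightarrow> nat)" "\<forall>i<n. (\<lambda>j. x (s j) i) \<longlonglongrightarrow> l i"
    by (metis less_SucI)
  have "bounded (range (\<lambda>j. x (s j) n))"
    unfolding bounded_iff using Suc.prems by blast
  then obtain c t where t: "strict_mono (t :: nat \<Rightarrow> nat)" "(\<lambda>j. x (s (t j)) n) \<longlonglongrightarrow> c"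
    using bounded_imp_convergent_subsequence[of "\<lambda>j. x (s j) n"] by (auto simp: o_def)
  have "(\<lambda>j. x (s (t j)) i) \<longlonglongrightarrow> (l(n := c)) i" if "i < Suc n" for i
    using that t LIMSEQ_subseq_LIMSEQ[OF _ t(1), of "\<lambda>j. x (s j) i" "l i"] s(2)
    by (cases "i = n") (auto simp: o_def)
  moreover have "strict_mono (s \<circ> t)" using s(1) t(1) by (rule strict_mono_o)
  ultimately show ?case by (intro exI[of _ "s \<circ> t"] exI[of _ "l(n := c)"]) (auto simp: o_def)
qed

lemma degree_diff_const:
  fixes q :: "complex poly"
  assumes "degree q > 0"
  shows "degree (q - [:w:]) = degree q" "lead_coeff (q - [:w:]) = lead_coeff q"
proof -
  have "degree (q + [:- w:]) = degree q"
    using assms by (intro degree_add_eq_left) simp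
  moreover have "q + [:- w:] = q - [:w:]" by simp
  ultimately show d: "degree (q - [:w:]) = degree q" by (simp only:)
  show "lead_coeff (q - [:w:]) = lead_coeff q"
    unfolding d using assms by (cases "degree q") (auto simp: coeff_pCons)
qed

lemma poly_sublevel_bounded:
  fixes q :: "complex poly"
  assumes "degree q > 0"
  obtains B where "\<And>z. cmod (poly q z) \<le> s \<Longrightarrow> cmod z \<le> B"
proof -
  have "\<forall>\<^sub>F z in at_infinity. s + 1 \<le> cmod (poly q z)"
    using filterlim_poly_at_infinity[of q] assms
    unfolding filterlim_at_infinity_conv_norm_at_top filterlim_at_top by blast
  then obtain b where b: "\<And>z. b \<le> cmod z \<Longrightarrow> s + 1 \<le> cmod (poly q z)"
    unfolding eventually_at_infinity by blast
  show thesis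
  proof (rule that[of b])
    fix z assume "cmod (poly q z) \<le> s"
    then show "cmod z \<le> b" using b[of z] by linarith
  qed
qed

lemma LIMSEQ_subsubseqI:
  fixes X :: "nat \<Rightarrow> 'a :: metric_space"
  assumes "\<And>s. strict_mono s \<Longrightarrow> \<exists>t. strict_mono (t :: nat \<Rightarrow> nat) \<and> (\<lambda>j. X (s (t j))) \<longlonglongrightarrow> L"
  shows "X \<longlonglongrightarrow> L"
proof (rule ccontr)
  assume "\<not> X \<longlonglongrightarrow> L"
  then obtain e where e: "e > 0" "\<And>N. \<exists>n\<ge>N. e \<le> dist (X n) L"
    unfolding lim_sequentially by (meson not_le)
  have "infinite {n. e \<le> dist (X n) L}"
    unfolding infinite_nat_iff_unbounded_le using e(2) by blast
  then obtain s :: "nat \<Rightarrow> nat" where s: "strict_mono s" "\<And>n. e \<le> dist (X (s n)) L"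
    using infinite_enumerate by (metis mem_Collect_eq)
  then obtain t :: "nat \<Rightarrow> nat" where t: "(\<lambda>j. X (s (t j))) \<longlonglongrightarrow> L"
    using assms by blast
  then have "\<forall>\<^sub>F j in sequentially. dist (X (s (t j))) L < e"
    using e(1) by (rule tendstoD)
  then show False using s(2) by (auto simp: not_less[symmetric])
qed

text \<open>Any limit of a sequence of root tuples is again a root tuple.\<close>

lemma sum_roots_continuous:
  fixes q :: "complex poly" and f :: "complex \<Rightarrow> real"
  assumes q: "degree q > 0" and f: "continuous_on UNIV f"
  shows "continuous_on UNIV (\<lambda>w. \<Sum>i<degree q. f (poly_root (q - [:w:]) i))"
proof -
  define n where "n = degree q"
  define a where "a = lead_coeff q"
  have a: "a \<noteq> 0" using q by (auto simp: a_def)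
  define F where "F w = (\<Sum>i<n. f (poly_root (q - [:w:]) i))" for w
  have "F \<midarrow>w\<rightarrow> F w" for w
    unfolding tendsto_at_iff_sequentially o_def
  proof (intro allI impI)
    fix v :: "nat \<Rightarrow> complex" assume v: "\<forall>j. v j \<in> UNIV - {w}" "v \<longlonglongrightarrow> w"
    show "(\<lambda>j. F (v j)) \<longlonglongrightarrow> F w"
    \<comment> \<open>The root lists themselves need not converge, their order being arbitrary.
      Along a further subsequence they do, and the limit list gives a factorisation of
      \<open>q - [:w:]\<close>, so the sum has the right limit.\<close>
    proof (rule LIMSEQ_subsubseqI)
      fix s :: "nat \<Rightarrow> nat" assume s: "strict_mono s"
      have vs: "(\<lambda>j. v (s j)) \<longlonglongrightarrow> w"
        using LIMSEQ_subseq_LIMSEQ[OF v(2) s] by (simp add: o_def)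
      then obtain S where S: "\<And>j. cmod (v (s j)) \<le> S"
        by (metis convergent_imp_Bseq convergentI BseqE)
      obtain B where B: "\<And>z. cmod (poly q z) \<le> S \<Longrightarrow> cmod z \<le> B"
        using poly_sublevel_bounded[OF q] by blast
      have root: "poly q (poly_root (q - [:w:]) i) = w" if "i < n" for w i
        using poly_poly_root[of i "q - [:w:]"] that degree_diff_const[OF q] by (simp add: n_def)
      have "cmod (poly_root (q - [:v (s j):]) i) \<le> B" if "i < n" for i j
        using root[OF that] S by (intro B) simp
      from bounded_tuple_subsequence[of n "\<lambda>j i. poly_root (q - [:v (s j):]) i", OF this]
      obtain t l where t: "strict_mono (t :: nat \<Rightarrow> nat)"
        and l: "\<And>i. i < n \<Longrightarrow> (\<lambda>j. poly_root (q - [:v (s (t j)):]) i) \<longlonglongrightarrow> l i" by blast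
      have vst: "(\<lambda>j. v (s (t j))) \<longlonglongrightarrow> w"
        using LIMSEQ_subseq_LIMSEQ[OF vs t] by (simp add: o_def)
      have fact: "q - [:w:] = smult a (\<Prod>i<n. [:- l i, 1:])"
      proof (rule poly_eq_poly_eq_iff[THEN iffD1], rule ext)
        fix z
        have "(\<lambda>j. a * (\<Prod>i<n. z - poly_root (q - [:v (s (t j)):]) i)) \<longlonglongrightarrow> a * (\<Prod>i<n. z - l i)"
          by (intro tendsto_mult tendsto_prod tendsto_const tendsto_diff l) auto
        moreover have "a * (\<Prod>i<n. z - poly_root (q - [:v (s (t j)):]) i) = poly q z - v (s (t j))" for j
          using poly_by_roots[of "q - [:v (s (t j)):]" z] degree_diff_const[OF q] by (simp add: n_def a_def)
        moreover have "(\<lambda>j. poly q z - v (s (t j))) \<longlonglongrightarrow> poly q z - w"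
          by (intro tendsto_diff tendsto_const vst)
        ultimately have "a * (\<Prod>i<n. z - l i) = poly q z - w"
          using LIMSEQ_unique by fastforce
        then show "poly (q - [:w:]) z = poly (smult a (\<Prod>i<n. [:- l i, 1:])) z"
          by (simp add: poly_prod)
      qed
      have dq: "degree (q - [:w:]) = n" unfolding n_def by (rule degree_diff_const[OF q])
      have "(\<Sum>i<degree (q - [:w:]). f (poly_root (q - [:w:]) i)) = (\<Sum>i<degree (q - [:w:]). f (l i))"
      proof (rule sum_roots_eqI[where c = a])
        show "0 < degree (q - [:w:])" using q by (simp only: dq n_def)
        show "q - [:w:] = smult a (\<Prod>i<degree (q - [:w:]). [:- l i, 1:])" unfolding dq by (rule fact)
      qed
      then have "F w = (\<Sum>i<n. f (l i))" unfolding F_def dq .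
      moreover have "(\<lambda>j. F (v (s (t j)))) \<longlonglongrightarrow> (\<Sum>i<n. f (l i))"
        unfolding F_def
        using f l by (intro tendsto_sum continuous_on_tendsto_compose[OF f]) auto
      ultimately show "\<exists>t. strict_mono t \<and> (\<lambda>j. F (v (s (t j)))) \<longlonglongrightarrow> F w"
        using t by auto
    qed
  qed
  then show ?thesis
    unfolding F_def[symmetric] n_def[symmetric] by (simp add: continuous_on_def)
qed

text \<open>The mass of a closed set is a pointwise limit of root sums of continuous functions, and
  these sums are continuous in \<open>w\<close>. Closed sets are stable under intersection and
  generate the Borel sets.\<close>

lemma root_measure_kernel:
  fixes q :: "complex poly"
  assumes q: "degree q > 0"
  shows "(\<lambda>w. root_measure (q - [:w:])) \<in> measurable borel (subprob_algebra borel)"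
proof (rule measurable_subprob_algebra_generated[where \<Omega> = UNIV and G = "Collect closed"])
  have d: "degree (q - [:w:]) = degree q" for w by (rule degree_diff_const[OF q])
  have ps: "prob_space (root_measure (q - [:w:]))" for w
    using q d by (intro prob_space_root_measure) simp
  show "sets borel = sigma_sets UNIV (Collect closed :: complex set set)" by (simp add: borel_eq_closed)
  show "Int_stable (Collect closed :: complex set set)" by (auto simp: Int_stable_def)
  show "subprob_space (root_measure (q - [:w:]))" for w
    by (rule prob_space_imp_subprob_space[OF ps])
  show "(\<lambda>w. emeasure (root_measure (q - [:w:])) UNIV) \<in> borel_measurable borel"
    using prob_space.emeasure_space_1[OF ps] by (simp add: root_measure_def)
  show "(\<lambda>w. emeasure (root_measure (q - [:w:])) A) \<in> borel_measurable borel"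
    if "A \<in> Collect closed" for A :: "complex set"
  proof -
    from that have A: "closed A" by simp
    obtain f :: "nat \<Rightarrow> complex \<Rightarrow> real" where cont: "\<And>n. continuous_on UNIV (f n)"
      and lim: "\<And>x. (\<lambda>n. f n x) \<longlonglongrightarrow> indicator A x"
      using closed_indicator_limit[OF A] by metis
    have "(\<lambda>w. (\<Sum>i<degree q. indicator A (poly_root (q - [:w:]) i)) / degree q) \<in> borel_measurable borel"
    proof (rule borel_measurable_LIMSEQ_real)
      show "(\<lambda>n. (\<Sum>i<degree q. f n (poly_root (q - [:w:]) i)) / degree q)
          \<longlonglongrightarrow> (\<Sum>i<degree q. indicator A (poly_root (q - [:w:]) i)) / degree q" for w
        using q by (intro tendsto_divide tendsto_sum lim tendsto_const) auto
      show "(\<lambda>w. (\<Sum>i<degree q. f n (poly_root (q - [:w:]) i)) / degree q) \<in> borel_measurable borel" for n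
        by (intro borel_measurable_divide borel_measurable_continuous_onI sum_roots_continuous q cont) simp
    qed
    moreover have "emeasure (root_measure (q - [:w:])) A
        = ennreal ((\<Sum>i<degree q. indicator A (poly_root (q - [:w:]) i)) / degree q)" for w
    proof -
      interpret prob_space "root_measure (q - [:w:])" by (rule ps)
      show ?thesis
        unfolding emeasure_eq_measure using measure_root_measure[of "q - [:w:]" A] q A by (simp only: d) simp
    qed
    ultimately show ?thesis by simp
  qed
qed auto

text \<open>Spread the mass of each point evenly over its fibre. The potential of the fibre of \<open>w\<close> is
  \<open>ln |q z - w| - ln |a|\<close>, so energies are transported exactly.\<close>

lemma pullback_measure:
  fixes q :: "complex poly"
  assumes q: "degree q > 0" and L: "L \<subseteq> cball 0 s" "L \<in> sets borel"
    and E: "poly q -` L \<subseteq> cball 0 \<rho>"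
    and D: "D > 0" "D \<ge> 2 * \<rho>" and D': "D' > 0" "D' \<ge> 2 * s"
    and c: "c = degree q * ln D + ln (cmod (lead_coeff q)) - ln D'" "c \<ge> 0"
    and \<nu>: "\<nu> \<in> prob_measures_on L"
  obtains \<mu> where "\<mu> \<in> prob_measures_on (poly q -` L)"
    "mutual_energy D \<mu> \<mu> = ennreal (1 / degree q) * (ennreal c + mutual_energy D' \<nu> \<nu>)"
proof -
  define n where "n = degree q"
  define a where "a = lead_coeff q"
  have a: "a \<noteq> 0" using q by (auto simp: a_def)
  define r where "r w i = poly_root (q - [:w:]) i" for w i
  define \<mu> where "\<mu> = \<nu> \<bind> (\<lambda>w. root_measure (q - [:w:]))"
  note P = prob_measures_onD[OF \<nu>]
  interpret \<nu>: prob_space \<nu> by (rule P)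
  have [measurable_cong]: "sets \<nu> = sets borel" by (rule P)
  have d: "degree (q - [:w:]) = n" for w unfolding n_def by (rule degree_diff_const[OF q])
  have kernel: "(\<lambda>w. root_measure (q - [:w:])) \<in> measurable \<nu> (subprob_algebra borel)"
    using root_measure_kernel[OF q] P(2) by (simp cong: measurable_cong_sets)
  have root: "poly q (r w i) = w" if "i < n" for w i
    using poly_poly_root[of i "q - [:w:]"] that by (simp add: d r_def)
  have [measurable]: "poly q \<in> borel_measurable borel"
    by (intro borel_measurable_continuous_onI continuous_intros)
  have Eb: "poly q -` L \<in> sets borel"
    using measurable_sets[of "poly q" borel borel L] L(2) by simp
  have int: "(\<integral>\<^sup>+ z. g z \<partial>\<mu>) = (\<integral>\<^sup>+ w. ennreal (1 / n) * (\<Sum>i<n. g (r w i)) \<partial>\<nu>)"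
    if "g \<in> borel_measurable borel" for g
    unfolding \<mu>_def nn_integral_bind[OF that kernel]
  proof (rule nn_integral_cong)
    fix w
    show "(\<integral>\<^sup>+ z. g z \<partial>root_measure (q - [:w:])) = ennreal (1 / n) * (\<Sum>i<n. g (r w i))"
      using nn_integral_root_measure[of "q - [:w:]" g] that q unfolding d r_def n_def by simp
  qed
  have sets: "sets \<mu> = sets borel"
    unfolding \<mu>_def using P by (subst sets_bind[where N = borel]) auto
  have L_AE: "AE w in \<nu>. w \<in> L" by (rule prob_measures_on_AE[OF \<nu> L(2)])
  have avg: "ennreal (1 / n) * (\<Sum>i<n. x) = x" for x :: ennreal
  proof -
    have "ennreal (1 / n) * ennreal n = 1"
      using q by (subst ennreal_mult[symmetric]) (auto simp: n_def)
    then show ?thesis by (simp add: mult.assoc[symmetric] ennreal_of_nat_eq_real_of_nat)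
  qed
  have full: "emeasure \<mu> X = 1" if "X \<in> sets borel" "poly q -` L \<subseteq> X" for X
  proof -
    have "emeasure \<mu> X = (\<integral>\<^sup>+ w. ennreal (1 / n) * (\<Sum>i<n. indicator X (r w i)) \<partial>\<nu>)"
      using int[of "indicator X"] that sets by simp
    also have "\<dots> = (\<integral>\<^sup>+ w. 1 \<partial>\<nu>)"
    proof (rule nn_integral_cong_AE)
      show "AE w in \<nu>. ennreal (1 / n) * (\<Sum>i<n. indicator X (r w i)) = 1"
        using L_AE
      proof eventually_elim
        case (elim w)
        then have "(\<Sum>i<n. indicator X (r w i)) = (\<Sum>i<n. 1 :: ennreal)"
          using that root by (intro sum.cong) (auto simp: indicator_def)
        then show ?case by (simp only: avg)
      qed
    qed
    finally show ?thesis by (simp add: \<nu>.emeasure_space_1)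
  qed
  have "prob_space \<mu>"
    using full[of UNIV] sets_eq_imp_space_eq[OF sets] by (auto intro!: prob_spaceI)
  then have \<mu>: "\<mu> \<in> prob_measures_on (poly q -` L)"
    using full[OF Eb] sets by (simp add: prob_measures_on_def)
  \<comment> \<open>The product over the fibre is \<open>(poly q z - w) / a\<close>. Its logarithm
    turns \<open>n\<close> kernels at scale \<open>D\<close> into one kernel at scale
    \<open>D'\<close>, and \<open>c\<close> collects the constants; \<open>c \<ge> 0\<close> lets
    the sum be split in \<open>ennreal\<close>.\<close>
  have fibre: "(\<Sum>i<n. log_gap D z (r w i)) = ennreal c + log_gap D' (poly q z) w"
    if z: "poly q z \<in> L" and w: "w \<in> L" for z w
  proof -
    have fac: "poly q z - w = a * (\<Prod>i<n. z - r w i)"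
      using poly_by_roots[of "q - [:w:]" z] d[of w] degree_diff_const(2)[OF q, of w] by (simp add: r_def a_def)
    show ?thesis
    proof (cases "poly q z = w")
      case True
      then obtain i where "i < n" "r w i = z" using fac a by auto
      then have "\<infinity> \<le> (\<Sum>i<n. log_gap D z (r w i))"
        using member_le_sum[of i "{..<n}" "\<lambda>i. log_gap D z (r w i)"] by (simp add: log_gap_def)
      then have "(\<Sum>i<n. log_gap D z (r w i)) = \<infinity>" by (simp add: top_unique)
      then show ?thesis using True by (simp add: log_gap_def)
    next
      case False
      then have ne: "z \<noteq> r w i" if "i < n" for i using root[OF that, of w] by auto
      have le: "cmod (z - r w i) \<le> D" if "i < n" for i
      proof -
        have "z \<in> cball 0 \<rho>" "r w i \<in> cball 0 \<rho>" using E z w root[OF that, of w] by auto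
        then show ?thesis using norm_triangle_ineq4[of z "r w i"] D by simp
      qed
      have le': "cmod (poly q z - w) \<le> D'"
      proof -
        have "poly q z \<in> cball 0 s" "w \<in> cball 0 s" using L z w by auto
        then show ?thesis using norm_triangle_ineq4[of "poly q z" w] D' by simp
      qed
      have "(\<Sum>i<n. log_gap D z (r w i)) = (\<Sum>i<n. ennreal (ln (D / cmod (z - r w i))))"
        using ne by (intro sum.cong) (auto simp: log_gap_def)
      also have "\<dots> = ennreal (\<Sum>i<n. ln (D / cmod (z - r w i)))"
        using ne le by (intro sum_ennreal) auto
      also have "(\<Sum>i<n. ln (D / cmod (z - r w i))) = n * ln D - ln (\<Prod>i<n. cmod (z - r w i))"
        using ne D by (subst ln_prod) (auto simp: ln_div sum_subtractf)
      also have "(\<Prod>i<n. cmod (z - r w i)) = cmod (poly q z - w) / cmod a"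
        using fac a by (simp add: norm_mult prod_norm)
      also have "n * ln D - ln (cmod (poly q z - w) / cmod a) = c + ln (D' / cmod (poly q z - w))"
        using a False D' by (simp add: ln_div c n_def a_def)
      also have "ennreal \<dots> = ennreal c + ennreal (ln (D' / cmod (poly q z - w)))"
        using False c le' D' by (intro ennreal_plus) auto
      finally show ?thesis using False by (simp add: log_gap_def)
    qed
  qed
  have pot: "gap_potential D \<mu> z = ennreal (1 / n) * (ennreal c + gap_potential D' \<nu> (poly q z))"
    if z: "poly q z \<in> L" for z
  proof -
    have "gap_potential D \<mu> z = (\<integral>\<^sup>+ w. ennreal (1 / n) * (\<Sum>i<n. log_gap D z (r w i)) \<partial>\<nu>)"
      unfolding gap_potential_def by (rule int) measurable
    also have "\<dots> = (\<integral>\<^sup>+ w. ennreal (1 / n) * (ennreal c + log_gap D' (poly q z) w) \<partial>\<nu>)"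
      by (rule nn_integral_cong_AE) (use L_AE fibre[OF z] in \<open>auto elim!: eventually_mono\<close>)
    also have "\<dots> = ennreal (1 / n) * (ennreal c + gap_potential D' \<nu> (poly q z))"
      unfolding gap_potential_def
      by (subst nn_integral_cmult, measurable) (subst nn_integral_add, auto simp: \<nu>.emeasure_space_1)
    finally show ?thesis .
  qed
  have [measurable]: "gap_potential D' \<nu> \<in> borel_measurable borel"
    by (rule gap_potential_measurable[OF \<nu>.sigma_finite_measure_axioms P(2)])
  have "mutual_energy D \<mu> \<mu> = (\<integral>\<^sup>+ z. ennreal (1 / n) * (ennreal c + gap_potential D' \<nu> (poly q z)) \<partial>\<mu>)"
    unfolding mutual_energy_def
    by (rule nn_integral_cong_AE) (use prob_measures_on_AE[OF \<mu> Eb] pot in \<open>auto elim!: eventually_mono\<close>)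
  also have "\<dots> = (\<integral>\<^sup>+ w. ennreal (1 / n) * (\<Sum>i<n. ennreal (1 / n) * (ennreal c + gap_potential D' \<nu> (poly q (r w i)))) \<partial>\<nu>)"
    by (rule int) measurable
  \<comment> \<open>The potential depends on \<open>z\<close> only through \<open>poly q z\<close>,
    so it is constant on each fibre and averaging over the fibre of \<open>w\<close> returns its
    value there.\<close>
  also have "\<dots> = (\<integral>\<^sup>+ w. ennreal (1 / n) * (ennreal c + gap_potential D' \<nu> w) \<partial>\<nu>)"
  proof (rule nn_integral_cong)
    fix w
    have "(\<Sum>i<n. ennreal (1 / n) * (ennreal c + gap_potential D' \<nu> (poly q (r w i))))
        = (\<Sum>i<n. ennreal (1 / n) * (ennreal c + gap_potential D' \<nu> w))"
      by (intro sum.cong) (auto simp: root)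
    then show "ennreal (1 / n) * (\<Sum>i<n. ennreal (1 / n) * (ennreal c + gap_potential D' \<nu> (poly q (r w i))))
        = ennreal (1 / n) * (ennreal c + gap_potential D' \<nu> w)"
      by (simp only: avg)
  qed
  also have "\<dots> = ennreal (1 / n) * (ennreal c + mutual_energy D' \<nu> \<nu>)"
    unfolding mutual_energy_def
    by (subst nn_integral_cmult, measurable) (subst nn_integral_add, auto simp: \<nu>.emeasure_space_1)
  finally have "mutual_energy D \<mu> \<mu> = ennreal (1 / degree q) * (ennreal c + mutual_energy D' \<nu> \<nu>)"
    by (simp add: n_def)
  with \<mu> show thesis by (rule that)
qed

section \<open>Potentials off the support\<close>

text \<open>A real-valued potential, suited to calculus. As \<open>ln 0 = 0\<close>, it is
  trustworthy only away from the mass; it is applied at points off a compact carrier of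
  \<mu>.\<close>

definition log_pot :: "complex measure \<Rightarrow> complex \<Rightarrow> real" where
  "log_pot \<mu> z = (LINT w|\<mu>. ln (cmod (z - w)))"

lemma integrable_on_compact:
  fixes f :: "complex \<Rightarrow> 'b :: {banach, second_countable_topology}"
  assumes \<mu>: "\<mu> \<in> prob_measures_on K" and K: "compact K"
    and f: "f \<in> borel_measurable borel" "continuous_on K f"
  shows "integrable \<mu> f"
proof -
  note P = prob_measures_onD[OF \<mu>]
  interpret prob_space \<mu> by (rule P)
  have [measurable_cong]: "sets \<mu> = sets borel" by (rule P)
  have "bounded (f ` K)" by (intro compact_imp_bounded compact_continuous_image f K)
  then obtain B where B: "\<And>z. z \<in> K \<Longrightarrow> norm (f z) \<le> B" unfolding bounded_iff by blast
  have "AE z in \<mu>. z \<in> K"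
    by (rule prob_measures_on_AE[OF \<mu>]) (simp add: K borel_compact)
  then have "AE z in \<mu>. norm (f z) \<le> B" by (rule eventually_mono) (rule B)
  then show ?thesis using f(1) by (intro integrable_const_bound) simp_all
qed

lemma integrable_log_dist:
  assumes "\<mu> \<in> prob_measures_on K" "compact K" "z \<notin> K"
  shows "integrable \<mu> (\<lambda>w. ln (cmod (z - w)))"
  using assms by (intro integrable_on_compact[of \<mu> K]) (auto intro!: continuous_intros)

lemma integrable_cauchy_kernel:
  assumes "\<mu> \<in> prob_measures_on K" "compact K" "z \<notin> K"
  shows "integrable \<mu> (\<lambda>w. 1 / (z - w) ^ m)"
  using assms by (intro integrable_on_compact[of \<mu> K]) (auto intro!: continuous_intros)

text \<open>A quadratic remainder with a constant independent of \<open>w\<close> survives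
  integration over \<open>w\<close>: this is how potentials and Cauchy transforms are differentiated
  under the integral sign.\<close>

lemma has_derivative_quadratic:
  fixes f :: "'a :: real_normed_vector \<Rightarrow> 'b :: real_normed_vector"
  assumes L: "bounded_linear L" and \<delta>: "\<delta> > 0"
    and bound: "\<And>h. norm h < \<delta> \<Longrightarrow> norm (f (x + h) - f x - L h) \<le> M * (norm h)\<^sup>2"
  shows "(f has_derivative L) (at x)"
  unfolding has_derivative_at
proof (intro conjI L)
  show "(\<lambda>h. norm (f (x + h) - f x - L h) / norm h) \<midarrow>0\<rightarrow> 0"
  proof (rule real_tendsto_sandwich)
    show "\<forall>\<^sub>F h in at 0. 0 \<le> norm (f (x + h) - f x - L h) / norm h" by simp
    show "\<forall>\<^sub>F h in at 0. norm (f (x + h) - f x - L h) / norm h \<le> M * norm h"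
      unfolding eventually_at
    proof (intro exI[of _ \<delta>] conjI \<delta> ballI impI)
      fix h :: 'a assume "h \<noteq> 0 \<and> dist h 0 < \<delta>"
      then show "norm (f (x + h) - f x - L h) / norm h \<le> M * norm h"
        using bound[of h] by (simp add: divide_le_eq power2_eq_square mult.assoc)
    qed
    have "(\<lambda>h :: 'a. M * norm h) \<midarrow>0\<rightarrow> M * norm (0 :: 'a)" by (rule tendsto_mult[OF tendsto_const tendsto_norm[OF tendsto_ident_at]])
    then show "(\<lambda>h. M * norm h) \<midarrow>(0 :: 'a)\<rightarrow> 0" by simp
  qed simp
qed

lemma ball_outside_compact:
  assumes "compact K" "z \<notin> K"
  obtains d where "d > 0" "\<And>w. w \<in> K \<Longrightarrow> d \<le> cmod (z - w)"
  using separate_point_closed[of K z] assms compact_imp_closed by (auto simp: dist_norm)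

text \<open>With \<open>v = h / (z - w)\<close> the increment is the real part of
  \<open>Ln (1 + v)\<close>. The modulus of \<open>v\<close> is at most 1/2, so the error of the
  linear approximation is at most twice its square.\<close>

lemma log_dist_taylor:
  assumes u: "cmod (z - w) \<ge> d" "d > 0" and h: "cmod h < d / 2"
  shows "\<bar>ln (cmod (z + h - w)) - ln (cmod (z - w)) - Re (1 / (z - w) * h)\<bar> \<le> 2 / d\<^sup>2 * (cmod h)\<^sup>2"
proof -
  define v where "v = h / (z - w)"
  have ne: "z - w \<noteq> 0" using u by auto
  have v: "cmod v \<le> cmod h / d" using u ne unfolding v_def norm_divide by (intro divide_left_mono mult_pos_pos) auto
  also have "\<dots> \<le> 1 / 2" using h u(2) by (simp add: pos_divide_le_eq)
  finally have v2: "cmod v \<le> 1 / 2" .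
  have ne1: "1 + v \<noteq> 0"
  proof
    assume "1 + v = 0"
    then have "v = -1" by (simp add: eq_neg_iff_add_eq_0 add.commute)
    with v2 show False by simp
  qed
  have "z + h - w = (z - w) * (1 + v)" using ne by (simp add: v_def field_simps)
  then have "ln (cmod (z + h - w)) - ln (cmod (z - w)) = Re (Ln (1 + v))"
    using ne ne1 by (simp add: norm_mult ln_mult)
  moreover have "Re (1 / (z - w) * h) = Re v" by (simp add: v_def)
  ultimately have "\<bar>ln (cmod (z + h - w)) - ln (cmod (z - w)) - Re (1 / (z - w) * h)\<bar> = \<bar>Re (Ln (1 + v) - v)\<bar>"
    by simp
  also have "\<dots> \<le> cmod (Ln (1 + v) - v)" by (rule abs_Re_le_cmod)
  also have "\<dots> \<le> (cmod v)\<^sup>2 / (1 - cmod v)" using v2 by (intro Ln_approx_linear) simp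
  also have "\<dots> \<le> (cmod h / d)\<^sup>2 / (1 / 2)" using v v2 by (intro frac_le power_mono) auto
  also have "\<dots> = 2 / d\<^sup>2 * (cmod h)\<^sup>2" by (simp add: power_divide)
  finally show ?thesis .
qed

lemma cauchy_kernel_taylor:
  assumes u: "cmod (z - w) \<ge> d" "d > 0" and h: "cmod h < d / 2"
  shows "cmod (1 / (z + h - w) - 1 / (z - w) - (- 1 / (z - w)\<^sup>2) * h) \<le> 2 / d ^ 3 * (cmod h)\<^sup>2"
proof -
  have ne: "z - w \<noteq> 0" using u by auto
  have low: "d / 2 \<le> cmod (z + h - w)"
    using norm_triangle_ineq2[of "z - w" "- h"] u h by (simp add: algebra_simps)
  then have ne': "z + h - w \<noteq> 0" using u by auto
  have "1 / (z + h - w) - 1 / (z - w) - (- 1 / (z - w)\<^sup>2) * h = h\<^sup>2 / ((z - w)\<^sup>2 * (z + h - w))"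
    using ne ne' by (simp add: divide_simps) (simp add: algebra_simps power2_eq_square)
  then have "cmod (1 / (z + h - w) - 1 / (z - w) - (- 1 / (z - w)\<^sup>2) * h) = (cmod h)\<^sup>2 / ((cmod (z - w))\<^sup>2 * cmod (z + h - w))"
    by (simp add: norm_divide norm_mult norm_power)
  also have "\<dots> \<le> (cmod h)\<^sup>2 / (d\<^sup>2 * (d / 2))"
    using u low ne ne' by (intro divide_left_mono mult_mono power_mono mult_pos_pos) auto
  also have "\<dots> = 2 / d ^ 3 * (cmod h)\<^sup>2" by (simp add: power2_eq_square power3_eq_cube)
  finally show ?thesis .
qed

lemma log_pot_has_derivative:
  assumes \<mu>: "\<mu> \<in> prob_measures_on K" and K: "compact K" and z: "z \<notin> K"
  shows "(log_pot \<mu> has_derivative (\<lambda>h. Re ((LINT w|\<mu>. 1 / (z - w)) * h))) (at z)"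
proof -
  note P = prob_measures_onD[OF \<mu>]
  interpret prob_space \<mu> by (rule P)
  obtain d where d: "d > 0" "\<And>w. w \<in> K \<Longrightarrow> d \<le> cmod (z - w)"
    using ball_outside_compact[OF K z] by blast
  have AE: "AE w in \<mu>. w \<in> K"
    by (rule prob_measures_on_AE[OF \<mu>]) (simp add: K borel_compact)
  show ?thesis
  proof (rule has_derivative_quadratic[where \<delta> = "d / 2" and M = "2 / d\<^sup>2"])
    show "bounded_linear (\<lambda>h. Re ((LINT w|\<mu>. 1 / (z - w)) * h))"
      by (intro bounded_linear_compose[OF bounded_linear_Re] bounded_linear_mult_right)
    fix h assume h: "cmod h < d / 2"
    have zh: "z + h \<notin> K"
    proof
      assume "z + h \<in> K"
      then have "d \<le> cmod h" using d(2)[of "z + h"] by simp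
      then show False using h d(1) by simp
    qed
    have i1: "integrable \<mu> (\<lambda>w. ln (cmod (z + h - w)))" by (rule integrable_log_dist[OF \<mu> K zh])
    have i2: "integrable \<mu> (\<lambda>w. ln (cmod (z - w)))" by (rule integrable_log_dist[OF \<mu> K z])
    have i3: "integrable \<mu> (\<lambda>w. 1 / (z - w))" using integrable_cauchy_kernel[OF \<mu> K z, of 1] by simp
    have i4: "integrable \<mu> (\<lambda>w. 1 / (z - w) * h)" by (intro integrable_mult_left i3)
    have i5: "integrable \<mu> (\<lambda>w. Re (1 / (z - w) * h))" using i4 by (rule integrable_Re)
    have diff: "log_pot \<mu> (z + h) - log_pot \<mu> z - Re ((LINT w|\<mu>. 1 / (z - w)) * h)
        = (LINT w|\<mu>. ln (cmod (z + h - w)) - ln (cmod (z - w)) - Re (1 / (z - w) * h))"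
    proof -
      have "Re ((LINT w|\<mu>. 1 / (z - w)) * h) = Re (LINT w|\<mu>. 1 / (z - w) * h)"
        by (subst integral_mult_left_zero) simp
      also have "\<dots> = (LINT w|\<mu>. Re (1 / (z - w) * h))" by (rule integral_Re[OF i4, symmetric])
      finally show ?thesis unfolding log_pot_def using i1 i2 i5 by simp
    qed
    have "norm (log_pot \<mu> (z + h) - log_pot \<mu> z - Re ((LINT w|\<mu>. 1 / (z - w)) * h))
        \<le> (LINT w|\<mu>. norm (ln (cmod (z + h - w)) - ln (cmod (z - w)) - Re (1 / (z - w) * h)))"
      unfolding diff by (rule integral_norm_bound)
    also have "\<dots> \<le> (LINT w|\<mu>. 2 / d\<^sup>2 * (cmod h)\<^sup>2)"
    proof (rule integral_mono_AE)
      show "AE w in \<mu>. norm (ln (cmod (z + h - w)) - ln (cmod (z - w)) - Re (1 / (z - w) * h)) \<le> 2 / d\<^sup>2 * (cmod h)\<^sup>2"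
        using AE
      proof eventually_elim
        case (elim w)
        then show ?case unfolding real_norm_def by (intro log_dist_taylor d h)
      qed
      show "integrable \<mu> (\<lambda>w. norm (ln (cmod (z + h - w)) - ln (cmod (z - w)) - Re (1 / (z - w) * h)))"
        by (intro integrable_norm Bochner_Integration.integrable_diff i1 i2 i5)
    qed simp
    finally show "norm (log_pot \<mu> (z + h) - log_pot \<mu> z - Re ((LINT w|\<mu>. 1 / (z - w)) * h)) \<le> 2 / d\<^sup>2 * (norm h)\<^sup>2"
      by (simp add: prob_space)
  qed (use d in simp)
qed

lemma cauchy_transform_holomorphic:
  assumes \<mu>: "\<mu> \<in> prob_measures_on K" and K: "compact K"
  shows "(\<lambda>z. LINT w|\<mu>. 1 / (z - w)) holomorphic_on - K"
proof (rule holomorphic_onI, rule field_differentiable_at_within)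
  fix z assume "z \<in> - K"
  then have z: "z \<notin> K" by simp
  note P = prob_measures_onD[OF \<mu>]
  interpret prob_space \<mu> by (rule P)
  obtain d where d: "d > 0" "\<And>w. w \<in> K \<Longrightarrow> d \<le> cmod (z - w)"
    using ball_outside_compact[OF K z] by blast
  have AE: "AE w in \<mu>. w \<in> K"
    by (rule prob_measures_on_AE[OF \<mu>]) (simp add: K borel_compact)
  define c where "c = (LINT w|\<mu>. - 1 / (z - w)\<^sup>2)"
  have "((\<lambda>z. LINT w|\<mu>. 1 / (z - w)) has_derivative (*) c) (at z)"
  proof (rule has_derivative_quadratic[where \<delta> = "d / 2" and M = "2 / d ^ 3"])
    show "bounded_linear ((*) c)" by (rule bounded_linear_mult_right)
    fix h assume h: "cmod h < d / 2"
    have zh: "z + h \<notin> K"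
    proof
      assume "z + h \<in> K"
      then have "d \<le> cmod h" using d(2)[of "z + h"] by simp
      then show False using h d(1) by simp
    qed
    have i1: "integrable \<mu> (\<lambda>w. 1 / (z + h - w))" using integrable_cauchy_kernel[OF \<mu> K zh, of 1] by simp
    have i2: "integrable \<mu> (\<lambda>w. 1 / (z - w))" using integrable_cauchy_kernel[OF \<mu> K z, of 1] by simp
    have i3: "integrable \<mu> (\<lambda>w. - 1 / (z - w)\<^sup>2)" using integrable_cauchy_kernel[OF \<mu> K z, of 2] by simp
    have i4: "integrable \<mu> (\<lambda>w. (- 1 / (z - w)\<^sup>2) * h)" by (intro integrable_mult_left i3)
    have diff: "(LINT w|\<mu>. 1 / (z + h - w)) - (LINT w|\<mu>. 1 / (z - w)) - c * h
        = (LINT w|\<mu>. 1 / (z + h - w) - 1 / (z - w) - (- 1 / (z - w)\<^sup>2) * h)"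
    proof -
      have "c * h = (LINT w|\<mu>. (- 1 / (z - w)\<^sup>2) * h)"
        unfolding c_def by (rule integral_mult_left_zero[symmetric])
      then show ?thesis
        using Bochner_Integration.integral_diff[OF Bochner_Integration.integrable_diff[OF i1 i2] i4]
          Bochner_Integration.integral_diff[OF i1 i2] by simp
    qed
    have "norm ((LINT w|\<mu>. 1 / (z + h - w)) - (LINT w|\<mu>. 1 / (z - w)) - c * h)
        \<le> (LINT w|\<mu>. norm (1 / (z + h - w) - 1 / (z - w) - (- 1 / (z - w)\<^sup>2) * h))"
      unfolding diff by (rule integral_norm_bound)
    also have "\<dots> \<le> (LINT w|\<mu>. 2 / d ^ 3 * (cmod h)\<^sup>2)"
    proof (rule integral_mono_AE)
      show "AE w in \<mu>. norm (1 / (z + h - w) - 1 / (z - w) - (- 1 / (z - w)\<^sup>2) * h) \<le> 2 / d ^ 3 * (cmod h)\<^sup>2"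
        using AE
      proof eventually_elim
        case (elim w)
        then show ?case by (intro cauchy_kernel_taylor d h)
      qed
      show "integrable \<mu> (\<lambda>w. norm (1 / (z + h - w) - 1 / (z - w) - (- 1 / (z - w)\<^sup>2) * h))"
        by (intro integrable_norm Bochner_Integration.integrable_diff i1 i2 i4)
    qed simp
    finally show "norm ((LINT w|\<mu>. 1 / (z + h - w)) - (LINT w|\<mu>. 1 / (z - w)) - c * h) \<le> 2 / d ^ 3 * (norm h)\<^sup>2"
      by (simp add: prob_space)
  qed (use d in simp)
  then show "(\<lambda>z. LINT w|\<mu>. 1 / (z - w)) field_differentiable at z"
    unfolding field_differentiable_def has_field_derivative_def by blast
qed

text \<open>The potential is the real part of a local primitive of the Cauchy transform, so unique
  continuation passes from the transform to the potential.\<close>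

lemma log_pot_unique_continuation:
  assumes \<mu>: "\<mu> \<in> prob_measures_on K" and \<nu>: "\<nu> \<in> prob_measures_on K" and K: "compact K"
    and conn: "connected (- K)" and R: "K \<subseteq> ball 0 R"
    and eq: "\<And>z. cmod z > R \<Longrightarrow> log_pot \<mu> z = log_pot \<nu> z" and z: "z \<notin> K"
  shows "log_pot \<mu> z = log_pot \<nu> z"
proof -
  define C where "C M z = (LINT w|M. 1 / (z - w))" for M :: "complex measure" and z
  have op: "open (- K)" using K by (simp add: compact_imp_closed open_Compl)
  define U where "U = - cball (0 :: complex) R"
  have U: "open U" "U \<subseteq> - K" using R by (auto simp: U_def)
  have "complex_of_real (\<bar>R\<bar> + 1) \<in> U" by (simp add: U_def)
  then have "U \<noteq> {}" by blast
  define F where "F z = log_pot \<mu> z - log_pot \<nu> z" for z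
  have dF: "(F has_derivative (\<lambda>h. Re ((C \<mu> z - C \<nu> z) * h))) (at z)" if "z \<notin> K" for z
    unfolding F_def C_def left_diff_distrib minus_complex.sel
    by (intro has_derivative_diff log_pot_has_derivative[OF \<mu> K that] log_pot_has_derivative[OF \<nu> K that])
  have CU: "C \<mu> z = C \<nu> z" if z: "z \<in> U" for z
  proof -
    have "(F has_derivative (\<lambda>h. 0)) (at z)"
    proof (rule has_derivative_transform_within_open[OF has_derivative_const[of 0] U(1) z])
      show "0 = F x" if "x \<in> U" for x using that eq by (simp add: F_def U_def)
    qed
    moreover have "z \<notin> K" using z U by blast
    ultimately have "(\<lambda>h. 0) = (\<lambda>h. Re ((C \<mu> z - C \<nu> z) * h))"
      using dF has_derivative_unique by blast
    \<comment> \<open>Evaluating the vanishing real-linear map at the conjugate of the difference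
      produces the squared modulus of the difference.\<close>
    from fun_cong[OF this, of "cnj (C \<mu> z - C \<nu> z)"]
    have "Re ((C \<mu> z - C \<nu> z) * cnj (C \<mu> z - C \<nu> z)) = 0" by (rule sym)
    then show ?thesis
      by (simp only: complex_norm_square[symmetric] Re_complex_of_real) simp
  qed
  have C_eq: "C \<mu> z = C \<nu> z" if "z \<notin> K" for z
  proof (rule analytic_continuation_open[where f = "C \<mu>" and g = "C \<nu>", OF U(1) op \<open>U \<noteq> {}\<close> conn U(2)])
    show "C \<mu> holomorphic_on - K" "C \<nu> holomorphic_on - K"
      unfolding C_def[abs_def]
      by (intro cauchy_transform_holomorphic[OF \<mu> K] cauchy_transform_holomorphic[OF \<nu> K])+
  qed (use that CU in auto)
  have "(F has_derivative (\<lambda>h. 0)) (at z)" if "z \<in> - K" for z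
    using dF[of z] C_eq[of z] that by simp
  moreover obtain x where x: "x \<in> U" using \<open>U \<noteq> {}\<close> by blast
  ultimately have "F z = F x"
    using z U by (intro has_derivative_zero_unique_connected[OF op conn]) auto
  also have "\<dots> = 0" using x eq by (simp add: F_def U_def)
  finally show ?thesis by (simp add: F_def)
qed

lemma log_pot_bounds:
  assumes \<mu>: "\<mu> \<in> prob_measures_on K" and K: "compact K" "K \<subseteq> cball 0 \<rho>" and z: "cmod z > \<rho>"
  shows "ln (cmod z - \<rho>) \<le> log_pot \<mu> z" "log_pot \<mu> z \<le> ln (cmod z + \<rho>)"
proof -
  note P = prob_measures_onD[OF \<mu>]
  interpret prob_space \<mu> by (rule P)
  have zK: "z \<notin> K" using K z by auto
  have int: "integrable \<mu> (\<lambda>w. ln (cmod (z - w)))" by (rule integrable_log_dist[OF \<mu> K(1) zK])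
  have AE: "AE w in \<mu>. w \<in> K"
    by (rule prob_measures_on_AE[OF \<mu>]) (simp add: K borel_compact)
  have low: "cmod z - \<rho> \<le> cmod (z - w)" and up: "cmod (z - w) \<le> cmod z + \<rho>" if "w \<in> K" for w
  proof -
    have "cmod w \<le> \<rho>" using that K by auto
    then show "cmod z - \<rho> \<le> cmod (z - w)" "cmod (z - w) \<le> cmod z + \<rho>"
      using norm_triangle_ineq2[of z w] norm_triangle_ineq4[of z w] by linarith+
  qed
  have "(LINT w|\<mu>. ln (cmod z - \<rho>)) \<le> log_pot \<mu> z"
    unfolding log_pot_def
  proof (rule integral_mono_AE[OF _ int])
    show "AE w in \<mu>. ln (cmod z - \<rho>) \<le> ln (cmod (z - w))"
      using AE
    proof eventually_elim
      case (elim w)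
      show ?case using low[OF elim] z by (subst ln_le_cancel_iff) auto
    qed
  qed simp
  then show "ln (cmod z - \<rho>) \<le> log_pot \<mu> z" by (simp add: prob_space)
  have "log_pot \<mu> z \<le> (LINT w|\<mu>. ln (cmod z + \<rho>))"
    unfolding log_pot_def
  proof (rule integral_mono_AE[OF int])
    show "AE w in \<mu>. ln (cmod (z - w)) \<le> ln (cmod z + \<rho>)"
      using AE
    proof eventually_elim
      case (elim w)
      show ?case using low[OF elim] up[OF elim] z by (intro ln_mono) auto
    qed
  qed simp
  then show "log_pot \<mu> z \<le> ln (cmod z + \<rho>)" by (simp add: prob_space)
qed

lemma gap_potential_log_pot:
  assumes \<mu>: "\<mu> \<in> prob_measures_on K" and K: "compact K" and z: "z \<notin> K"
    and D: "D > 0" "\<And>w. w \<in> K \<Longrightarrow> cmod (z - w) \<le> D"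
  shows "gap_potential D \<mu> z = ennreal (ln D - log_pot \<mu> z)" "log_pot \<mu> z \<le> ln D"
proof -
  note P = prob_measures_onD[OF \<mu>]
  interpret prob_space \<mu> by (rule P)
  have int: "integrable \<mu> (\<lambda>w. ln (cmod (z - w)))" by (rule integrable_log_dist[OF \<mu> K z])
  have AE: "AE w in \<mu>. w \<in> K"
    by (rule prob_measures_on_AE[OF \<mu>]) (simp add: K borel_compact)
  have nn: "AE w in \<mu>. 0 \<le> ln D - ln (cmod (z - w))"
    using AE
  proof eventually_elim
    case (elim w)
    then have "0 < cmod (z - w)" "cmod (z - w) \<le> D" using z D by auto
    then show ?case by (simp add: ln_mono)
  qed
  have "gap_potential D \<mu> z = (\<integral>\<^sup>+ w. ennreal (ln D - ln (cmod (z - w))) \<partial>\<mu>)"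
    unfolding gap_potential_def
  proof (rule nn_integral_cong_AE)
    show "AE w in \<mu>. log_gap D z w = ennreal (ln D - ln (cmod (z - w)))"
      using AE
    proof eventually_elim
      case (elim w)
      then have "z \<noteq> w" using z by auto
      then show ?case using D(1) by (simp add: log_gap_def ln_div)
    qed
  qed
  also have "\<dots> = ennreal (LINT w|\<mu>. ln D - ln (cmod (z - w)))"
    using int nn by (intro nn_integral_eq_integral) auto
  also have I: "(LINT w|\<mu>. ln D - ln (cmod (z - w))) = ln D - log_pot \<mu> z"
    using int by (simp add: log_pot_def prob_space)
  finally show "gap_potential D \<mu> z = ennreal (ln D - log_pot \<mu> z)" .
  show "log_pot \<mu> z \<le> ln D" using integral_nonneg_AE[OF nn] I by simp
qed

lemma log_potential_log_pot:
  assumes \<mu>: "\<mu> \<in> prob_measures_on K" and K: "compact K" and z: "z \<notin> K"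
  shows "log_potential \<mu> z = ereal (log_pot \<mu> z)"
proof -
  note P = prob_measures_onD[OF \<mu>]
  obtain B where B: "\<And>w. w \<in> K \<Longrightarrow> cmod w \<le> B" using compact_imp_bounded[OF K] unfolding bounded_iff by blast
  define D where "D = \<bar>B\<bar> + cmod z + 1"
  have D: "D \<ge> 1" by (simp add: D_def)
  have le: "cmod (z - w) \<le> D" if "w \<in> K" for w
    using B[OF that] norm_triangle_ineq4[of z w] by (simp add: D_def)
  have AE: "AE w in \<mu>. w \<in> K"
    by (rule prob_measures_on_AE[OF \<mu>]) (simp add: K borel_compact)
  have "log_potential \<mu> z = ereal (ln D) - enn2ereal (gap_potential D \<mu> z)"
    by (rule log_potential_gap[OF P(1,2) D eventually_mono[OF AE le]])
  also have "\<dots> = ereal (log_pot \<mu> z)"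
    using gap_potential_log_pot[OF \<mu> K z _ le] D by (simp add: ennreal.rep_eq max_def)
  finally show ?thesis .
qed

section \<open>Null sets of limit measures and mass bounds from energy\<close>

lemma AE_not_in_locally_null:
  fixes U :: "'a :: second_countable_topology set"
  assumes M: "sets M = sets borel" and loc: "\<And>x. x \<in> U \<Longrightarrow> \<exists>B. open B \<and> x \<in> B \<and> emeasure M B = 0"
  shows "AE x in M. x \<notin> U"
proof -
  define F where "F = {B. open B \<and> emeasure M B = 0}"
  obtain F' where F': "F' \<subseteq> F" "countable F'" "\<Union>F' = \<Union>F"
    using Lindelof[of F] by (auto simp: F_def)
  have "(\<Union>B\<in>F'. B) \<in> null_sets M"
    using F' M by (intro null_sets_UN') (auto simp: F_def null_sets_def)
  moreover have "U \<subseteq> (\<Union>B\<in>F'. B)"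
  proof
    fix x assume "x \<in> U"
    then have "x \<in> \<Union>F" using loc unfolding F_def by blast
    then show "x \<in> (\<Union>B\<in>F'. B)" using F'(3) by simp
  qed
  ultimately show ?thesis by (intro AE_I'[of "\<Union>B\<in>F'. B"]) auto
qed

text \<open>The open-set half of the portmanteau theorem: the indicator of an open set is lower
  semicontinuous, so Fatou bounds the limit mass by every \<open>e > 0\<close>.\<close>

lemma null_open_limit:
  fixes U :: "complex set"
  assumes \<Omega>: "prob_space \<Omega>" and X [measurable]: "\<And>n. X n \<in> borel_measurable \<Omega>" "Y \<in> borel_measurable \<Omega>"
    and lim: "\<And>\<omega>. \<omega> \<in> space \<Omega> \<Longrightarrow> (\<lambda>n. X n \<omega>) \<longlonglongrightarrow> Y \<omega>" and U: "open U"
    and small: "\<And>e. e > 0 \<Longrightarrow> \<forall>\<^sub>F n in sequentially. measure (distr \<Omega> borel (X n)) U \<le> e"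
  shows "emeasure (distr \<Omega> borel Y) U = 0"
proof -
  interpret prob_space \<Omega> by fact
  have Ub [measurable]: "U \<in> sets borel" using U by simp
  interpret D: prob_space "distr \<Omega> borel (X n)" for n by (rule prob_space_distr) measurable
  have em: "emeasure (distr \<Omega> borel Z) U = (\<integral>\<^sup>+ \<omega>. indicator U (Z \<omega>) \<partial>\<Omega>)"
    if [measurable]: "Z \<in> borel_measurable \<Omega>" for Z
  proof -
    have "emeasure (distr \<Omega> borel Z) U = (\<integral>\<^sup>+ z. indicator U z \<partial>distr \<Omega> borel Z)" by simp
    also have "\<dots> = (\<integral>\<^sup>+ \<omega>. indicator U (Z \<omega>) \<partial>\<Omega>)" by (rule nn_integral_distr) auto
    finally show ?thesis .
  qed
  have "(\<integral>\<^sup>+ \<omega>. indicator U (Y \<omega>) \<partial>\<Omega>) \<le> (\<integral>\<^sup>+ \<omega>. liminf (\<lambda>n. indicator U (X n \<omega>)) \<partial>\<Omega>)"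
  proof (rule nn_integral_mono)
    fix \<omega> assume \<omega>: "\<omega> \<in> space \<Omega>"
    show "(indicator U (Y \<omega>) :: ennreal) \<le> liminf (\<lambda>n. indicator U (X n \<omega>))"
    proof (cases "Y \<omega> \<in> U")
      case True
      have "\<forall>\<^sub>F n in sequentially. X n \<omega> \<in> U" by (rule topological_tendstoD[OF lim[OF \<omega>] U True])
      then have "\<forall>\<^sub>F n in sequentially. indicator U (Y \<omega>) \<le> (indicator U (X n \<omega>) :: ennreal)"
        by eventually_elim (simp add: True)
      then show ?thesis by (rule Liminf_bounded)
    qed simp
  qed
  also have "\<dots> \<le> liminf (\<lambda>n. \<integral>\<^sup>+ \<omega>. indicator U (X n \<omega>) \<partial>\<Omega>)"
    by (rule nn_integral_liminf) measurable
  finally have le: "emeasure (distr \<Omega> borel Y) U \<le> liminf (\<lambda>n. emeasure (distr \<Omega> borel (X n)) U)"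
    by (simp only: em X)
  have "emeasure (distr \<Omega> borel Y) U \<le> 0 + ennreal e" if "e > 0" for e
  proof -
    have "\<forall>\<^sub>F n in sequentially. emeasure (distr \<Omega> borel (X n)) U \<le> ennreal e"
      using small[OF that] by eventually_elim (simp add: D.emeasure_eq_measure ennreal_leI)
    then have "liminf (\<lambda>n. emeasure (distr \<Omega> borel (X n)) U) \<le> liminf (\<lambda>n :: nat. ennreal e)"
      by (rule Liminf_mono)
    then show ?thesis using le by (simp add: Liminf_const)
  qed
  note bound = this
  have "emeasure (distr \<Omega> borel Y) U \<le> 0" by (rule ennreal_le_epsilon) (rule bound)
  then show ?thesis by simp
qed

text \<open>Two points of the ball are less than \<open>2 * r\<close> apart, so the kernel is at
  least \<open>ln (D / (2 * r))\<close> there. With bounded energy the mass therefore tends to 0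
  with \<open>r\<close>, uniformly in the centre.\<close>

lemma energy_ball_mass:
  assumes \<mu>: "prob_space \<mu>" "sets \<mu> = sets borel" and r: "0 < r" "2 * r < D"
    and B: "mutual_energy D \<mu> \<mu> \<le> ennreal B" "B \<ge> 0"
  shows "(measure \<mu> (ball \<zeta> r))\<^sup>2 * ln (D / (2 * r)) \<le> B"
proof -
  interpret prob_space \<mu> by fact
  have [measurable_cong]: "sets \<mu> = sets borel" by fact
  have ball: "ball \<zeta> r \<in> sets \<mu>" by simp
  define l where "l = ln (D / (2 * r))"
  have l: "l > 0" using r by (simp add: l_def)
  have gap: "ennreal l * indicator (ball \<zeta> r) z * indicator (ball \<zeta> r) w \<le> log_gap D z w" for z w
  proof (cases "z \<in> ball \<zeta> r \<and> w \<in> ball \<zeta> r \<and> z \<noteq> w")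
    case True
    have "cmod (z - w) < 2 * r"
      using True dist_triangle3[of z w \<zeta>] by (auto simp: dist_norm)
    then have "l \<le> ln (D / cmod (z - w))"
      unfolding l_def using r True by (intro ln_mono divide_left_mono) auto
    then show ?thesis using True by (simp add: log_gap_def ennreal_leI)
  qed (auto simp: log_gap_def indicator_def)
  have "ennreal (l * (measure \<mu> (ball \<zeta> r))\<^sup>2) = (\<integral>\<^sup>+ z. \<integral>\<^sup>+ w. ennreal l * indicator (ball \<zeta> r) z * indicator (ball \<zeta> r) w \<partial>\<mu> \<partial>\<mu>)"
  proof -
    have "(\<integral>\<^sup>+ z. \<integral>\<^sup>+ w. ennreal l * indicator (ball \<zeta> r) z * indicator (ball \<zeta> r) w \<partial>\<mu> \<partial>\<mu>)
        = (\<integral>\<^sup>+ z. ennreal l * indicator (ball \<zeta> r) z * emeasure \<mu> (ball \<zeta> r) \<partial>\<mu>)"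
      by (intro nn_integral_cong nn_integral_cmult_indicator) simp
    also have "\<dots> = (\<integral>\<^sup>+ z. ennreal l * emeasure \<mu> (ball \<zeta> r) * indicator (ball \<zeta> r) z \<partial>\<mu>)"
      by (intro nn_integral_cong) (simp only: mult.assoc mult.commute[of "indicator (ball \<zeta> r) _" "emeasure \<mu> (ball \<zeta> r)"])
    also have "\<dots> = ennreal l * emeasure \<mu> (ball \<zeta> r) * emeasure \<mu> (ball \<zeta> r)"
      by (rule nn_integral_cmult_indicator[OF ball])
    finally have I: "(\<integral>\<^sup>+ z. \<integral>\<^sup>+ w. ennreal l * indicator (ball \<zeta> r) z * indicator (ball \<zeta> r) w \<partial>\<mu> \<partial>\<mu>)
        = ennreal l * ennreal (prob (ball \<zeta> r)) * ennreal (prob (ball \<zeta> r))"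
      unfolding emeasure_eq_measure .
    show ?thesis
      unfolding I using l by (simp add: power2_eq_square flip: ennreal_mult)
  qed
  also have "\<dots> \<le> mutual_energy D \<mu> \<mu>"
    unfolding mutual_energy_def gap_potential_def by (intro nn_integral_mono gap)
  also have "\<dots> \<le> ennreal B" by (rule B)
  finally have "l * (prob (ball \<zeta> r))\<^sup>2 \<le> B" unfolding ennreal_le_iff[OF B(2)] .
  then show ?thesis unfolding l_def by (simp only: mult.commute)
qed

lemma log_pot_root_measure:
  assumes p: "degree p > 0" and z: "poly p z \<noteq> 0"
  shows "ln (cmod (poly p z)) / degree p = ln (cmod (lead_coeff p)) / degree p + log_pot (root_measure p) z"
proof -
  have ne: "z - poly_root p i \<noteq> 0" if "i < degree p" for i using poly_poly_root[OF that] z by auto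
  have "lead_coeff p \<noteq> 0" using p by auto
  then have "ln (cmod (poly p z)) = ln (cmod (lead_coeff p)) + ln (\<Prod>i<degree p. cmod (z - poly_root p i))"
    using ne by (subst poly_by_roots) (simp add: norm_mult prod_norm ln_mult)
  also have "ln (\<Prod>i<degree p. cmod (z - poly_root p i)) = (\<Sum>i<degree p. ln (cmod (z - poly_root p i)))"
    using ne by (intro ln_prod) auto
  finally show ?thesis
    using p by (simp add: log_pot_def integral_root_measure add_divide_distrib)
qed

lemma log_pot_distr:
  assumes [measurable]: "X \<in> borel_measurable \<Omega>"
  shows "log_pot (distr \<Omega> borel X) z = (LINT \<omega>|\<Omega>. ln (cmod (z - X \<omega>)))"
  unfolding log_pot_def by (rule integral_distr) measurable

text \<open>Truncating distances from below at \<open>r\<close> removes the singularity, so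
  dominated convergence applies, even with moving points \<open>z n\<close>.
  \<open>log_pot_distr_max\<close> drops the truncation again where the measure keeps distance
  \<open>r\<close>.\<close>

lemma truncated_potential_limit:
  assumes \<Omega>: "prob_space \<Omega>" and X [measurable]: "\<And>n. X n \<in> borel_measurable \<Omega>" "Y \<in> borel_measurable \<Omega>"
    and lim: "\<And>\<omega>. \<omega> \<in> space \<Omega> \<Longrightarrow> (\<lambda>n. X n \<omega>) \<longlonglongrightarrow> Y \<omega>"
    and bound: "\<And>n \<omega>. cmod (X n \<omega>) \<le> B" and r: "r > 0" and z: "z \<longlonglongrightarrow> a"
  shows "(\<lambda>n. LINT \<omega>|\<Omega>. ln (max r (cmod (z n - X n \<omega>)))) \<longlonglongrightarrow> (LINT \<omega>|\<Omega>. ln (max r (cmod (a - Y \<omega>))))"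
proof -
  interpret prob_space \<Omega> by fact
  obtain A where A: "\<And>n. cmod (z n) \<le> A"
    using convergent_imp_Bseq[OF convergentI[OF z]] unfolding Bseq_def by blast
  define C where "C = \<bar>ln r\<bar> + \<bar>ln (max r (A + B))\<bar>"
  show ?thesis
  proof (rule integral_dominated_convergence[where w = "\<lambda>_. C"])
    show "AE \<omega> in \<Omega>. (\<lambda>n. ln (max r (cmod (z n - X n \<omega>)))) \<longlonglongrightarrow> ln (max r (cmod (a - Y \<omega>)))"
      using r by (intro AE_I2 tendsto_ln tendsto_max tendsto_const tendsto_norm tendsto_diff z lim) auto
    show "AE \<omega> in \<Omega>. norm (ln (max r (cmod (z n - X n \<omega>)))) \<le> C" for n
    proof (rule AE_I2)
      fix \<omega>
      have "cmod (z n - X n \<omega>) \<le> A + B"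
        using norm_triangle_ineq4[of "z n" "X n \<omega>"] A[of n] bound[of n \<omega>] by linarith
      then have "ln r \<le> ln (max r (cmod (z n - X n \<omega>)))"
        "ln (max r (cmod (z n - X n \<omega>))) \<le> ln (max r (A + B))"
        using r by (auto intro!: ln_mono)
      then show "norm (ln (max r (cmod (z n - X n \<omega>)))) \<le> C" unfolding C_def real_norm_def by linarith
    qed
  qed auto
qed

lemma log_pot_distr_max:
  assumes \<Omega>: "prob_space \<Omega>" and [measurable]: "X \<in> borel_measurable \<Omega>"
    and A: "closed A" "distr \<Omega> borel X \<in> prob_measures_on A" and r: "\<And>w. w \<in> A \<Longrightarrow> r \<le> cmod (z - w)"
  shows "(LINT \<omega>|\<Omega>. ln (max r (cmod (z - X \<omega>)))) = log_pot (distr \<Omega> borel X) z"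
  unfolding log_pot_distr[OF assms(2)]
proof (rule integral_cong_AE)
  have "AE \<omega> in \<Omega>. X \<omega> \<in> A"
    using prob_measures_on_AE[OF A(2) borel_closed[OF A(1)]] borel_closed[OF A(1)] by (subst (asm) AE_distr_iff) auto
  then show "AE \<omega> in \<Omega>. ln (max r (cmod (z - X \<omega>))) = ln (cmod (z - X \<omega>))"
    by eventually_elim (simp add: max_absorb2 r)
qed measurable

text \<open>Frostman's inequality applied to the normalised restriction of \<mu> to
  \<open>C\<close>, whose energy is at most that of \<mu> divided by the squared mass, hence finite.
  This form suits a limit measure that may also charge the complement of \<open>C\<close>.\<close>

lemma frostman_restricted:
  assumes C: "C \<in> sets borel" and \<omega>: "\<omega> \<in> prob_measures_on C"
    and min: "\<And>\<nu>. \<nu> \<in> prob_measures_on C \<Longrightarrow> mutual_energy D \<omega> \<omega> \<le> mutual_energy D \<nu> \<nu>"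
    and fin: "mutual_energy D \<omega> \<omega> < \<infinity>"
    and \<mu>: "prob_space \<mu>" "sets \<mu> = sets borel" "mutual_energy D \<mu> \<mu> < \<infinity>"
  shows "mutual_energy D \<omega> \<omega> * emeasure \<mu> C \<le> (\<integral>\<^sup>+ z. gap_potential D \<omega> z * indicator C z \<partial>\<mu>)"
proof (cases "emeasure \<mu> C = 0")
  case False
  interpret \<mu>: prob_space \<mu> by fact
  note P = prob_measures_onD[OF \<omega>]
  interpret \<omega>: prob_space \<omega> by (rule P)
  have [measurable_cong]: "sets \<mu> = sets borel" by fact
  have [measurable]: "C \<in> sets \<mu>" using C \<mu> by simp
  have [measurable]: "gap_potential D \<omega> \<in> borel_measurable borel"
    by (rule gap_potential_measurable[OF \<omega>.sigma_finite_measure_axioms P(2)])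
  have [measurable]: "gap_potential D \<mu> \<in> borel_measurable borel"
    by (rule gap_potential_measurable[OF \<mu>.sigma_finite_measure_axioms \<mu>(2)])
  define \<sigma> where "\<sigma> = uniform_measure \<mu> C"
  have Cfin: "emeasure \<mu> C \<noteq> \<infinity>" by simp
  have "emeasure \<mu> C < top" unfolding \<mu>.emeasure_eq_measure by (rule ennreal_less_top)
  with False have self: "emeasure \<mu> C / emeasure \<mu> C = 1" by (rule ennreal_divide_self)
  have \<sigma>_prob: "prob_space \<sigma>" unfolding \<sigma>_def using False Cfin by (rule prob_space_uniform_measure)
  have \<sigma>_sets: "sets \<sigma> = sets borel" by (simp add: \<sigma>_def \<mu>)
  have "\<sigma> \<in> prob_measures_on C"
  proof -
    have "emeasure \<sigma> C = emeasure \<mu> C / emeasure \<mu> C"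
      unfolding \<sigma>_def using emeasure_uniform_measure[OF \<open>C \<in> sets \<mu>\<close> \<open>C \<in> sets \<mu>\<close>] by simp
    also have "\<dots> = 1" by (rule self)
    finally show ?thesis using \<sigma>_prob \<sigma>_sets by (simp add: prob_measures_on_def)
  qed
  have int: "(\<integral>\<^sup>+ z. f z \<partial>\<sigma>) = (\<integral>\<^sup>+ z. f z * indicator C z \<partial>\<mu>) / emeasure \<mu> C"
    if "f \<in> borel_measurable borel" for f
    unfolding \<sigma>_def using that by (intro nn_integral_uniform_measure) auto
  have int_le: "(\<integral>\<^sup>+ z. f z \<partial>\<sigma>) \<le> (\<integral>\<^sup>+ z. f z \<partial>\<mu>) / emeasure \<mu> C" if "f \<in> borel_measurable borel" for f
    unfolding int[OF that] by (intro divide_right_mono_ennreal nn_integral_mono) (auto simp: indicator_def)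
  have pot_le: "gap_potential D \<sigma> z \<le> gap_potential D \<mu> z / emeasure \<mu> C" for z
    unfolding gap_potential_def by (rule int_le) measurable
  have "mutual_energy D \<sigma> \<sigma> \<le> (\<integral>\<^sup>+ z. gap_potential D \<mu> z / emeasure \<mu> C \<partial>\<sigma>)"
    unfolding mutual_energy_def by (intro nn_integral_mono pot_le)
  also have "\<dots> \<le> (\<integral>\<^sup>+ z. gap_potential D \<mu> z / emeasure \<mu> C \<partial>\<mu>) / emeasure \<mu> C"
    by (rule int_le) measurable
  also have "\<dots> = mutual_energy D \<mu> \<mu> / emeasure \<mu> C / emeasure \<mu> C"
    unfolding mutual_energy_def by (subst nn_integral_divide) auto
  also have "\<dots> < \<infinity>"
  proof -
    obtain m where m: "mutual_energy D \<mu> \<mu> = ennreal m" "m \<ge> 0" using \<mu>(3) by (cases "mutual_energy D \<mu> \<mu>") auto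
    have "\<mu>.prob C \<noteq> 0" using False unfolding \<mu>.emeasure_eq_measure by simp
    then have c: "\<mu>.prob C > 0" using measure_nonneg[of \<mu> C] by linarith
    show ?thesis unfolding m \<mu>.emeasure_eq_measure using m(2) c by (simp add: divide_ennreal)
  qed
  finally have \<sigma>_fin: "mutual_energy D \<sigma> \<sigma> < \<infinity>" .
  have "mutual_energy D \<omega> \<omega> \<le> mutual_energy D \<omega> \<sigma>"
    by (rule frostman[OF C \<omega> \<open>\<sigma> \<in> prob_measures_on C\<close> min fin \<sigma>_fin])
  also have "\<dots> = mutual_energy D \<sigma> \<omega>" by (rule mutual_energy_commute[OF P(1,2) \<sigma>_prob \<sigma>_sets])
  also have "\<dots> = (\<integral>\<^sup>+ z. gap_potential D \<omega> z * indicator C z \<partial>\<mu>) / emeasure \<mu> C"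
    unfolding mutual_energy_def by (rule int) measurable
  finally have le: "mutual_energy D \<omega> \<omega> \<le> (\<integral>\<^sup>+ z. gap_potential D \<omega> z * indicator C z \<partial>\<mu>) / emeasure \<mu> C" .
  have cancel: "x / emeasure \<mu> C * emeasure \<mu> C = x" for x
    unfolding ennreal_divide_times self by simp
  show ?thesis
    using mult_right_mono[OF le, of "emeasure \<mu> C"] unfolding cancel by simp
qed simp

text \<open>A measure within a factor 2 of the supremum takes the place of a maximiser; the price
  \<open>ln 2\<close> disappears later, after division by the degree.\<close>

lemma capacity_near_maximizer:
  assumes cap: "capacity L > 0" and L: "L \<subseteq> cball 0 s" "L \<in> sets borel" and D: "D \<ge> 1" "D \<ge> 2 * s"
  obtains \<nu> where "\<nu> \<in> prob_measures_on L"
    "mutual_energy D \<nu> \<nu> \<le> ennreal (ln D - ln (capacity L) + ln 2)" "0 \<le> ln D - ln (capacity L) + ln 2"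
proof -
  define S where "S = (\<Squnion>\<mu>\<in>prob_measures_on L. exp_ereal (log_energy \<mu>))"
  have S: "S = ennreal (capacity L)"
    using cap unfolding capacity_def S_def[symmetric] by (cases S) auto
  have "ennreal (capacity L / 2) < S" unfolding S using cap by (intro ennreal_lessI) auto
  then obtain \<nu> where \<nu>: "\<nu> \<in> prob_measures_on L" and less: "ennreal (capacity L / 2) < exp_ereal (log_energy \<nu>)"
    unfolding S_def less_SUP_iff by blast
  have "\<nu> \<in> prob_measures_on (cball 0 s)" by (rule prob_measures_on_mono[OF \<nu> L(1) _ L(2)]) simp
  then have en: "log_energy \<nu> = ereal (ln D) - enn2ereal (mutual_energy D \<nu> \<nu>)"
    by (rule log_energy_gap[OF _ D])
  show thesis
  proof (cases "mutual_energy D \<nu> \<nu>")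
    case (real m)
    then have "log_energy \<nu> = ereal (ln D - m)" using en by (simp add: ennreal.rep_eq)
    then have "capacity L / 2 < exp (ln D - m)"
      using less cap by (simp add: exp_ereal_def ennreal_less_iff)
    then have "ln (capacity L / 2) < ln D - m"
      using cap by (metis exp_gt_zero half_gt_zero ln_exp ln_less_cancel_iff)
    then have "m \<le> ln D - ln (capacity L) + ln 2" using cap by (simp add: ln_div)
    then show thesis using \<nu> real by (intro that[of \<nu>]) (auto intro: ennreal_leI)
  next
    case top
    then show thesis using less en by (simp add: exp_ereal_def)
  qed
qed

section \<open>Mass near the zeros\<close>

text \<open>By contradiction: take points \<open>x j\<close> of the small disc with
  \<open>|p j| \<le> s\<close> but at distance at least \<open>r\<close> from all zeros. There the
  truncation at \<open>r\<close> is inactive, so along a subsequence \<open>ln |p j|\<close> over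
  the degree converges to a value of \<open>c + log_pot\<close>, which is positive; yet it is at
  most \<open>ln s\<close> over the degree, which tends to 0.\<close>

lemma eventually_near_root:
  fixes p :: "nat \<Rightarrow> complex poly"
  assumes K: "compact K" and \<Omega>: "prob_space \<Omega>"
    and X: "\<And>j. W j \<in> borel_measurable \<Omega>" "V \<in> borel_measurable \<Omega>"
    and lim: "\<And>\<omega>. \<omega> \<in> space \<Omega> \<Longrightarrow> (\<lambda>j. W j \<omega>) \<longlonglongrightarrow> V \<omega>"
    and bound: "\<And>j \<omega>. cmod (W j \<omega>) \<le> B"
    and law: "\<And>j. distr \<Omega> borel (W j) = root_measure (p j)"
    and \<tau>: "distr \<Omega> borel V \<in> prob_measures_on K"
    and deg: "\<And>j. degree (p j) > 0" "filterlim (\<lambda>j. degree (p j)) at_top sequentially"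
    and lead: "(\<lambda>j. ln (cmod (lead_coeff (p j))) / degree (p j)) \<longlonglongrightarrow> c"
    and out: "cball z0 (2 * r0) \<inter> K = {}" "r0 > 0"
    and pos: "\<And>z. z \<in> cball z0 r0 \<Longrightarrow> c + log_pot (distr \<Omega> borel V) z > 0"
    and r: "0 < r" "r < r0" and s: "s > 0"
  shows "\<forall>\<^sub>F j in sequentially. \<forall>z\<in>ball z0 r0. cmod (poly (p j) z) \<le> s \<longrightarrow>
    (\<exists>\<zeta>\<in>cball z0 (2 * r0). poly (p j) \<zeta> = 0 \<and> cmod (z - \<zeta>) < r)"
proof (rule ccontr)
  assume neg: "\<not> ?thesis"
  define bad where "bad j z \<longleftrightarrow> z \<in> ball z0 r0 \<and> cmod (poly (p j) z) \<le> s \<and>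
    (\<forall>\<zeta>\<in>cball z0 (2 * r0). poly (p j) \<zeta> = 0 \<longrightarrow> r \<le> cmod (z - \<zeta>))" for j z
  have "\<exists>j\<ge>N. \<exists>z. bad j z" for N
  proof -
    have "\<not> (\<forall>j\<ge>N. \<forall>z\<in>ball z0 r0. cmod (poly (p j) z) \<le> s \<longrightarrow>
        (\<exists>\<zeta>\<in>cball z0 (2 * r0). poly (p j) \<zeta> = 0 \<and> cmod (z - \<zeta>) < r))"
      using neg unfolding eventually_sequentially by blast
    then obtain j z where "j \<ge> N" "z \<in> ball z0 r0" "cmod (poly (p j) z) \<le> s"
      "\<not> (\<exists>\<zeta>\<in>cball z0 (2 * r0). poly (p j) \<zeta> = 0 \<and> cmod (z - \<zeta>) < r)" by blast
    then have "bad j z" unfolding bad_def not_less[symmetric] by blast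
    with \<open>j \<ge> N\<close> show ?thesis by blast
  qed
  then have "infinite {j. \<exists>z. bad j z}"
    unfolding infinite_nat_iff_unbounded_le by blast
  from infinite_enumerate[OF this] obtain u :: "nat \<Rightarrow> nat" where u: "strict_mono u" "\<forall>j. \<exists>z. bad (u j) z"
    by blast
  from choice[OF u(2)] obtain x where x: "\<And>j. bad (u j) (x j)" by blast
  have "\<forall>j. x j \<in> cball z0 r0" using x by (auto simp: bad_def less_imp_le)
  then obtain a v where a: "a \<in> cball z0 r0" and v: "strict_mono (v :: nat \<Rightarrow> nat)" and "(x \<circ> v) \<longlonglongrightarrow> a"
    using compact_cball[of z0 r0] unfolding compact_eq_seq_compact_metric seq_compact_def by blast
  then have xa: "(\<lambda>j. x (v j)) \<longlonglongrightarrow> a" by (simp add: o_def)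
  define k where "k j = u (v j)" for j
  have k: "strict_mono k" unfolding k_def using strict_mono_o[OF u(1) v] by (simp add: o_def)
  have badk: "bad (k j) (x (v j))" for j using x[of "v j"] by (simp add: k_def)
  \<comment> \<open>Zeros outside the ball of radius \<open>2 * r0\<close> are more than
    \<open>r0 > r\<close> away from the small ball in any case, so the condition on nearby zeros
    extends to all of them.\<close>
  have far: "r \<le> cmod (x (v j) - \<zeta>)" if "poly (p (k j)) \<zeta> = 0" for j \<zeta>
  proof (cases "\<zeta> \<in> cball z0 (2 * r0)")
    case True
    then show ?thesis using badk[of j] that by (simp add: bad_def)
  next
    case False
    have "dist z0 \<zeta> \<le> dist z0 (x (v j)) + dist (x (v j)) \<zeta>" by (rule dist_triangle)
    moreover have "dist z0 (x (v j)) < r0" using badk[of j] by (simp add: bad_def)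
    ultimately show ?thesis using False r by (simp add: dist_norm)
  qed
  have nz: "poly (p (k j)) (x (v j)) \<noteq> 0" for j using far[of j "x (v j)"] r by auto
  define g where "g j = (LINT \<omega>|\<Omega>. ln (max r (cmod (x (v j) - W (k j) \<omega>))))" for j
  have g: "g j = log_pot (root_measure (p (k j))) (x (v j))" for j
    unfolding g_def law[symmetric]
  proof (rule log_pot_distr_max[OF \<Omega> X(1)])
    show "closed {\<zeta>. poly (p (k j)) \<zeta> = 0}"
      using deg(1)[of "k j"] by (intro finite_imp_closed poly_roots_finite) auto
    then show "distr \<Omega> borel (W (k j)) \<in> prob_measures_on {\<zeta>. poly (p (k j)) \<zeta> = 0}"
      unfolding law using deg(1) by (intro root_measure_prob_measures_on) auto
  qed (use far in auto)
  have "g \<longlonglongrightarrow> (LINT \<omega>|\<Omega>. ln (max r (cmod (a - V \<omega>))))"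
    unfolding g_def
    by (rule truncated_potential_limit[OF \<Omega> X(1) X(2) _ bound r(1) xa])
       (use LIMSEQ_subseq_LIMSEQ[OF lim k] in \<open>simp add: o_def\<close>)
  also have "(LINT \<omega>|\<Omega>. ln (max r (cmod (a - V \<omega>)))) = log_pot (distr \<Omega> borel V) a"
  proof (rule log_pot_distr_max[OF \<Omega> X(2) compact_imp_closed[OF K] \<tau>])
    fix w assume "w \<in> K"
    then have "w \<notin> cball z0 (2 * r0)" using out by auto
    then have "2 * r0 < dist z0 w" by simp
    moreover have "dist z0 w \<le> dist z0 a + dist a w" by (rule dist_triangle)
    moreover have "dist z0 a \<le> r0" using a by simp
    ultimately show "r \<le> cmod (a - w)" using r by (simp add: dist_norm)
  qed
  finally have glim: "g \<longlonglongrightarrow> log_pot (distr \<Omega> borel V) a" .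
  have "(\<lambda>j. ln (cmod (lead_coeff (p (k j)))) / degree (p (k j)) + g j) \<longlonglongrightarrow> c + log_pot (distr \<Omega> borel V) a"
    using LIMSEQ_subseq_LIMSEQ[OF lead k] glim by (intro tendsto_add) (simp_all add: o_def)
  note l1 = this
  have l2: "(\<lambda>j. ln s / degree (p (k j))) \<longlonglongrightarrow> 0"
  proof (rule tendsto_divide_0[OF tendsto_const])
    have "filterlim (\<lambda>j. degree (p (k j))) at_top sequentially"
      using filterlim_compose[OF deg(2) filterlim_subseq[OF k]] by simp
    then show "filterlim (\<lambda>j. real (degree (p (k j)))) at_infinity sequentially"
      by (intro filterlim_at_top_imp_at_infinity filterlim_compose[OF filterlim_real_sequentially])
  qed
  have l3: "ln (cmod (lead_coeff (p (k j)))) / degree (p (k j)) + g j \<le> ln s / degree (p (k j))" for j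
  proof -
    have "ln (cmod (poly (p (k j)) (x (v j)))) \<le> ln s"
      using nz badk[of j] s by (intro ln_mono) (auto simp: bad_def)
    then have "ln (cmod (poly (p (k j)) (x (v j)))) / degree (p (k j)) \<le> ln s / degree (p (k j))"
      by (intro divide_right_mono) auto
    then show ?thesis unfolding log_pot_root_measure[OF deg(1) nz] g .
  qed
  have "c + log_pot (distr \<Omega> borel V) a \<le> 0"
    by (rule LIMSEQ_le[OF l1 l2]) (intro exI allI impI l3)
  then show False using pos[OF a] by simp
qed

text \<open>A measure of bounded energy gives little mass to a small ball, and only boundedly many zeros
  lie away from \<open>K\<close>. Hence no mass survives near points where \<open>|p j|\<close> is large away from the zeros.\<close>

lemma mass_near_roots_vanishes:
  fixes p :: "nat \<Rightarrow> complex poly"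
  assumes deg: "\<And>j. degree (p j) > 0"
    and M: "\<And>j. size {#z \<in># proots (p j). z \<in> A#} \<le> M"
    and near: "\<And>r. 0 < r \<Longrightarrow> r < r0 \<Longrightarrow> \<forall>\<^sub>F j in sequentially. \<forall>z\<in>U. cmod (poly (p j) z) \<le> s \<longrightarrow>
      (\<exists>\<zeta>\<in>A. poly (p j) \<zeta> = 0 \<and> cmod (z - \<zeta>) < r)"
    and r0: "r0 > 0" and U: "U \<in> sets borel"
    and m: "\<And>j. prob_space (m j)" "\<And>j. sets (m j) = sets borel"
    and sub: "\<And>j. AE z in m j. cmod (poly (p j) z) \<le> s"
    and en: "\<forall>\<^sub>F j in sequentially. mutual_energy D (m j) (m j) \<le> ennreal C" "C \<ge> 0" and D: "D > 0"
    and e: "e > 0"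
  shows "\<forall>\<^sub>F j in sequentially. measure (m j) U \<le> e"
proof -
  \<comment> \<open>At most \<open>M\<close> distinct zeros, each with a ball of mass at most
    \<delta>, contribute at most \<open>e\<close>; the \<open>+ 1\<close> covers
    \<open>M = 0\<close>. The radius below makes \<open>ln (D / (2 * r))\<close> exceed
    \<open>C / \<delta>\<^sup>2\<close>, which by \<open>energy_ball_mass\<close> forces mass at
    most \<delta>.\<close>
  define \<delta> where "\<delta> = e / (real M + 1)"
  have \<delta>: "\<delta> > 0" using e by (simp add: \<delta>_def)
  have c0: "0 < C / \<delta>\<^sup>2 + 1" using en(2) by (intro add_nonneg_pos divide_nonneg_nonneg) auto
  define r where "r = min (r0 / 2) (D / 2 * exp (- (C / \<delta>\<^sup>2 + 1)))"
  have r: "0 < r" "r < r0" using r0 D by (auto simp: r_def min_def)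
  have "r \<le> D / 2 * exp (- (C / \<delta>\<^sup>2 + 1))" by (simp add: r_def)
  then have rle: "2 * r \<le> D * exp (- (C / \<delta>\<^sup>2 + 1))" by simp
  have "D * exp (- (C / \<delta>\<^sup>2 + 1)) < D * 1"
    using D c0 by (intro mult_strict_left_mono) auto
  then have rD: "2 * r < D" using rle by simp
  have "exp (C / \<delta>\<^sup>2 + 1) * (2 * r) \<le> exp (C / \<delta>\<^sup>2 + 1) * (D * exp (- (C / \<delta>\<^sup>2 + 1)))"
    using rle by (rule mult_left_mono) simp
  also have "\<dots> = D * (exp (C / \<delta>\<^sup>2 + 1) * exp (- (C / \<delta>\<^sup>2 + 1)))" by (simp only: mult.left_commute)
  also have "\<dots> = D" by (simp only: mult_exp_exp) simp
  finally have "exp (C / \<delta>\<^sup>2 + 1) \<le> D / (2 * r)" using r by (simp add: pos_le_divide_eq)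
  then have "ln (exp (C / \<delta>\<^sup>2 + 1)) \<le> ln (D / (2 * r))" by (intro ln_mono) auto
  then have lnr: "C / \<delta>\<^sup>2 + 1 \<le> ln (D / (2 * r))" by simp
  show ?thesis
    using near[OF r] en(1)
  proof eventually_elim
    case (elim j)
    interpret prob_space "m j" by (rule m)
    have [measurable_cong]: "sets (m j) = sets borel" by (rule m)
    have small: "prob (ball \<zeta> r) \<le> \<delta>" for \<zeta>
    proof -
      have mass: "(prob (ball \<zeta> r))\<^sup>2 * ln (D / (2 * r)) \<le> C"
        by (rule energy_ball_mass[OF m r(1) rD elim(2) en(2)])
      have "(prob (ball \<zeta> r))\<^sup>2 * (C / \<delta>\<^sup>2 + 1) \<le> (prob (ball \<zeta> r))\<^sup>2 * ln (D / (2 * r))"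
        using lnr by (intro mult_left_mono) auto
      also have "\<dots> \<le> C" by (rule mass)
      also have "C \<le> \<delta>\<^sup>2 * (C / \<delta>\<^sup>2 + 1)" using \<delta> by (simp add: distrib_left)
      finally have "(prob (ball \<zeta> r))\<^sup>2 \<le> \<delta>\<^sup>2"
        using mult_le_cancel_right_pos[OF c0] by blast
      then show ?thesis by (rule power2_le_imp_le) (use \<delta> in simp)
    qed
    define Z where "Z = {\<zeta> \<in> A. poly (p j) \<zeta> = 0}"
    have pj: "p j \<noteq> 0" using deg[of j] by auto
    have Zset: "Z = set_mset {#z \<in># proots (p j). z \<in> A#}" using pj by (auto simp: Z_def)
    then have finZ: "finite Z" by simp
    have "card Z \<le> size {#z \<in># proots (p j). z \<in> A#}"
      unfolding Zset size_mset_set[symmetric] by (rule size_mset_mono[OF mset_set_set_mset_msubset])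
    then have cardZ: "card Z \<le> M" using M[of j] by linarith
    have "AE z in m j. z \<in> U \<longrightarrow> z \<in> (\<Union>\<zeta>\<in>Z. ball \<zeta> r)"
      using sub[of j]
    proof (rule eventually_mono, intro impI)
      fix z assume "cmod (poly (p j) z) \<le> s" "z \<in> U"
      then obtain \<zeta> where "\<zeta> \<in> A" "poly (p j) \<zeta> = 0" "cmod (z - \<zeta>) < r" using elim(1) by blast
      then show "z \<in> (\<Union>\<zeta>\<in>Z. ball \<zeta> r)"
        by (auto simp: Z_def dist_norm norm_minus_commute)
    qed
    moreover have "(\<Union>\<zeta>\<in>Z. ball \<zeta> r) \<in> events"
      unfolding m by (intro borel_open open_UN ballI open_ball)
    ultimately have "prob U \<le> prob (\<Union>\<zeta>\<in>Z. ball \<zeta> r)"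
      by (rule finite_measure_mono_AE)
    also have "\<dots> \<le> (\<Sum>\<zeta>\<in>Z. prob (ball \<zeta> r))"
      by (intro measure_UNION_le finZ) (auto simp: m)
    also have "\<dots> \<le> (\<Sum>\<zeta>\<in>Z. \<delta>)" by (intro sum_mono small)
    also have "\<dots> = real (card Z) * \<delta>" by simp
    also have "\<dots> \<le> (real M + 1) * \<delta>" using cardZ \<delta> by (intro mult_right_mono) auto
    also have "\<dots> = e" by (simp add: \<delta>_def)
    finally show ?case .
  qed
qed

section \<open>Limits of equilibrium measures\<close>

text \<open>The core of the argument, with everything expressed at scale \<open>D\<close>:
  \<open>E\<close> stands for \<open>ln D - I\<close>, so \<open>E - ln D\<close> is
  \<open>- I\<close> and the threshold \<open>ln D - E\<close> is \<open>I\<close>. Conditions are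
  stated for every index because exceptional initial terms are dropped before it is applied.\<close>

lemma equilibrium_subsequence:
  fixes p :: "nat \<Rightarrow> complex poly"
  assumes K: "compact K" "connected (- K)" "K \<subseteq> cball 0 \<rho>" and \<rho>: "\<rho> > 0"
    and \<omega>: "\<omega> \<in> prob_measures_on K"
    and min: "\<And>\<nu>. \<nu> \<in> prob_measures_on K \<Longrightarrow> mutual_energy D \<omega> \<omega> \<le> mutual_energy D \<nu> \<nu>"
    and E: "mutual_energy D \<omega> \<omega> = ennreal E" "E \<ge> 0"
    and D: "D > 0" "D \<ge> 2 * \<rho>"
    and deg: "\<And>j. degree (p j) > 0" "filterlim (\<lambda>j. degree (p j)) at_top sequentially"
    and m: "\<And>j. m j \<in> prob_measures_on (cball 0 \<rho>)"
      "\<And>j. AE z in m j. cmod (poly (p j) z) \<le> s" and s: "s > 0"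
    and en: "\<And>j. mutual_energy D (m j) (m j) \<le> ennreal (b j)" "b \<longlonglongrightarrow> E"
    and roots: "\<And>j. root_measure (p j) \<in> prob_measures_on (cball 0 \<rho>)"
    and center: "\<And>A. closed A \<Longrightarrow> A \<inter> K = {} \<Longrightarrow> \<exists>M. \<forall>j. size {#z \<in># proots (p j). z \<in> A#} \<le> M"
    and lead: "(\<lambda>j. ln (cmod (lead_coeff (p j))) / degree (p j)) \<longlonglongrightarrow> E - ln D"
    and pot: "\<And>z. cmod z > R \<Longrightarrow> (\<lambda>j. log_pot (root_measure (p j)) z) \<longlonglongrightarrow> log_pot \<omega> z"
  shows "\<exists>t. strict_mono (t :: nat \<Rightarrow> nat) \<and>
    (\<forall>f :: complex \<Rightarrow> real. continuous_on UNIV f \<longrightarrow> (\<lambda>j. LINT z|m (t j). f z) \<longlonglongrightarrow> (LINT z|\<omega>. f z))"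
proof -
  have Kc: "closed K" and Kb: "K \<in> sets borel" using K(1) by (auto simp: compact_imp_closed)
  \<comment> \<open>Two extractions in turn, each with its own probability space: the limits \<mu>
    and \<tau> meet only through the potential of \<tau>.\<close>
  obtain t1 \<Omega>1 X Y where t1: "strict_mono (t1 :: nat \<Rightarrow> nat)" and \<Omega>1: "prob_space (\<Omega>1 :: real measure)"
    and X: "\<And>n. X n \<in> borel_measurable \<Omega>1" "Y \<in> borel_measurable \<Omega>1"
    and lawX: "\<And>n. distr \<Omega>1 borel (X n) = m (t1 n)"
    and limX: "\<And>\<omega>. \<omega> \<in> space \<Omega>1 \<Longrightarrow> (\<lambda>n. X n \<omega>) \<longlonglongrightarrow> Y \<omega>"
    and bX: "\<And>n \<omega>. cmod (X n \<omega>) \<le> 10 * \<rho>" "\<And>\<omega>. cmod (Y \<omega>) \<le> 10 * \<rho>"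
    by (rule skorohod_subsequence[where \<mu> = m, OF m(1) \<rho>]) (rule that)
  obtain t2 \<Omega>2 W V where t2: "strict_mono (t2 :: nat \<Rightarrow> nat)" and \<Omega>2: "prob_space (\<Omega>2 :: real measure)"
    and W: "\<And>n. W n \<in> borel_measurable \<Omega>2" "V \<in> borel_measurable \<Omega>2"
    and lawW: "\<And>n. distr \<Omega>2 borel (W n) = root_measure (p (t1 (t2 n)))"
    and limW: "\<And>\<omega>. \<omega> \<in> space \<Omega>2 \<Longrightarrow> (\<lambda>n. W n \<omega>) \<longlonglongrightarrow> V \<omega>"
    and bW: "\<And>n \<omega>. cmod (W n \<omega>) \<le> 10 * \<rho>" "\<And>\<omega>. cmod (V \<omega>) \<le> 10 * \<rho>"
    by (rule skorohod_subsequence[where \<mu> = "\<lambda>j. root_measure (p (t1 j))", OF roots \<rho>]) (rule that)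
  define t where "t j = t1 (t2 j)" for j
  have t: "strict_mono t" unfolding t_def using strict_mono_o[OF t1 t2] by (simp add: o_def)
  define Z where "Z j = X (t2 j)" for j
  have Z: "Z j \<in> borel_measurable \<Omega>1" for j unfolding Z_def by (rule X)
  have lawZ: "distr \<Omega>1 borel (Z j) = m (t j)" for j unfolding Z_def t_def by (rule lawX)
  have limZ: "(\<lambda>n. Z n \<omega>) \<longlonglongrightarrow> Y \<omega>" if "\<omega> \<in> space \<Omega>1" for \<omega>
    using LIMSEQ_subseq_LIMSEQ[OF limX[OF that] t2] by (simp add: Z_def o_def)
  have bZ: "cmod (Z n \<omega>) \<le> 10 * \<rho>" for n \<omega> unfolding Z_def by (rule bX)
  have lawW': "distr \<Omega>2 borel (W j) = root_measure (p (t j))" for j unfolding t_def by (rule lawW)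
  have degt: "filterlim (\<lambda>j. degree (p (t j))) at_top sequentially"
    using filterlim_compose[OF deg(2) filterlim_subseq[OF t]] by simp
  have leadt: "(\<lambda>j. ln (cmod (lead_coeff (p (t j)))) / degree (p (t j))) \<longlonglongrightarrow> E - ln D"
    using LIMSEQ_subseq_LIMSEQ[OF lead t] by (simp add: o_def)
  define \<mu> where "\<mu> = distr \<Omega>1 borel Y"
  define \<tau> where "\<tau> = distr \<Omega>2 borel V"
  interpret \<Omega>1: prob_space \<Omega>1 by (rule \<Omega>1)
  interpret \<Omega>2: prob_space \<Omega>2 by (rule \<Omega>2)
  have \<tau>_prob: "prob_space \<tau>" unfolding \<tau>_def using W(2) by (rule \<Omega>2.prob_space_distr)
  have \<mu>_prob: "prob_space \<mu>" unfolding \<mu>_def using X(2) by (rule \<Omega>1.prob_space_distr)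
  interpret \<mu>: prob_space \<mu> by (rule \<mu>_prob)
  have \<mu>_sets: "sets \<mu> = sets borel" and \<tau>_sets: "sets \<tau> = sets borel" by (simp_all add: \<mu>_def \<tau>_def)
  have nbhd: "\<exists>r>0. cball z (2 * r) \<inter> K = {}" if zK: "z \<notin> K" for z
  proof -
    obtain d where d: "d > 0" "\<And>w. w \<in> K \<Longrightarrow> d \<le> cmod (z - w)"
      using ball_outside_compact[OF K(1) zK] by blast
    have "w \<notin> cball z (2 * (d / 4))" if "w \<in> K" for w using d(2)[OF that] d(1) by (simp add: dist_norm)
    then have "cball z (2 * (d / 4)) \<inter> K = {}" by blast
    then show ?thesis using d(1) by (intro exI[of _ "d / 4"]) simp
  qed
  \<comment> \<open>Boundedly many zeros near a point off \<open>K\<close>, divided by degrees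
    tending to infinity, leave no mass in the limit.\<close>
  have "AE z in \<tau>. z \<notin> - K"
  proof (rule AE_not_in_locally_null[OF \<tau>_sets])
    fix z assume "z \<in> - K"
    then obtain r where r: "r > 0" "cball z (2 * r) \<inter> K = {}" using nbhd by blast
    then obtain M where M: "\<And>j. size {#x \<in># proots (p j). x \<in> cball z (2 * r)#} \<le> M"
      using center[OF closed_cball] by blast
    have "emeasure \<tau> (ball z r) = 0"
      unfolding \<tau>_def
    proof (rule null_open_limit[OF \<Omega>2 W limW open_ball])
      fix e :: real assume e: "e > 0"
      obtain n0 :: nat where n0: "real M / e < real n0" using reals_Archimedean2 by blast
      have "\<forall>\<^sub>F j in sequentially. n0 \<le> degree (p (t j))"
        using degt unfolding filterlim_at_top by blast
      then show "\<forall>\<^sub>F j in sequentially. measure (distr \<Omega>2 borel (W j)) (ball z r) \<le> e"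
      proof eventually_elim
        case (elim j)
        interpret R: prob_space "root_measure (p (t j))" by (rule prob_space_root_measure[OF deg(1)])
        have "R.prob (ball z r) \<le> R.prob (cball z (2 * r))"
          using r(1) by (intro R.finite_measure_mono) auto
        also have "\<dots> = size {#x \<in># proots (p (t j)). x \<in> cball z (2 * r)#} / degree (p (t j))"
          by (rule measure_root_measure_proots[OF deg(1)]) simp
        also have "\<dots> \<le> M / degree (p (t j))" using M[of "t j"] by (intro divide_right_mono) auto
        also have "\<dots> \<le> e"
        proof -
          have "real M < real n0 * e" using n0 e by (simp add: pos_divide_less_eq)
          also have "\<dots> \<le> degree (p (t j)) * e" using elim e by (intro mult_right_mono) auto
          finally show ?thesis using deg(1)[of "t j"] by (simp add: pos_divide_le_eq mult.commute)
        qed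
        finally show ?case unfolding lawW' .
      qed
    qed
    then show "\<exists>B. open B \<and> z \<in> B \<and> emeasure \<tau> B = 0"
      using r(1) by (intro exI[of _ "ball z r"]) simp
  qed
  then have \<tau>K: "\<tau> \<in> prob_measures_on K"
    by (intro prob_measures_onI[OF \<tau>_prob \<tau>_sets Kb]) simp
  have pot_eq: "log_pot \<tau> z = log_pot \<omega> z" if "z \<notin> K" for z
  proof (rule log_pot_unique_continuation[OF \<tau>K \<omega> K(1,2) _ _ that])
    \<comment> \<open>The coupled variables are bounded by \<open>10 * \<rho>\<close>, so beyond
      \<open>11 * \<rho>\<close> the truncation at \<rho> is inactive.\<close>
    define R' where "R' = max R (11 * \<rho>)"
    show "K \<subseteq> ball 0 R'"
    proof
      fix x assume "x \<in> K"
      then have "cmod x \<le> \<rho>" using K(3) by auto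
      then show "x \<in> ball 0 R'" using \<rho> by (simp add: R'_def max_def)
    qed
    fix z :: complex assume z: "cmod z > R'"
    then have zR: "cmod z > R" "cmod z > 11 * \<rho>" by (auto simp: R'_def)
    have far: "\<rho> \<le> cmod (z - w)" if "cmod w \<le> 10 * \<rho>" for w
      using norm_triangle_ineq2[of z w] that zR by linarith
    have mx: "max \<rho> (cmod (z - w)) = cmod (z - w)" if "cmod w \<le> 10 * \<rho>" for w
      using far[OF that] by (rule max_absorb2)
    have "(\<lambda>n. LINT \<omega>|\<Omega>2. ln (max \<rho> (cmod (z - W n \<omega>)))) \<longlonglongrightarrow> (LINT \<omega>|\<Omega>2. ln (max \<rho> (cmod (z - V \<omega>))))"
      by (rule truncated_potential_limit[OF \<Omega>2 W limW bW(1) \<rho> tendsto_const])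
    then have "(\<lambda>n. log_pot (root_measure (p (t n))) z) \<longlonglongrightarrow> log_pot \<tau> z"
      unfolding mx[OF bW(1)] mx[OF bW(2)] \<tau>_def lawW'[symmetric] log_pot_distr[OF W(1)] log_pot_distr[OF W(2)] .
    moreover have "(\<lambda>n. log_pot (root_measure (p (t n))) z) \<longlonglongrightarrow> log_pot \<omega> z"
      using LIMSEQ_subseq_LIMSEQ[OF pot[OF zR(1)] t] by (simp add: o_def)
    ultimately show "log_pot \<tau> z = log_pot \<omega> z" by (rule LIMSEQ_unique)
  qed
  have \<mu>_ball: "\<mu> \<in> prob_measures_on (cball 0 \<rho>)"
    unfolding \<mu>_def by (rule distr_limit_closed[OF \<Omega>1 Z X(2) limZ closed_cball]) (simp_all add: lawZ m)
  have btE: "(\<lambda>j. b (t j)) \<longlonglongrightarrow> E" using LIMSEQ_subseq_LIMSEQ[OF en(2) t] by (simp add: o_def)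
  have E_bound: "\<forall>\<^sub>F j in sequentially. mutual_energy D (m (t j)) (m (t j)) \<le> ennreal (E + 1)"
  proof -
    have "\<forall>\<^sub>F j in sequentially. b (t j) < E + 1" by (rule order_tendstoD(2)[OF btE]) simp
    then show ?thesis
      by eventually_elim (rule order_trans[OF en(1)], simp add: ennreal_leI)
  qed
  have \<mu>_en: "mutual_energy D \<mu> \<mu> \<le> ennreal E"
  proof -
    have "mutual_energy D \<mu> \<mu> \<le> liminf (\<lambda>j. mutual_energy D (m (t j)) (m (t j)))"
      using mutual_energy_liminf[OF \<Omega>1 Z X(2) limZ D(1)] unfolding lawZ \<mu>_def .
    also have "\<dots> \<le> liminf (\<lambda>j. ennreal (b (t j)))"
      by (intro Liminf_mono always_eventually allI en)
    also have "\<dots> = ennreal E"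
      by (intro lim_imp_Liminf tendsto_ennrealI btE) simp
    finally show ?thesis .
  qed
  \<comment> \<open>As \<open>ln D - E\<close> is the logarithmic energy of \<omega>, this is where
    the Green's function is positive.\<close>
  define P where "P = {z. z \<notin> K \<and> log_pot \<omega> z > ln D - E}"
  have "AE z in \<mu>. z \<notin> P"
  proof (rule AE_not_in_locally_null[OF \<mu>_sets])
    fix z0 assume "z0 \<in> P"
    then have z0: "z0 \<notin> K" and g0: "log_pot \<omega> z0 > ln D - E" by (auto simp: P_def)
    obtain r1 where r1: "r1 > 0" "cball z0 (2 * r1) \<inter> K = {}" using nbhd[OF z0] by blast
    have "isCont (log_pot \<omega>) z0"
      using log_pot_has_derivative[OF \<omega> K(1) z0] by (rule has_derivative_continuous)
    then have "\<forall>\<^sub>F z in nhds z0. log_pot \<omega> z > ln D - E"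
      using g0 by (intro order_tendstoD(1)[of "log_pot \<omega>" "log_pot \<omega> z0"]) (simp_all add: isCont_def tendsto_at_iff_tendsto_nhds)
    then obtain d where d: "d > 0" "\<And>z. dist z z0 < d \<Longrightarrow> log_pot \<omega> z > ln D - E"
      unfolding eventually_nhds_metric by blast
    \<comment> \<open>The closed disc of radius \<open>2 * r0\<close> avoids \<open>K\<close>, while
      on that of radius \<open>r0\<close> the potential stays above the threshold.\<close>
    define r0 where "r0 = min r1 (d / 2)"
    have r0: "r0 > 0" using r1 d by (simp add: r0_def)
    have out: "cball z0 (2 * r0) \<inter> K = {}"
    proof -
      have "cball z0 (2 * r0) \<subseteq> cball z0 (2 * r1)" by (intro subset_cball) (simp add: r0_def)
      then show ?thesis using r1 by blast
    qed
    have pos: "E - ln D + log_pot \<tau> z > 0" if "z \<in> cball z0 r0" for z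
    proof -
      have "z \<in> cball z0 (2 * r0)" using that r0 by auto
      then have "z \<notin> K" using out by blast
      moreover have "dist z z0 < d"
        using that r0 d by (auto simp: r0_def dist_commute min_def split: if_splits)
      ultimately show ?thesis using d(2)[of z] pot_eq[of z] by simp
    qed
    obtain M where M: "\<And>j. size {#x \<in># proots (p j). x \<in> cball z0 (2 * r0)#} \<le> M"
      using center[OF closed_cball out] by blast
    have "emeasure \<mu> (ball z0 r0) = 0"
      unfolding \<mu>_def
    proof (rule null_open_limit[OF \<Omega>1 Z X(2) limZ open_ball])
      fix e :: real assume e: "e > 0"
      show "\<forall>\<^sub>F j in sequentially. measure (distr \<Omega>1 borel (Z j)) (ball z0 r0) \<le> e"
        unfolding lawZ
      proof (rule mass_near_roots_vanishes[where p = "\<lambda>j. p (t j)" and A = "cball z0 (2 * r0)" and s = s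
            and C = "E + 1" and D = D and M = M])
        show "\<forall>\<^sub>F j in sequentially. \<forall>z\<in>ball z0 r0. cmod (poly (p (t j)) z) \<le> s \<longrightarrow>
            (\<exists>\<zeta>\<in>cball z0 (2 * r0). poly (p (t j)) \<zeta> = 0 \<and> cmod (z - \<zeta>) < r)"
          if "0 < r" "r < r0" for r
          by (rule eventually_near_root[where p = "\<lambda>j. p (t j)",
                OF K(1) \<Omega>2 W limW bW(1) lawW' \<tau>K[unfolded \<tau>_def] deg(1) degt leadt out r0
                  pos[unfolded \<tau>_def] that s])
        show "AE z in m (t j). cmod (poly (p (t j)) z) \<le> s" for j by (rule m)
        show "prob_space (m (t j))" "sets (m (t j)) = sets borel" for j
          using prob_measures_onD[OF m(1)[of "t j"]] by auto
      qed (use deg M r0 E_bound E(2) D(1) e in auto)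
    qed
    then show "\<exists>B. open B \<and> z0 \<in> B \<and> emeasure \<mu> B = 0"
      using r0 by (intro exI[of _ "ball z0 r0"]) simp
  qed
  note AE_P = this
  have AE_ball: "AE z in \<mu>. z \<in> cball 0 \<rho>" by (rule prob_measures_on_AE[OF \<mu>_ball]) simp
  note P\<omega> = prob_measures_onD[OF \<omega>]
  interpret \<omega>: prob_space \<omega> by (rule P\<omega>)
  have gm: "gap_potential D \<omega> \<in> borel_measurable borel"
    by (rule gap_potential_measurable[OF \<omega>.sigma_finite_measure_axioms P\<omega>(2)])
  have gm\<mu> [measurable]: "gap_potential D \<omega> \<in> borel_measurable \<mu>"
    using gm \<mu>_sets by (simp cong: measurable_cong_sets)
  have Kb\<mu> [measurable]: "K \<in> sets \<mu>" using Kb \<mu>_sets by simp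
  \<comment> \<open>Off \<open>K\<close> and outside \<open>P\<close> the gap potential of \<omega>
    is at least \<open>E\<close>; on \<open>K\<close> this holds on \<mu>-average by
    \<open>frostman_restricted\<close>. The two bounds add up to a lower bound \<open>E\<close> for
    the mutual energy.\<close>
  have off: "AE z in \<mu>. ennreal E * indicator (- K) z \<le> gap_potential D \<omega> z * indicator (- K) z"
    using AE_P AE_ball
  proof eventually_elim
    case (elim z)
    show ?case
    proof (cases "z \<in> K")
      case False
      have le: "cmod (z - w) \<le> D" if "w \<in> K" for w
      proof -
        have "cmod w \<le> \<rho>" using that K(3) by auto
        then show ?thesis using elim(2) norm_triangle_ineq4[of z w] D by simp
      qed
      have "gap_potential D \<omega> z = ennreal (ln D - log_pot \<omega> z)"
        by (rule gap_potential_log_pot(1)[OF \<omega> K(1) False D(1) le])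
      moreover have "log_pot \<omega> z \<le> ln D - E" using elim(1) False by (simp add: P_def)
      ultimately show ?thesis using False by (simp add: ennreal_leI)
    qed simp
  qed
  have "mutual_energy D \<mu> \<mu> < \<infinity>" using \<mu>_en by (rule order_le_less_trans) simp
  then have on: "ennreal E * emeasure \<mu> K \<le> (\<integral>\<^sup>+ z. gap_potential D \<omega> z * indicator K z \<partial>\<mu>)"
    using frostman_restricted[OF Kb \<omega> min _ \<mu>_prob \<mu>_sets] unfolding E(1) by simp
  have "ennreal E = (\<integral>\<^sup>+ z. ennreal E * indicator K z + ennreal E * indicator (- K) z \<partial>\<mu>)"
  proof -
    have "ennreal E * indicator K z + ennreal E * indicator (- K) z = ennreal E" for z
      by (simp add: indicator_def)
    then show ?thesis by (simp add: \<mu>.emeasure_space_1)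
  qed
  also have "\<dots> = (\<integral>\<^sup>+ z. ennreal E * indicator K z \<partial>\<mu>) + (\<integral>\<^sup>+ z. ennreal E * indicator (- K) z \<partial>\<mu>)"
    by (rule nn_integral_add) measurable
  also have "(\<integral>\<^sup>+ z. ennreal E * indicator K z \<partial>\<mu>) = ennreal E * emeasure \<mu> K"
    by (rule nn_integral_cmult_indicator[OF Kb\<mu>])
  also have "ennreal E * emeasure \<mu> K + (\<integral>\<^sup>+ z. ennreal E * indicator (- K) z \<partial>\<mu>)
      \<le> (\<integral>\<^sup>+ z. gap_potential D \<omega> z * indicator K z \<partial>\<mu>) + (\<integral>\<^sup>+ z. gap_potential D \<omega> z * indicator (- K) z \<partial>\<mu>)"
    by (rule add_mono[OF on nn_integral_mono_AE[OF off]])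
  also have "\<dots> = (\<integral>\<^sup>+ z. gap_potential D \<omega> z * indicator K z + gap_potential D \<omega> z * indicator (- K) z \<partial>\<mu>)"
    by (rule nn_integral_add[symmetric]) measurable
  also have "\<dots> = mutual_energy D \<mu> \<omega>"
    unfolding mutual_energy_def by (rule nn_integral_cong) (simp add: indicator_def)
  also have "\<dots> = mutual_energy D \<omega> \<mu>" by (rule mutual_energy_commute[OF \<mu>_prob \<mu>_sets P\<omega>(1,2)])
  finally have frost: "mutual_energy D \<omega> \<omega> \<le> mutual_energy D \<omega> \<mu>" unfolding E(1) .
  have \<omega>_ball: "\<omega> \<in> prob_measures_on (cball 0 \<rho>)"
    by (rule prob_measures_on_mono[OF \<omega> K(3) _ Kb]) simp
  have \<mu>_eq: "\<mu> = \<omega>"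
    by (rule energy_minimizer_eqI[OF \<omega>_ball \<mu>_ball D _ frost]) (simp_all add: E(1) \<mu>_en)
  have "(\<lambda>j. LINT z|m (t j). f z) \<longlonglongrightarrow> (LINT z|\<omega>. f z)" if f: "continuous_on UNIV f" for f :: "complex \<Rightarrow> real"
  proof -
    have fm: "f \<in> borel_measurable borel" using f by (rule borel_measurable_continuous_onI)
    have "bounded (f ` cball 0 (10 * \<rho>))"
      by (intro compact_imp_bounded compact_continuous_image continuous_on_subset[OF f]) auto
    then obtain B where B: "\<And>z. z \<in> cball 0 (10 * \<rho>) \<Longrightarrow> norm (f z) \<le> B" unfolding bounded_iff by blast
    have "(\<lambda>j. LINT \<omega>|\<Omega>1. f (Z j \<omega>)) \<longlonglongrightarrow> (LINT \<omega>|\<Omega>1. f (Y \<omega>))"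
    proof (rule integral_dominated_convergence[where w = "\<lambda>_. B"])
      show "(\<lambda>\<omega>. f (Y \<omega>)) \<in> borel_measurable \<Omega>1" by (rule measurable_compose[OF X(2) fm])
      show "(\<lambda>\<omega>. f (Z j \<omega>)) \<in> borel_measurable \<Omega>1" for j by (rule measurable_compose[OF Z fm])
      show "AE \<omega> in \<Omega>1. (\<lambda>j. f (Z j \<omega>)) \<longlonglongrightarrow> f (Y \<omega>)"
        by (intro AE_I2 continuous_on_tendsto_compose[OF f] limZ) auto
      show "AE \<omega> in \<Omega>1. norm (f (Z j \<omega>)) \<le> B" for j
        by (intro AE_I2 B) (simp add: bZ)
    qed simp
    then show ?thesis
      unfolding \<mu>_eq[symmetric] \<mu>_def lawZ[symmetric] integral_distr[OF X(2) fm] integral_distr[OF Z fm] .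
  qed
  with t show ?thesis by blast
qed

text \<open>One number \<open>I\<close> serves every admissible scale: \<open>log_energy\<close>
  does not involve \<open>D\<close>, so the gap energy at scale \<open>D\<close> has to be
  \<open>ln D - I\<close>. The choice of \<open>D\<close> can thus wait until the size of the
  preimages is known.\<close>

lemma nonpolar_equilibrium:
  assumes K: "compact K" "\<not> polar K"
  obtains I where "equilibrium_measure K \<in> prob_measures_on K" "log_energy (equilibrium_measure K) = ereal I"
    "\<And>\<rho> D. K \<subseteq> cball 0 \<rho> \<Longrightarrow> \<rho> > 0 \<Longrightarrow> D \<ge> 1 \<Longrightarrow> D \<ge> 2 * \<rho> \<Longrightarrow>
      mutual_energy D (equilibrium_measure K) (equilibrium_measure K) = ennreal (ln D - I) \<and> 0 \<le> ln D - I"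
    "\<And>\<rho> D \<sigma>. K \<subseteq> cball 0 \<rho> \<Longrightarrow> \<rho> > 0 \<Longrightarrow> D \<ge> 1 \<Longrightarrow> D \<ge> 2 * \<rho> \<Longrightarrow> \<sigma> \<in> prob_measures_on K \<Longrightarrow>
      mutual_energy D (equilibrium_measure K) (equilibrium_measure K) \<le> mutual_energy D \<sigma> \<sigma>"
proof -
  have Kc: "closed K" and Kb: "K \<in> sets borel" using K(1) by (auto simp: compact_imp_closed)
  obtain \<nu> where \<nu>: "\<nu> \<in> prob_measures_on K" "log_energy \<nu> \<noteq> - \<infinity>"
    using K(2) unfolding polar_def by blast
  have ball: "\<sigma> \<in> prob_measures_on (cball 0 \<rho>)" if "\<sigma> \<in> prob_measures_on K" "K \<subseteq> cball 0 \<rho>" for \<sigma> \<rho>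
    by (rule prob_measures_on_mono[OF that _ Kb]) simp
  have fin: "mutual_energy D \<nu> \<nu> < \<infinity>" if "K \<subseteq> cball 0 \<rho>" "D \<ge> 1" "D \<ge> 2 * \<rho>" for D \<rho>
    using \<nu>(2) log_energy_gap[OF ball[OF \<nu>(1) that(1)] that(2,3)]
    by (cases "mutual_energy D \<nu> \<nu>") auto
  note eq = equilibrium_measure[OF Kc _ _ _ _ \<nu>(1) fin]
  obtain B where B: "\<And>z. z \<in> K \<Longrightarrow> cmod z \<le> B"
    using compact_imp_bounded[OF K(1)] unfolding bounded_iff by blast
  have K0: "K \<subseteq> cball 0 (\<bar>B\<bar> + 1)"
  proof
    fix z assume "z \<in> K"
    then show "z \<in> cball 0 (\<bar>B\<bar> + 1)" using B[of z] by simp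
  qed
  define \<omega> where "\<omega> = equilibrium_measure K"
  define D0 where "D0 = 2 * (\<bar>B\<bar> + 1)"
  have D0: "D0 \<ge> 1" "D0 \<ge> 2 * (\<bar>B\<bar> + 1)" by (auto simp: D0_def)
  have \<omega>: "\<omega> \<in> prob_measures_on K"
    unfolding \<omega>_def by (rule eq(1)[OF K0 _ D0 K0 D0]) simp
  have min: "mutual_energy D \<omega> \<omega> \<le> mutual_energy D \<sigma> \<sigma>"
    if "K \<subseteq> cball 0 \<rho>" "\<rho> > 0" "D \<ge> 1" "D \<ge> 2 * \<rho>" "\<sigma> \<in> prob_measures_on K" for \<rho> D \<sigma>
    unfolding \<omega>_def by (rule eq(2)[OF that(1-4) that(1,3,4) that(5)])
  have val: "\<exists>e\<ge>0. mutual_energy D \<omega> \<omega> = ennreal e \<and> log_energy \<omega> = ereal (ln D - e)"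
    if "K \<subseteq> cball 0 \<rho>" "\<rho> > 0" "D \<ge> 1" "D \<ge> 2 * \<rho>" for \<rho> D
  proof -
    have "mutual_energy D \<omega> \<omega> < \<infinity>"
      by (rule order_le_less_trans[OF min[OF that \<nu>(1)] fin[OF that(1,3,4)]])
    then obtain e where e: "e \<ge> 0" "mutual_energy D \<omega> \<omega> = ennreal e" by (cases "mutual_energy D \<omega> \<omega>") auto
    have "log_energy \<omega> = ereal (ln D - e)"
      unfolding log_energy_gap[OF ball[OF \<omega> that(1)] that(3,4)] e(2) using e(1) by (simp add: ennreal.rep_eq)
    with e show ?thesis by blast
  qed
  have "0 < \<bar>B\<bar> + 1" by simp
  from val[OF K0 this D0] obtain e0 where e0: "log_energy \<omega> = ereal (ln D0 - e0)" by blast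
  define I where "I = ln D0 - e0"
  show thesis
  proof (rule that[of I, folded \<omega>_def, OF \<omega> _ _ min])
    show "log_energy \<omega> = ereal I" unfolding I_def by (rule e0)
    show "mutual_energy D \<omega> \<omega> = ennreal (ln D - I) \<and> 0 \<le> ln D - I"
      if KD: "K \<subseteq> cball 0 \<rho>" "\<rho> > 0" "D \<ge> 1" "D \<ge> 2 * \<rho>" for \<rho> D
    proof -
      obtain e where e: "e \<ge> 0" "mutual_energy D \<omega> \<omega> = ennreal e" "log_energy \<omega> = ereal (ln D - e)"
        using val[OF KD] by blast
      then have "ln D - e = I" using e0 by (simp add: I_def)
      then have "e = ln D - I" by simp
      then show ?thesis using e by simp
    qed
  qed
qed

section \<open>Consequences of regularity, and the assembly\<close>

lemma green_log_pot:
  assumes K: "compact K" and \<omega>: "equilibrium_measure K \<in> prob_measures_on K"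
    and I: "log_energy (equilibrium_measure K) = ereal I" and z: "z \<notin> K"
  shows "green K z = log_pot (equilibrium_measure K) z - I"
  unfolding green_def I log_potential_log_pot[OF \<omega> K z] by simp

text \<open>Comparison at infinity: both potentials are \<open>ln |z| + o(1)\<close>.\<close>

lemma leading_coefficient_limit:
  assumes \<omega>: "\<omega> \<in> prob_measures_on (cball 0 \<rho>)"
    and \<tau>: "\<forall>\<^sub>F k in sequentially. \<tau> k \<in> prob_measures_on (cball 0 \<rho>)"
    and close: "\<And>e. e > 0 \<Longrightarrow> \<forall>\<^sub>F k in sequentially. \<forall>z. R \<le> cmod z \<longrightarrow>
      \<bar>a k + log_pot (\<tau> k) z - (log_pot \<omega> z - I)\<bar> < e"
  shows "a \<longlonglongrightarrow> - I"
proof (rule tendstoI)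
  fix e :: real assume e: "e > 0"
  have "((\<lambda>x. ln (x + \<rho>) - ln (x - \<rho>)) \<longlongrightarrow> 0) at_top" by real_asymp
  then have "\<forall>\<^sub>F x in at_top. ln (x + \<rho>) - ln (x - \<rho>) < e / 2"
    using e by (intro order_tendstoD(2)) auto
  moreover have "\<forall>\<^sub>F x in at_top. x > max (max R \<rho>) 0" by (rule eventually_gt_at_top)
  ultimately have "\<forall>\<^sub>F x in at_top. ln (x + \<rho>) - ln (x - \<rho>) < e / 2 \<and> x > max (max R \<rho>) 0"
    by (rule eventually_conj)
  then obtain x where x: "ln (x + \<rho>) - ln (x - \<rho>) < e / 2" "x > max (max R \<rho>) 0"
    using eventually_happens'[OF trivial_limit_at_top_linorder] by blast
  define z where "z = complex_of_real x"
  have z: "cmod z = x" using x by (simp add: z_def)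
  have "\<rho> < cmod z" "R \<le> cmod z" using x z by auto
  note b = log_pot_bounds[OF _ compact_cball order_refl \<open>\<rho> < cmod z\<close>]
  show "\<forall>\<^sub>F k in sequentially. dist (a k) (- I) < e"
    using \<tau> close[OF half_gt_zero[OF e]]
  proof eventually_elim
    case (elim k)
    then have "\<bar>a k + log_pot (\<tau> k) z - (log_pot \<omega> z - I)\<bar> < e / 2" using \<open>R \<le> cmod z\<close> by blast
    then show ?case
      using b[OF \<omega>] b[OF elim(1)] x(1) unfolding z dist_real_def by linarith
  qed
qed

text \<open>The pull-back of a near-maximiser on \<open>L\<close> is a competitor of finite energy
  on the preimage, so the equilibrium measure there is well defined and has at most this gap energy.
  The auxiliary \<open>ln D'\<close> cancels in \<open>c + x\<close>.\<close>

lemma preimage_equilibrium_energy: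
  fixes q :: "complex poly"
  assumes q: "degree q > 0" and L: "compact L" "L \<subseteq> cball 0 s" "capacity L > 0"
    and E: "poly q -` L \<subseteq> cball 0 \<rho>" "\<rho> > 0"
    and D: "D \<ge> 1" "D \<ge> 2 * \<rho>" and D': "D' \<ge> 1" "D' \<ge> 2 * s"
    and c: "degree q * ln D + ln (cmod (lead_coeff q)) - ln D' \<ge> 0"
  shows "equilibrium_measure (poly q -` L) \<in> prob_measures_on (poly q -` L)"
    and "mutual_energy D (equilibrium_measure (poly q -` L)) (equilibrium_measure (poly q -` L))
      \<le> ennreal (ln D + ln (cmod (lead_coeff q)) / degree q - ln (capacity L) / degree q + ln 2 / degree q)"
proof -
  define n where "n = real (degree q)"
  define c where "c = n * ln D + ln (cmod (lead_coeff q)) - ln D'"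
  have n: "n > 0" using q by (simp add: n_def)
  have c0: "c \<ge> 0" using \<open>degree q * ln D + ln (cmod (lead_coeff q)) - ln D' \<ge> 0\<close> by (simp add: c_def n_def)
  have Lc: "closed L" and Lb: "L \<in> sets borel" using L(1) by (auto simp: compact_imp_closed)
  have Ec: "closed (poly q -` L)" by (intro continuous_closed_vimage Lc) simp
  have D0: "D > 0" "D' > 0" using D D' by auto
  define x where "x = ln D' - ln (capacity L) + ln 2"
  obtain \<nu> where \<nu>: "\<nu> \<in> prob_measures_on L" "mutual_energy D' \<nu> \<nu> \<le> ennreal x" "0 \<le> x"
    unfolding x_def by (rule capacity_near_maximizer[OF L(3,2) Lb D'])
  obtain \<mu> where \<mu>: "\<mu> \<in> prob_measures_on (poly q -` L)"
    and en: "mutual_energy D \<mu> \<mu> = ennreal (1 / degree q) * (ennreal c + mutual_energy D' \<nu> \<nu>)"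
    by (rule pullback_measure[OF q L(2) Lb E(1) D0(1) D(2) D0(2) D'(2) _ c0 \<nu>(1)]) (simp_all add: c_def n_def)
  have "mutual_energy D \<mu> \<mu> \<le> ennreal (1 / n) * (ennreal c + ennreal x)"
    unfolding en n_def by (intro mult_left_mono add_left_mono \<nu>) simp
  also have "\<dots> = ennreal ((c + x) / n)"
    using c0 \<nu>(3) n by (simp flip: ennreal_plus ennreal_mult)
  also have "(c + x) / n = ln D + ln (cmod (lead_coeff q)) / n - ln (capacity L) / n + ln 2 / n"
    using n by (simp add: c_def x_def field_simps)
  finally have le: "mutual_energy D \<mu> \<mu> \<le> ennreal (ln D + ln (cmod (lead_coeff q)) / n - ln (capacity L) / n + ln 2 / n)" .
  then have fin: "mutual_energy D \<mu> \<mu> < \<infinity>" by (rule order_le_less_trans) simp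
  note eq = equilibrium_measure[OF Ec E D \<mu> fin]
  show "equilibrium_measure (poly q -` L) \<in> prob_measures_on (poly q -` L)" by (rule eq(1))
  show "mutual_energy D (equilibrium_measure (poly q -` L)) (equilibrium_measure (poly q -` L))
      \<le> ennreal (ln D + ln (cmod (lead_coeff q)) / degree q - ln (capacity L) / degree q + ln 2 / degree q)"
    using order_trans[OF eq(2)[OF \<mu>] le] unfolding n_def .
qed

theorem theorem4:
  fixes K :: "complex set"
    and q :: "nat \<Rightarrow> complex poly"
    and L :: "nat \<Rightarrow> complex set"
  assumes "compact K" and "\<not> polar K" and "polynomially_convex K"
    and "filterlim (\<lambda>k. degree (q k)) at_top sequentially"
    and "\<And>k. compact (L k)"
    and "log_capacity_smallo L (\<lambda>k. degree (q k))"
    and "\<exists>N. \<exists>r>0. \<forall>k\<ge>N. L k \<subseteq> ball 0 r"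
    and "regular_wrt K q"
    and "centers_on q K"
  shows "weak_star_tendsto (\<lambda>k. equilibrium_measure (poly (q k) -` L k)) (equilibrium_measure K)"
proof -
  note K = \<open>compact K\<close>
  define \<omega> where "\<omega> = equilibrium_measure K"
  obtain I where \<omega>: "\<omega> \<in> prob_measures_on K" and I: "log_energy \<omega> = ereal I"
    and en\<omega>: "\<And>\<rho> D. K \<subseteq> cball 0 \<rho> \<Longrightarrow> \<rho> > 0 \<Longrightarrow> D \<ge> 1 \<Longrightarrow> D \<ge> 2 * \<rho> \<Longrightarrow>
      mutual_energy D \<omega> \<omega> = ennreal (ln D - I) \<and> 0 \<le> ln D - I"
    and min: "\<And>\<rho> D \<sigma>. K \<subseteq> cball 0 \<rho> \<Longrightarrow> \<rho> > 0 \<Longrightarrow> D \<ge> 1 \<Longrightarrow> D \<ge> 2 * \<rho> \<Longrightarrow> \<sigma> \<in> prob_measures_on K \<Longrightarrow>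
      mutual_energy D \<omega> \<omega> \<le> mutual_energy D \<sigma> \<sigma>"
    by (rule nonpolar_equilibrium[OF K \<open>\<not> polar K\<close>, folded \<omega>_def]) (rule that)
  have green: "green K z = log_pot \<omega> z - I" if "z \<notin> K" for z
    using green_log_pot[OF K \<omega>[unfolded \<omega>_def] I[unfolded \<omega>_def] that] by (simp add: \<omega>_def)
  obtain R where R: "R > 0" "K \<subseteq> ball 0 R"
    and nz: "\<forall>\<^sub>F k in sequentially. \<forall>z\<in>- ball 0 R. poly (q k) z \<noteq> 0"
    and unif: "uniform_limit (- ball 0 R) (\<lambda>k z. ln (cmod (poly (q k) z)) / real (degree (q k))) (green K) sequentially"
    using \<open>regular_wrt K q\<close> unfolding regular_wrt_def by blast
  obtain Nc Rc where Rc: "Rc > 0" "\<And>k. k \<ge> Nc \<Longrightarrow> poly (q k) -` {0} \<subseteq> ball 0 Rc"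
    and cent: "\<And>A. closed A \<Longrightarrow> A \<inter> K = {} \<Longrightarrow> \<exists>M>0. \<forall>k\<ge>Nc. size {# z \<in># proots (q k). z \<in> A #} \<le> M"
    using \<open>centers_on q K\<close> unfolding centers_on_def by blast
  obtain Nl s where s: "s > 0" "\<And>k. k \<ge> Nl \<Longrightarrow> L k \<subseteq> ball 0 s"
    using \<open>\<exists>N. \<exists>r>0. \<forall>k\<ge>N. L k \<subseteq> ball 0 r\<close> by blast
  have cap: "\<forall>\<^sub>F k in sequentially. capacity (L k) > 0"
    and small: "(\<lambda>k. ln (capacity (L k))) \<in> o(\<lambda>k. real (degree (q k)))"
    using \<open>log_capacity_smallo L (\<lambda>k. degree (q k))\<close> unfolding log_capacity_smallo_def by blast+
  define n where "n k = real (degree (q k))" for k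
  define a where "a k = ln (cmod (lead_coeff (q k))) / n k" for k
  define \<tau> where "\<tau> k = root_measure (q k)" for k
  define \<rho>1 where "\<rho>1 = max R Rc"
  have \<rho>1: "\<rho>1 > 0" "K \<subseteq> cball 0 \<rho>1" using R by (auto simp: \<rho>1_def)
  have n_top: "filterlim n at_top sequentially"
    unfolding n_def by (intro filterlim_compose[OF filterlim_real_sequentially] assms(4))
  then have n_ev: "\<forall>\<^sub>F k in sequentially. c \<le> n k" for c unfolding filterlim_at_top by blast
  have deg: "\<forall>\<^sub>F k in sequentially. degree (q k) > 0"
    using n_ev[of 1] by eventually_elim (simp add: n_def)
  have roots: "\<forall>\<^sub>F k in sequentially. \<tau> k \<in> prob_measures_on (cball 0 \<rho>1)"
    using deg eventually_ge_at_top[of Nc]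
  proof eventually_elim
    case (elim k)
    have "ball 0 Rc \<subseteq> cball (0 :: complex) \<rho>1" by (auto simp: \<rho>1_def)
    then show ?case
      unfolding \<tau>_def using Rc(2)[OF elim(2)] by (intro root_measure_prob_measures_on elim) auto
  qed
  \<comment> \<open>Regularity in terms of potentials: \<open>ln |q k|\<close> over the degree is
    \<open>a k\<close> plus the potential of the zeros, and the Green's function is the potential of
    \<omega> minus \<open>I\<close>.\<close>
  have close: "\<forall>\<^sub>F k in sequentially. \<forall>z. R \<le> cmod z \<longrightarrow> \<bar>a k + log_pot (\<tau> k) z - (log_pot \<omega> z - I)\<bar> < e"
    if e: "e > 0" for e
    using uniform_limitD[OF unif e] nz deg
  proof eventually_elim
    case (elim k)
    show ?case
    proof (intro allI impI)
      fix z :: complex assume "R \<le> cmod z"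
      then have z: "z \<in> - ball 0 R" by simp
      then have "z \<notin> K" using R by blast
      have "poly (q k) z \<noteq> 0" using elim(2) z by blast
      from log_pot_root_measure[OF elim(3) this]
      have "ln (cmod (poly (q k) z)) / degree (q k) = a k + log_pot (\<tau> k) z"
        by (simp add: a_def n_def \<tau>_def)
      moreover have "dist (ln (cmod (poly (q k) z)) / degree (q k)) (green K z) < e"
        using elim(1) z by blast
      ultimately show "\<bar>a k + log_pot (\<tau> k) z - (log_pot \<omega> z - I)\<bar> < e"
        unfolding green[OF \<open>z \<notin> K\<close>] dist_real_def by simp
    qed
  qed
  have \<omega>_ball: "\<omega> \<in> prob_measures_on (cball 0 \<rho>1)"
    by (rule prob_measures_on_mono[OF \<omega> \<rho>1(2)]) (simp_all add: K borel_compact)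
  have a_lim: "a \<longlonglongrightarrow> - I" by (rule leading_coefficient_limit[OF \<omega>_ball roots close])
  \<comment> \<open>Beyond \<open>R1\<close> the potential of \<omega> exceeds \<open>I + 2\<close>,
    so \<open>ln |q k| / n k > 1\<close> once the uniform error is below 1. With
    \<open>n k \<ge> ln s\<close> this gives \<open>|q k| > s\<close>, and the point is not in the
    preimage.\<close>
  define R1 where "R1 = \<rho>1 + exp (I + 2)"
  have preimage: "\<forall>\<^sub>F k in sequentially. poly (q k) -` L k \<subseteq> cball 0 R1"
    using close[OF zero_less_one] nz deg eventually_ge_at_top[of Nl] n_ev[of "ln s"]
  proof eventually_elim
    case (elim k)
    show ?case
    proof (rule subsetI, rule ccontr)
      fix z assume z: "z \<in> poly (q k) -` L k" "z \<notin> cball 0 R1"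
      have zR1: "R1 < cmod z" using z by simp
      have zR: "R \<le> cmod z" and z\<rho>: "\<rho>1 < cmod z" and ez: "exp (I + 2) < cmod z - \<rho>1"
        using zR1 exp_gt_zero[of "I + 2"] unfolding R1_def \<rho>1_def by linarith+
      have nzz: "poly (q k) z \<noteq> 0" using elim(2) zR by auto
      have "ln (exp (I + 2)) < ln (cmod z - \<rho>1)" using ez z\<rho> by (subst ln_less_cancel_iff) auto
      also have "\<dots> \<le> log_pot \<omega> z" by (rule log_pot_bounds(1)[OF \<omega>_ball compact_cball order_refl z\<rho>])
      finally have "1 < a k + log_pot (\<tau> k) z" using elim(1) zR by force
      then have "1 < ln (cmod (poly (q k) z)) / n k"
        using log_pot_root_measure[OF elim(3) nzz] by (simp add: a_def n_def \<tau>_def)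
      then have "n k < ln (cmod (poly (q k) z))" using elim(3) by (simp add: n_def pos_less_divide_eq)
      then have "ln s < ln (cmod (poly (q k) z))" using elim(5) by linarith
      then have "s < cmod (poly (q k) z)" using s(1) nzz by (subst (asm) ln_less_cancel_iff) auto
      moreover have "poly (q k) z \<in> ball 0 s" using z(1) s(2)[OF elim(4)] by blast
      ultimately show False by simp
    qed
  qed
  define \<rho> where "\<rho> = max \<rho>1 R1"
  have \<rho>: "\<rho> > 0" "K \<subseteq> cball 0 \<rho>" "cball 0 \<rho>1 \<subseteq> cball (0 :: complex) \<rho>" "cball 0 R1 \<subseteq> cball (0 :: complex) \<rho>"
    using \<rho>1 by (auto simp: \<rho>_def)
  \<comment> \<open>Besides bounding diameters, \<open>D\<close> has to make the constant
    \<open>c\<close> of the pull-back nonnegative: eventually \<open>a k > - I - 1\<close>, so the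
    exponential gives \<open>ln D + a k \<ge> 1\<close>, and \<open>n k \<ge> ln D'\<close> does the
    rest.\<close>
  define D where "D = max (max 1 (2 * \<rho>)) (exp (\<bar>I\<bar> + 2))"
  have D: "D \<ge> 1" "D \<ge> 2 * \<rho>" "D \<ge> exp (\<bar>I\<bar> + 2)" by (auto simp: D_def)
  have D0: "D > 0" using D by simp
  have "ln (exp (\<bar>I\<bar> + 2)) \<le> ln D" using D by (intro ln_mono) auto
  then have lnD: "\<bar>I\<bar> + 2 \<le> ln D" by simp
  define D' where "D' = max 1 (2 * s)"
  have D': "D' \<ge> 1" "D' \<ge> 2 * s" by (auto simp: D'_def)
  define m where "m k = equilibrium_measure (poly (q k) -` L k)" for k
  define b where "b k = ln D + a k - ln (capacity (L k)) / n k + ln 2 / n k" for k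
  have b_lim: "b \<longlonglongrightarrow> ln D - I"
  proof -
    have "(\<lambda>k. ln (capacity (L k)) / n k) \<longlonglongrightarrow> 0"
      using smalloD_tendsto[OF small] by (simp add: n_def)
    moreover have "(\<lambda>k. ln 2 / n k) \<longlonglongrightarrow> 0"
      by (intro tendsto_divide_0[OF tendsto_const] filterlim_at_top_imp_at_infinity n_top)
    ultimately have "b \<longlonglongrightarrow> ln D + - I - 0 + 0"
      unfolding b_def by (intro tendsto_intros a_lim)
    then show ?thesis by simp
  qed
  have a_ev: "\<forall>\<^sub>F k in sequentially. - I - 1 < a k"
    by (rule order_tendstoD(1)[OF a_lim]) simp
  have energy: "\<forall>\<^sub>F k in sequentially. m k \<in> prob_measures_on (poly (q k) -` L k) \<and>
      mutual_energy D (m k) (m k) \<le> ennreal (b k)"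
    using deg preimage cap eventually_ge_at_top[of Nl] a_ev n_ev[of "ln D'"]
  proof eventually_elim
    case (elim k)
    have Ls: "L k \<subseteq> cball 0 s" using s(2)[OF elim(4)] by auto
    have pre: "poly (q k) -` L k \<subseteq> cball 0 \<rho>" using elim(2) \<rho>(4) by blast
    have nk: "n k > 0" using elim(1) by (simp add: n_def)
    have "1 \<le> ln D + a k" using lnD elim(5) by linarith
    then have "n k * 1 \<le> n k * (ln D + a k)" using nk by (intro mult_left_mono) auto
    then have "ln D' \<le> n k * (ln D + a k)" using elim(6) by linarith
    also have "\<dots> = n k * ln D + ln (cmod (lead_coeff (q k)))" using nk by (simp add: a_def distrib_left)
    finally have c: "degree (q k) * ln D + ln (cmod (lead_coeff (q k))) - ln D' \<ge> 0" by (simp add: n_def)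
    note pe = preimage_equilibrium_energy[OF elim(1) assms(5) Ls elim(3) pre \<rho>(1) D(1,2) D' c]
    show ?case
      unfolding m_def b_def a_def n_def using pe by blast
  qed
  have "\<forall>\<^sub>F k in sequentially. degree (q k) > 0 \<and> \<tau> k \<in> prob_measures_on (cball 0 \<rho>1) \<and>
      poly (q k) -` L k \<subseteq> cball 0 R1 \<and> m k \<in> prob_measures_on (poly (q k) -` L k) \<and>
      mutual_energy D (m k) (m k) \<le> ennreal (b k) \<and> k \<ge> Nl \<and> k \<ge> Nc"
    using deg roots preimage energy eventually_ge_at_top[of Nl] eventually_ge_at_top[of Nc]
    by eventually_elim blast
  then obtain k0 where good: "\<And>k. k \<ge> k0 \<Longrightarrow> degree (q k) > 0 \<and> \<tau> k \<in> prob_measures_on (cball 0 \<rho>1) \<and>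
      poly (q k) -` L k \<subseteq> cball 0 R1 \<and> m k \<in> prob_measures_on (poly (q k) -` L k) \<and>
      mutual_energy D (m k) (m k) \<le> ennreal (b k) \<and> k \<ge> Nl \<and> k \<ge> Nc"
    unfolding eventually_sequentially by blast
  have pot_lim: "(\<lambda>k. log_pot (\<tau> k) z) \<longlonglongrightarrow> log_pot \<omega> z" if z: "cmod z > R" for z
  proof -
    have "(\<lambda>k. a k + log_pot (\<tau> k) z) \<longlonglongrightarrow> log_pot \<omega> z - I"
    proof (rule tendstoI)
      fix e :: real assume "e > 0"
      from close[OF this] show "\<forall>\<^sub>F k in sequentially. dist (a k + log_pot (\<tau> k) z) (log_pot \<omega> z - I) < e"
        by eventually_elim (use z in \<open>simp add: dist_real_def\<close>)
    qed
    from tendsto_diff[OF this a_lim] show ?thesis by simp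
  qed
  have "(\<lambda>k. LINT z|m k. f z) \<longlonglongrightarrow> (LINT z|\<omega>. f z)" if f: "continuous_on UNIV f" for f :: "complex \<Rightarrow> real"
  proof (rule LIMSEQ_subsubseqI)
    fix u :: "nat \<Rightarrow> nat" assume u: "strict_mono u"
    \<comment> \<open>The shift by \<open>k0\<close> makes all eventual conditions hold for every
      index. It is undone at the end through \<open>v (t j) = u (t j + k0)\<close>.\<close>
    define v where "v j = u (j + k0)" for j
    have v: "strict_mono v" using u by (auto simp: v_def strict_mono_def)
    have vk: "v j \<ge> k0" for j
      using seq_suble[OF u, of "j + k0"] unfolding v_def by linarith
    note g = good[OF vk]
    have "\<exists>t. strict_mono (t :: nat \<Rightarrow> nat) \<and>
      (\<forall>f :: complex \<Rightarrow> real. continuous_on UNIV f \<longrightarrow> (\<lambda>j. LINT z|m (v (t j)). f z) \<longlonglongrightarrow> (LINT z|\<omega>. f z))"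
    proof (rule equilibrium_subsequence[where p = "\<lambda>j. q (v j)" and b = "\<lambda>j. b (v j)" and s = s and R = R,
          OF K _ \<rho>(2,1) \<omega> min[OF \<rho>(2,1) D(1,2)] conjunct1[OF en\<omega>[OF \<rho>(2,1) D(1,2)]]
          conjunct2[OF en\<omega>[OF \<rho>(2,1) D(1,2)]] D0 D(2)])
      show "connected (- K)" using \<open>polynomially_convex K\<close> by (simp add: polynomially_convex_def)
      show "0 < degree (q (v j))" for j using g by blast
      show "filterlim (\<lambda>j. degree (q (v j))) at_top sequentially"
        by (rule filterlim_compose[OF assms(4) filterlim_subseq[OF v]])
      have mE: "m (v j) \<in> prob_measures_on (poly (q (v j)) -` L (v j))" for j using g by blast
      have Eb: "poly (q (v j)) -` L (v j) \<in> sets borel" for j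
        by (intro borel_closed continuous_closed_vimage compact_imp_closed assms(5)) simp
      have Esub: "poly (q (v j)) -` L (v j) \<subseteq> cball 0 \<rho>" for j using g \<rho>(4) by blast
      show "m (v j) \<in> prob_measures_on (cball 0 \<rho>)" for j
        by (rule prob_measures_on_mono[OF mE Esub _ Eb]) simp
      show "AE z in m (v j). cmod (poly (q (v j)) z) \<le> s" for j
      proof (rule eventually_mono[OF prob_measures_on_AE[OF mE Eb]])
        fix z assume "z \<in> poly (q (v j)) -` L (v j)"
        moreover have "L (v j) \<subseteq> ball 0 s" using g by (intro s(2)) blast
        ultimately have "poly (q (v j)) z \<in> ball 0 s" by blast
        then show "cmod (poly (q (v j)) z) \<le> s" by simp
      qed
      show "0 < s" by (rule s)
      show "mutual_energy D (m (v j)) (m (v j)) \<le> ennreal (b (v j))" for j using g by blast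
      show "(\<lambda>j. b (v j)) \<longlonglongrightarrow> ln D - I"
        using LIMSEQ_subseq_LIMSEQ[OF b_lim v] by (simp add: o_def)
      have \<tau>1: "\<tau> (v j) \<in> prob_measures_on (cball 0 \<rho>1)" for j using g by blast
      show "root_measure (q (v j)) \<in> prob_measures_on (cball 0 \<rho>)" for j
        by (rule prob_measures_on_mono[OF \<tau>1[unfolded \<tau>_def] \<rho>(3)]) simp_all
      show "\<exists>M. \<forall>j. size {#z \<in># proots (q (v j)). z \<in> A#} \<le> M" if A: "closed A" "A \<inter> K = {}" for A
      proof -
        obtain M where "\<forall>k\<ge>Nc. size {# z \<in># proots (q k). z \<in> A #} \<le> M" using cent[OF A] by blast
        then show ?thesis using g by blast
      qed
      show "(\<lambda>j. ln (cmod (lead_coeff (q (v j)))) / degree (q (v j))) \<longlonglongrightarrow> ln D - I - ln D"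
        using LIMSEQ_subseq_LIMSEQ[OF a_lim v] by (simp add: o_def a_def n_def)
      show "(\<lambda>j. log_pot (root_measure (q (v j))) z) \<longlonglongrightarrow> log_pot \<omega> z" if "cmod z > R" for z
        using LIMSEQ_subseq_LIMSEQ[OF pot_lim[OF that] v] by (simp add: o_def \<tau>_def)
    qed
    then obtain t where t: "strict_mono (t :: nat \<Rightarrow> nat)"
      and lim: "(\<lambda>j. LINT z|m (v (t j)). f z) \<longlonglongrightarrow> (LINT z|\<omega>. f z)" using f by blast
    have "strict_mono (\<lambda>j. t j + k0)" using t by (auto simp: strict_mono_def)
    then show "\<exists>t. strict_mono t \<and> (\<lambda>j. LINT z|m (u (t j)). f z) \<longlonglongrightarrow> (LINT z|\<omega>. f z)"
      using lim unfolding v_def by blast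
  qed
  then show ?thesis
    unfolding weak_star_tendsto_def m_def \<omega>_def by blast
qed

end
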